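(* Let $V$ and $W$ be vector spaces over a field $\Phi$ with $V\cap W=(0)$, and let $L(V\oplus W)$ be the free Lie algebra on $V\oplus W$. Let $M = U(L(V))\cdot W\subseteq L(V\oplus W)$, and let $A\subset L(V)$ and $B\subset M$ be arbitrary subspaces. Put $$\mathfrak g = L(V)/\langle A\rangle_{L(V)},\qquad M_1=[M,\langle A\rangle_{L(V)}]+U(L(V))\cdot B,\qquad N=M/M_1 .$$ Then: (1) The space $N$ is a $\mathfrak g$-module (under the action induced by the adjoint action of $L(V)$ on $M$). (2) $L(N)$ is isomorphic as a $\mathfrak g$-module to the ideal of $L(V\oplus W)/\langle A,B\rangle_{L(V\oplus W)}$ generated by the image of $W$. (3) $L(V\oplus W)/\langle A,B\rangle_{L(V\oplus W)}\cong \mathfrak g\ltimes L(N)$ as Lie algebras.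
   Context: All vector spaces and Lie algebras are over a field $\Phi$, and vector spaces may be infinite dimensional. $L(X)$ denotes the free Lie algebra on the vector space $X$; $L(V)$ is regarded as a subalgebra of $L(V\oplus W)$. $U(\mathfrak r)$ is the universal enveloping algebra of a Lie algebra $\mathfrak r$, acting on $\mathfrak r$ (and on Lie algebras containing $\mathfrak r$) via the adjoint action, and $a\cdot b$ denotes the image of $b$ under the action of $a\in U(\mathfrak r)$; $U(L(V))\cdot W$ and $U(L(V))\cdot B$ denote the linear spans of all $a\cdot b$ with $a\in U(L(V))$ and $b$ in $W$, respectively $B$. For a subset $S$ of a Lie algebra $\mathfrak r$, $\langle S\rangle_{\mathfrak r}$ denotes the ideal of $\mathfrak r$ generated by $S$; $\langle A,B\rangle_{\mathfrak r}$ is the ideal generated by $A\cup B$. $[M,\langle A\rangle_{L(V)}]$ is the linear span of the brackets $[m,a]$, $m\in M$, $a\in\langle A\rangle_{L(V)}$, in $L(V\oplus W)$. When $N$ is a $\mathfrak g$-module, $\mathfrak g$ acts on $L(N)$ by the unique derivations extending its action on $N$, and $\mathfrak g\ltimes L(N)$ is the corresponding semidirect product, with $L(N)$ as ideal. The Lie algebra $\mathfrak g$ acts on the ideal in (2) by the adjoint action via the homomorphism $\mathfrak g\to L(V\oplus W)/\langle A,B\rangle_{L(V\oplus W)}$ induced by the inclusion $L(V)\subset L(V\oplus W)$. *)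

theory Defs
  imports "HOL-Algebra.QuotRing" "HOL-Algebra.Module" "HOL.Hull"
begin

section \<open>Lie algebras and their modules\<close>

text \<open>
  A Lie algebra over the field \<open>K\<close> is a \<^const>\<open>module\<close>-style record whose \<^const>\<open>mult\<close> field is
  the Lie bracket: \<open>x \<otimes>\<^bsub>L\<^esub> y\<close> is \<open>[x, y]\<close>. The \<^const>\<open>one\<close> field of the record is never used.
  Where a record of this type only serves as a vector space, its \<^const>\<open>mult\<close> field is irrelevant too.
\<close>

locale lie_algebra = module K L + field K for K (structure) and L (structure) +
  assumes lie_closed: "\<lbrakk>x \<in> carrier L; y \<in> carrier L\<rbrakk> \<Longrightarrow> x \<otimes>\<^bsub>L\<^esub> y \<in> carrier L"
    and lie_add_left: "\<lbrakk>x \<in> carrier L; y \<in> carrier L; z \<in> carrier L\<rbrakk>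
      \<Longrightarrow> (x \<oplus>\<^bsub>L\<^esub> y) \<otimes>\<^bsub>L\<^esub> z = (x \<otimes>\<^bsub>L\<^esub> z) \<oplus>\<^bsub>L\<^esub> (y \<otimes>\<^bsub>L\<^esub> z)"
    and lie_add_right: "\<lbrakk>x \<in> carrier L; y \<in> carrier L; z \<in> carrier L\<rbrakk>
      \<Longrightarrow> x \<otimes>\<^bsub>L\<^esub> (y \<oplus>\<^bsub>L\<^esub> z) = (x \<otimes>\<^bsub>L\<^esub> y) \<oplus>\<^bsub>L\<^esub> (x \<otimes>\<^bsub>L\<^esub> z)"
    and lie_smult_left: "\<lbrakk>c \<in> carrier K; x \<in> carrier L; y \<in> carrier L\<rbrakk>
      \<Longrightarrow> (c \<odot>\<^bsub>L\<^esub> x) \<otimes>\<^bsub>L\<^esub> y = c \<odot>\<^bsub>L\<^esub> (x \<otimes>\<^bsub>L\<^esub> y)"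
    and lie_smult_right: "\<lbrakk>c \<in> carrier K; x \<in> carrier L; y \<in> carrier L\<rbrakk>
      \<Longrightarrow> x \<otimes>\<^bsub>L\<^esub> (c \<odot>\<^bsub>L\<^esub> y) = c \<odot>\<^bsub>L\<^esub> (x \<otimes>\<^bsub>L\<^esub> y)"
    and lie_alternating: "x \<in> carrier L \<Longrightarrow> x \<otimes>\<^bsub>L\<^esub> x = \<zero>\<^bsub>L\<^esub>"
    and lie_jacobi: "\<lbrakk>x \<in> carrier L; y \<in> carrier L; z \<in> carrier L\<rbrakk>
      \<Longrightarrow> (x \<otimes>\<^bsub>L\<^esub> (y \<otimes>\<^bsub>L\<^esub> z)) \<oplus>\<^bsub>L\<^esub> ((y \<otimes>\<^bsub>L\<^esub> (z \<otimes>\<^bsub>L\<^esub> x)) \<oplus>\<^bsub>L\<^esub> (z \<otimes>\<^bsub>L\<^esub> (x \<otimes>\<^bsub>L\<^esub> y))) = \<zero>\<^bsub>L\<^esub>"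

definition lie_hom :: "('k, 'i) ring_scheme \<Rightarrow> ('k, 'a, 'j) module_scheme \<Rightarrow> ('k, 'b, 'l) module_scheme
    \<Rightarrow> ('a \<Rightarrow> 'b) set"
  where "lie_hom K L L' = {f \<in> carrier L \<rightarrow> carrier L'.
    (\<forall>x\<in>carrier L. \<forall>y\<in>carrier L. f (x \<oplus>\<^bsub>L\<^esub> y) = f x \<oplus>\<^bsub>L'\<^esub> f y) \<and>
    (\<forall>c\<in>carrier K. \<forall>x\<in>carrier L. f (c \<odot>\<^bsub>L\<^esub> x) = c \<odot>\<^bsub>L'\<^esub> f x) \<and>
    (\<forall>x\<in>carrier L. \<forall>y\<in>carrier L. f (x \<otimes>\<^bsub>L\<^esub> y) = f x \<otimes>\<^bsub>L'\<^esub> f y)}"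

definition lie_iso :: "('k, 'i) ring_scheme \<Rightarrow> ('k, 'a, 'j) module_scheme \<Rightarrow> ('k, 'b, 'l) module_scheme
    \<Rightarrow> ('a \<Rightarrow> 'b) set"
  where "lie_iso K L L' = {f \<in> lie_hom K L L'. bij_betw f (carrier L) (carrier L')}"

definition lie_ideal :: "('k, 'i) ring_scheme \<Rightarrow> ('k, 'a, 'j) module_scheme \<Rightarrow> 'a set \<Rightarrow> bool"
  where "lie_ideal K L I \<longleftrightarrow> submodule I K L \<and> (\<forall>x\<in>carrier L. \<forall>a\<in>I. x \<otimes>\<^bsub>L\<^esub> a \<in> I)"

definition ideal_gen :: "('k, 'i) ring_scheme \<Rightarrow> ('k, 'a, 'j) module_scheme \<Rightarrow> 'a set \<Rightarrow> 'a set"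
  where "ideal_gen K L S = lie_ideal K L hull S"

definition lin_span :: "('k, 'i) ring_scheme \<Rightarrow> ('k, 'a, 'j) module_scheme \<Rightarrow> 'a set \<Rightarrow> 'a set"
  where "lin_span K L S = (\<lambda>H. submodule H K L) hull S"

text \<open>
  The quotient of a Lie algebra by an ideal, or of a vector space by a subspace (the carrier
  consists of cosets, as in \<^const>\<open>FactRing\<close>).
\<close>

definition lie_quot :: "('k, 'a, 'j) module_scheme \<Rightarrow> 'a set \<Rightarrow> ('k, 'a set) module"
  where "lie_quot L I = ring.extend (L Quot I)
    (module.fields (\<lambda>c C. \<Union>x\<in>C. I +>\<^bsub>L\<^esub> (c \<odot>\<^bsub>L\<^esub> x)))"

locale lie_module = lie_algebra K G + N?: module K N
  for K (structure) and G (structure) and N (structure) +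
  fixes act :: "_ \<Rightarrow> _ \<Rightarrow> _"
  assumes act_closed: "\<lbrakk>x \<in> carrier G; n \<in> carrier N\<rbrakk> \<Longrightarrow> act x n \<in> carrier N"
    and act_add_left: "\<lbrakk>x \<in> carrier G; y \<in> carrier G; n \<in> carrier N\<rbrakk>
      \<Longrightarrow> act (x \<oplus>\<^bsub>G\<^esub> y) n = act x n \<oplus>\<^bsub>N\<^esub> act y n"
    and act_smult_left: "\<lbrakk>c \<in> carrier K; x \<in> carrier G; n \<in> carrier N\<rbrakk>
      \<Longrightarrow> act (c \<odot>\<^bsub>G\<^esub> x) n = c \<odot>\<^bsub>N\<^esub> act x n"
    and act_add_right: "\<lbrakk>x \<in> carrier G; m \<in> carrier N; n \<in> carrier N\<rbrakk>
      \<Longrightarrow> act x (m \<oplus>\<^bsub>N\<^esub> n) = act x m \<oplus>\<^bsub>N\<^esub> act x n"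
    and act_smult_right: "\<lbrakk>c \<in> carrier K; x \<in> carrier G; n \<in> carrier N\<rbrakk>
      \<Longrightarrow> act x (c \<odot>\<^bsub>N\<^esub> n) = c \<odot>\<^bsub>N\<^esub> act x n"
    and act_bracket: "\<lbrakk>x \<in> carrier G; y \<in> carrier G; n \<in> carrier N\<rbrakk>
      \<Longrightarrow> act (x \<otimes>\<^bsub>G\<^esub> y) n = act x (act y n) \<ominus>\<^bsub>N\<^esub> act y (act x n)"

definition lie_module_iso :: "('k, 'i) ring_scheme \<Rightarrow> ('k, 'g, 'j) module_scheme
    \<Rightarrow> ('k, 'a, 'l) module_scheme \<Rightarrow> ('g \<Rightarrow> 'a \<Rightarrow> 'a)
    \<Rightarrow> ('k, 'b, 'm) module_scheme \<Rightarrow> ('g \<Rightarrow> 'b \<Rightarrow> 'b) \<Rightarrow> ('a \<Rightarrow> 'b) set"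
  where "lie_module_iso K G N act N' act' = {f. bij_betw f (carrier N) (carrier N') \<and>
    (\<forall>x\<in>carrier N. \<forall>y\<in>carrier N. f (x \<oplus>\<^bsub>N\<^esub> y) = f x \<oplus>\<^bsub>N'\<^esub> f y) \<and>
    (\<forall>c\<in>carrier K. \<forall>x\<in>carrier N. f (c \<odot>\<^bsub>N\<^esub> x) = c \<odot>\<^bsub>N'\<^esub> f x) \<and>
    (\<forall>g\<in>carrier G. \<forall>x\<in>carrier N. f (act g x) = act' g (f x))}"

text \<open>
  \<open>G \<ltimes> H\<close>, where \<open>G\<close> acts on the Lie algebra \<open>H\<close> by derivations:
  \<open>[(x, a), (y, b)] = ([x, y], x\<cdot>b - y\<cdot>a + [a, b])\<close>.
\<close>

definition lie_semidirect :: "('k, 'a, 'i) module_scheme \<Rightarrow> ('k, 'b, 'j) module_scheme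
    \<Rightarrow> ('a \<Rightarrow> 'b \<Rightarrow> 'b) \<Rightarrow> ('k, 'a \<times> 'b) module"
  where "lie_semidirect G H act =
    \<lparr>carrier = carrier G \<times> carrier H,
     mult = (\<lambda>(x, a) (y, b). (x \<otimes>\<^bsub>G\<^esub> y, (act x b \<ominus>\<^bsub>H\<^esub> act y a) \<oplus>\<^bsub>H\<^esub> (a \<otimes>\<^bsub>H\<^esub> b))),
     one = undefined,
     zero = (\<zero>\<^bsub>G\<^esub>, \<zero>\<^bsub>H\<^esub>),
     add = (\<lambda>(x, a) (y, b). (x \<oplus>\<^bsub>G\<^esub> y, a \<oplus>\<^bsub>H\<^esub> b)),
     smult = (\<lambda>c (x, a). (c \<odot>\<^bsub>G\<^esub> x, c \<odot>\<^bsub>H\<^esub> a))\<rparr>"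


section \<open>Algebras presented by generators and relations\<close>

text \<open>
  \<open>pres_alg K S R\<close> is the (not necessarily associative) \<open>K\<close>-algebra with generators \<open>S\<close> and
  relations \<open>R\<close>: algebra terms modulo the least congruence \<open>alg_cong K S R\<close> that contains \<open>R\<close>
  and validates the vector space axioms and the bilinearity of the product.
\<close>

datatype ('k, 'x) aterm =
    TGen 'x
  | TZero
  | TAdd "('k, 'x) aterm" "('k, 'x) aterm"
  | TSmul 'k "('k, 'x) aterm"
  | TMul "('k, 'x) aterm" "('k, 'x) aterm"

inductive_set aterms :: "('k, 'i) ring_scheme \<Rightarrow> 'x set \<Rightarrow> ('k, 'x) aterm set"
  for K :: "('k, 'i) ring_scheme" and S :: "'x set"
  where
    gen: "x \<in> S \<Longrightarrow> TGen x \<in> aterms K S"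
  | zero: "TZero \<in> aterms K S"
  | add: "\<lbrakk>s \<in> aterms K S; t \<in> aterms K S\<rbrakk> \<Longrightarrow> TAdd s t \<in> aterms K S"
  | smul: "\<lbrakk>c \<in> carrier K; t \<in> aterms K S\<rbrakk> \<Longrightarrow> TSmul c t \<in> aterms K S"
  | mul: "\<lbrakk>s \<in> aterms K S; t \<in> aterms K S\<rbrakk> \<Longrightarrow> TMul s t \<in> aterms K S"

inductive alg_cong :: "('k, 'i) ring_scheme \<Rightarrow> 'x set \<Rightarrow> (('k, 'x) aterm \<times> ('k, 'x) aterm) set
    \<Rightarrow> ('k, 'x) aterm \<Rightarrow> ('k, 'x) aterm \<Rightarrow> bool"
  for K :: "('k, 'i) ring_scheme" and S :: "'x set"
    and R :: "(('k, 'x) aterm \<times> ('k, 'x) aterm) set"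
  where
    rel: "\<lbrakk>(s, t) \<in> R; s \<in> aterms K S; t \<in> aterms K S\<rbrakk> \<Longrightarrow> alg_cong K S R s t"
  | refl: "t \<in> aterms K S \<Longrightarrow> alg_cong K S R t t"
  | sym: "alg_cong K S R s t \<Longrightarrow> alg_cong K S R t s"
  | trans: "\<lbrakk>alg_cong K S R r s; alg_cong K S R s t\<rbrakk> \<Longrightarrow> alg_cong K S R r t"
  | add: "\<lbrakk>alg_cong K S R s s'; alg_cong K S R t t'\<rbrakk> \<Longrightarrow> alg_cong K S R (TAdd s t) (TAdd s' t')"
  | smul: "\<lbrakk>c \<in> carrier K; alg_cong K S R t t'\<rbrakk> \<Longrightarrow> alg_cong K S R (TSmul c t) (TSmul c t')"
  | mul: "\<lbrakk>alg_cong K S R s s'; alg_cong K S R t t'\<rbrakk> \<Longrightarrow> alg_cong K S R (TMul s t) (TMul s' t')"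
  | add_assoc: "\<lbrakk>r \<in> aterms K S; s \<in> aterms K S; t \<in> aterms K S\<rbrakk>
      \<Longrightarrow> alg_cong K S R (TAdd (TAdd r s) t) (TAdd r (TAdd s t))"
  | add_comm: "\<lbrakk>s \<in> aterms K S; t \<in> aterms K S\<rbrakk> \<Longrightarrow> alg_cong K S R (TAdd s t) (TAdd t s)"
  | add_zero: "t \<in> aterms K S \<Longrightarrow> alg_cong K S R (TAdd t TZero) t"
  | zero_smul: "t \<in> aterms K S \<Longrightarrow> alg_cong K S R (TSmul \<zero>\<^bsub>K\<^esub> t) TZero"
  | one_smul: "t \<in> aterms K S \<Longrightarrow> alg_cong K S R (TSmul \<one>\<^bsub>K\<^esub> t) t"
  | smul_smul: "\<lbrakk>c \<in> carrier K; d \<in> carrier K; t \<in> aterms K S\<rbrakk>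
      \<Longrightarrow> alg_cong K S R (TSmul (c \<otimes>\<^bsub>K\<^esub> d) t) (TSmul c (TSmul d t))"
  | add_smul: "\<lbrakk>c \<in> carrier K; d \<in> carrier K; t \<in> aterms K S\<rbrakk>
      \<Longrightarrow> alg_cong K S R (TSmul (c \<oplus>\<^bsub>K\<^esub> d) t) (TAdd (TSmul c t) (TSmul d t))"
  | smul_add: "\<lbrakk>c \<in> carrier K; s \<in> aterms K S; t \<in> aterms K S\<rbrakk>
      \<Longrightarrow> alg_cong K S R (TSmul c (TAdd s t)) (TAdd (TSmul c s) (TSmul c t))"
  | add_mul: "\<lbrakk>r \<in> aterms K S; s \<in> aterms K S; t \<in> aterms K S\<rbrakk>
      \<Longrightarrow> alg_cong K S R (TMul (TAdd r s) t) (TAdd (TMul r t) (TMul s t))"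
  | mul_add: "\<lbrakk>r \<in> aterms K S; s \<in> aterms K S; t \<in> aterms K S\<rbrakk>
      \<Longrightarrow> alg_cong K S R (TMul r (TAdd s t)) (TAdd (TMul r s) (TMul r t))"
  | smul_mul: "\<lbrakk>c \<in> carrier K; s \<in> aterms K S; t \<in> aterms K S\<rbrakk>
      \<Longrightarrow> alg_cong K S R (TMul (TSmul c s) t) (TSmul c (TMul s t))"
  | mul_smul: "\<lbrakk>c \<in> carrier K; s \<in> aterms K S; t \<in> aterms K S\<rbrakk>
      \<Longrightarrow> alg_cong K S R (TMul s (TSmul c t)) (TSmul c (TMul s t))"

definition alg_class :: "('k, 'i) ring_scheme \<Rightarrow> 'x set \<Rightarrow> (('k, 'x) aterm \<times> ('k, 'x) aterm) set
    \<Rightarrow> ('k, 'x) aterm \<Rightarrow> ('k, 'x) aterm set"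
  where "alg_class K S R t = {s. alg_cong K S R t s}"

definition pres_alg :: "('k, 'i) ring_scheme \<Rightarrow> 'x set \<Rightarrow> (('k, 'x) aterm \<times> ('k, 'x) aterm) set
    \<Rightarrow> ('k, ('k, 'x) aterm set) module"
  where "pres_alg K S R =
    \<lparr>carrier = alg_class K S R ` aterms K S,
     mult = (\<lambda>C D. \<Union>s\<in>C. \<Union>t\<in>D. alg_class K S R (TMul s t)),
     one = undefined,
     zero = alg_class K S R TZero,
     add = (\<lambda>C D. \<Union>s\<in>C. \<Union>t\<in>D. alg_class K S R (TAdd s t)),
     smult = (\<lambda>c C. \<Union>t\<in>C. alg_class K S R (TSmul c t))\<rparr>"

text \<open>The relations making \<open>x \<mapsto> TGen (g x)\<close> a linear map on the vector space \<open>X\<close>.\<close>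

definition lin_rels :: "('k, 'i) ring_scheme \<Rightarrow> ('k, 'a, 'j) module_scheme \<Rightarrow> ('a \<Rightarrow> 'x)
    \<Rightarrow> (('k, 'x) aterm \<times> ('k, 'x) aterm) set"
  where "lin_rels K X g =
    {(TGen (g (x \<oplus>\<^bsub>X\<^esub> y)), TAdd (TGen (g x)) (TGen (g y))) | x y. x \<in> carrier X \<and> y \<in> carrier X} \<union>
    {(TGen (g (c \<odot>\<^bsub>X\<^esub> x)), TSmul c (TGen (g x))) | c x. c \<in> carrier K \<and> x \<in> carrier X}"


section \<open>Free Lie algebras\<close>

definition lie_rels :: "('k, 'i) ring_scheme \<Rightarrow> ('k, 'x, 'j) module_scheme
    \<Rightarrow> (('k, 'x) aterm \<times> ('k, 'x) aterm) set"
  where "lie_rels K X = lin_rels K X id \<union> {(TMul t t, TZero) | t. True} \<union>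
    {(TAdd (TMul r (TMul s t)) (TAdd (TMul s (TMul t r)) (TMul t (TMul r s))), TZero) | r s t. True}"

definition free_lie :: "('k, 'i) ring_scheme \<Rightarrow> ('k, 'x, 'j) module_scheme
    \<Rightarrow> ('k, ('k, 'x) aterm set) module"
  where "free_lie K X = pres_alg K (carrier X) (lie_rels K X)"

text \<open>The canonical linear map \<open>X \<rightarrow> L(X)\<close>.\<close>

definition free_lie_gen :: "('k, 'i) ring_scheme \<Rightarrow> ('k, 'x, 'j) module_scheme
    \<Rightarrow> 'x \<Rightarrow> ('k, 'x) aterm set"
  where "free_lie_gen K X x = alg_class K (carrier X) (lie_rels K X) (TGen x)"

text \<open>
  The homomorphism \<open>L(V) \<rightarrow> L(X)\<close> induced by the inclusion of a subspace \<open>V \<subseteq> X\<close>, and its image,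
  as which \<open>L(V)\<close> is regarded as a subalgebra of \<open>L(X)\<close>.
\<close>

definition free_lie_incl :: "('k, 'i) ring_scheme \<Rightarrow> ('k, 'x, 'j) module_scheme
    \<Rightarrow> ('k, 'x) aterm set \<Rightarrow> ('k, 'x) aterm set"
  where "free_lie_incl K X C = (\<Union>t\<in>C. alg_class K (carrier X) (lie_rels K X) t)"

definition free_lie_sub :: "('k, 'i) ring_scheme \<Rightarrow> ('k, 'x, 'j) module_scheme
    \<Rightarrow> 'x set \<Rightarrow> ('k, 'x) aterm set set"
  where "free_lie_sub K X V = free_lie_incl K X ` carrier (free_lie K (X\<lparr>carrier := V\<rparr>))"

definition lie_derivations :: "('k, 'i) ring_scheme \<Rightarrow> ('k, 'a, 'j) module_scheme \<Rightarrow> ('a \<Rightarrow> 'a) set"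
  where "lie_derivations K L = {D \<in> carrier L \<rightarrow> carrier L.
    (\<forall>x\<in>carrier L. \<forall>y\<in>carrier L. D (x \<oplus>\<^bsub>L\<^esub> y) = D x \<oplus>\<^bsub>L\<^esub> D y) \<and>
    (\<forall>c\<in>carrier K. \<forall>x\<in>carrier L. D (c \<odot>\<^bsub>L\<^esub> x) = c \<odot>\<^bsub>L\<^esub> D x) \<and>
    (\<forall>x\<in>carrier L. \<forall>y\<in>carrier L. D (x \<otimes>\<^bsub>L\<^esub> y) = (D x \<otimes>\<^bsub>L\<^esub> y) \<oplus>\<^bsub>L\<^esub> (x \<otimes>\<^bsub>L\<^esub> D y))}"

text \<open>
  The unique derivation of \<open>L(N)\<close> extending the linear map \<open>d\<close> on \<open>N\<close>. Membership in
  \<^const>\<open>extensional\<close> only fixes the values outside the carrier.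
\<close>

definition free_lie_der :: "('k, 'i) ring_scheme \<Rightarrow> ('k, 'x, 'j) module_scheme \<Rightarrow> ('x \<Rightarrow> 'x)
    \<Rightarrow> ('k, 'x) aterm set \<Rightarrow> ('k, 'x) aterm set"
  where "free_lie_der K N d =
    (THE D. D \<in> lie_derivations K (free_lie K N) \<and> D \<in> extensional (carrier (free_lie K N)) \<and>
            (\<forall>n\<in>carrier N. D (free_lie_gen K N n) = free_lie_gen K N (d n)))"


section \<open>Universal enveloping algebras\<close>

text \<open>
  \<open>U(L)\<close> is the associative unital algebra generated by \<open>1\<close> (the generator \<open>None\<close>) and the vector
  space \<open>L\<close> (the generators \<open>Some x\<close>), with \<open>[x, y] = xy - yx\<close>.
\<close>

definition uea_rels :: "('k, 'i) ring_scheme \<Rightarrow> ('k, 'a, 'j) module_scheme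
    \<Rightarrow> (('k, 'a option) aterm \<times> ('k, 'a option) aterm) set"
  where "uea_rels K L = lin_rels K L Some \<union>
    {(TMul (TMul r s) t, TMul r (TMul s t)) | r s t. True} \<union>
    {(TMul (TGen None) t, t) | t. True} \<union> {(TMul t (TGen None), t) | t. True} \<union>
    {(TGen (Some (x \<otimes>\<^bsub>L\<^esub> y)),
      TAdd (TMul (TGen (Some x)) (TGen (Some y)))
        (TSmul (\<ominus>\<^bsub>K\<^esub> \<one>\<^bsub>K\<^esub>) (TMul (TGen (Some y)) (TGen (Some x))))) | x y.
      x \<in> carrier L \<and> y \<in> carrier L}"

definition uea :: "('k, 'i) ring_scheme \<Rightarrow> ('k, 'a, 'j) module_scheme
    \<Rightarrow> ('k, ('k, 'a option) aterm set) module"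
  where "uea K L = (pres_alg K (insert None (Some ` carrier L)) (uea_rels K L))
    \<lparr>one := alg_class K (insert None (Some ` carrier L)) (uea_rels K L) (TGen None)\<rparr>"

text \<open>
  The action of \<open>U(H)\<close> on a Lie algebra \<open>L\<close> containing \<open>H\<close> that extends the adjoint action of \<open>H\<close>
  on \<open>L\<close>. All terms representing the same element of \<open>U(H)\<close> act alike, so the action of a class \<open>a\<close>
  on \<open>b\<close> is the only value that its members yield.
\<close>

primrec uea_term_act :: "('k, 'a, 'j) module_scheme \<Rightarrow> ('k, 'a option) aterm \<Rightarrow> 'a \<Rightarrow> 'a"
  where
    "uea_term_act L (TGen g) b = (case g of None \<Rightarrow> b | Some x \<Rightarrow> x \<otimes>\<^bsub>L\<^esub> b)"
  | "uea_term_act L TZero b = \<zero>\<^bsub>L\<^esub>"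
  | "uea_term_act L (TAdd s t) b = uea_term_act L s b \<oplus>\<^bsub>L\<^esub> uea_term_act L t b"
  | "uea_term_act L (TSmul c t) b = c \<odot>\<^bsub>L\<^esub> uea_term_act L t b"
  | "uea_term_act L (TMul s t) b = uea_term_act L s (uea_term_act L t b)"

definition uea_act :: "('k, 'a, 'j) module_scheme \<Rightarrow> ('k, 'a option) aterm set \<Rightarrow> 'a \<Rightarrow> 'a"
  where "uea_act L a b = the_elem ((\<lambda>t. uea_term_act L t b) ` a)"

definition uea_span :: "('k, 'i) ring_scheme \<Rightarrow> ('k, 'a, 'j) module_scheme \<Rightarrow> 'a set \<Rightarrow> 'a set \<Rightarrow> 'a set"
  where "uea_span K L H S =
    lin_span K L {uea_act L a b | a b. a \<in> carrier (uea K (L\<lparr>carrier := H\<rparr>)) \<and> b \<in> S}"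

section \<open>Well-definedness\<close>

text \<open>
  The operations on classes are independent of representatives, \<open>L(X)\<close> is a Lie algebra,
  \<open>L(V) \<rightarrow> L(V \<oplus> W)\<close> is injective (\<open>free_lie_incl_inj\<close>), the action of \<open>U(H)\<close> does not depend
  on the representing term (\<open>uea_act_class\<close>), and \<^const>\<open>free_lie_der\<close> describes a unique
  derivation (\<open>free_lie_der_ex1\<close>).
\<close>

lemma alg_cong_terms:
  assumes "cring K" "alg_cong K S R s t"
  shows "s \<in> aterms K S \<and> t \<in> aterms K S"
proof -
  interpret cring K by fact
  from assms(2) show ?thesis
    by induction (auto intro: aterms.intros elim: aterms.cases)
qed

lemma alg_class_eq_iff:
  assumes "cring K" "s \<in> aterms K S"
  shows "alg_class K S R s = alg_class K S R t \<longleftrightarrow> alg_cong K S R s t"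
  using assms unfolding alg_class_def
  by (auto intro: alg_cong.trans alg_cong.sym alg_cong.refl)

lemma mem_alg_class: "s \<in> alg_class K S R t \<longleftrightarrow> alg_cong K S R t s"
  by (simp add: alg_class_def)

lemma pres_alg_carrier: "carrier (pres_alg K S R) = alg_class K S R ` aterms K S"
  by (simp add: pres_alg_def)

lemma pres_alg_zero: "\<zero>\<^bsub>pres_alg K S R\<^esub> = alg_class K S R TZero"
  by (simp add: pres_alg_def)

lemma pres_alg_ops:
  assumes "cring K" "s \<in> aterms K S" "t \<in> aterms K S"
  shows "alg_class K S R s \<oplus>\<^bsub>pres_alg K S R\<^esub> alg_class K S R t = alg_class K S R (TAdd s t)"
    and "alg_class K S R s \<otimes>\<^bsub>pres_alg K S R\<^esub> alg_class K S R t = alg_class K S R (TMul s t)"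
    and "c \<in> carrier K \<Longrightarrow> c \<odot>\<^bsub>pres_alg K S R\<^esub> alg_class K S R t = alg_class K S R (TSmul c t)"
proof -
  have A: "alg_class K S R (TAdd s' t') = alg_class K S R (TAdd s t)"
    if "alg_cong K S R s s'" "alg_cong K S R t t'" for s' t'
    using alg_class_eq_iff[OF assms(1)] that assms alg_cong.add[OF that] 
    by (metis aterms.add)
  have B: "alg_class K S R (TMul s' t') = alg_class K S R (TMul s t)"
    if "alg_cong K S R s s'" "alg_cong K S R t t'" for s' t'
    using alg_class_eq_iff[OF assms(1)] that assms alg_cong.mul[OF that] 
    by (metis aterms.mul)
  have C: "alg_class K S R (TSmul c t') = alg_class K S R (TSmul c t)"
    if "c \<in> carrier K" "alg_cong K S R t t'" for t'
    using alg_class_eq_iff[OF assms(1)] that assms alg_cong.smul[OF that] 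
    by (metis aterms.smul)
  have n: "s \<in> alg_class K S R s" "t \<in> alg_class K S R t"
    using assms by (auto simp: mem_alg_class intro: alg_cong.refl)
  have U: "(\<Union>a\<in>P. \<Union>b\<in>Q. f a b) = f s t"
    if "s \<in> P" "t \<in> Q" "\<And>a b. \<lbrakk>a \<in> P; b \<in> Q\<rbrakk> \<Longrightarrow> f a b = f s t"
    for P Q and f :: "('a, 'c) aterm \<Rightarrow> ('a, 'c) aterm \<Rightarrow> ('a, 'c) aterm set"
  proof -
    have "(\<Union>a\<in>P. \<Union>b\<in>Q. f a b) = (\<Union>a\<in>P. \<Union>b\<in>Q. f s t)"
      by (intro SUP_cong HOL.refl that)
    then show ?thesis using that(1,2) by auto
  qed
  have p: "add (pres_alg K S R) = (\<lambda>C D. \<Union>s\<in>C. \<Union>t\<in>D. alg_class K S R (TAdd s t))"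
    "mult (pres_alg K S R) = (\<lambda>C D. \<Union>s\<in>C. \<Union>t\<in>D. alg_class K S R (TMul s t))"
    "smult (pres_alg K S R) = (\<lambda>c C. \<Union>t\<in>C. alg_class K S R (TSmul c t))"
    by (simp_all add: pres_alg_def)
  show "alg_class K S R s \<oplus>\<^bsub>pres_alg K S R\<^esub> alg_class K S R t = alg_class K S R (TAdd s t)"
    unfolding p by (rule U[OF n, of "\<lambda>s t. alg_class K S R (TAdd s t)"]) (rule A; simp only: mem_alg_class)
  show "alg_class K S R s \<otimes>\<^bsub>pres_alg K S R\<^esub> alg_class K S R t = alg_class K S R (TMul s t)"
    unfolding p by (rule U[OF n, of "\<lambda>s t. alg_class K S R (TMul s t)"]) (rule B; simp only: mem_alg_class)
  show "c \<odot>\<^bsub>pres_alg K S R\<^esub> alg_class K S R t = alg_class K S R (TSmul c t)" if "c \<in> carrier K"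
  proof -
    have "(\<Union>a\<in>{s}. \<Union>b\<in>alg_class K S R t. alg_class K S R (TSmul c b)) = alg_class K S R (TSmul c t)"
      by (rule U[OF _ n(2), of "{s}" "\<lambda>s t. alg_class K S R (TSmul c t)"]) (simp, rule C[OF that], simp only: mem_alg_class)
    then show ?thesis unfolding p by simp
  qed
qed

lemma alg_class_eqI:
  assumes "cring K" "alg_cong K S R s t"
  shows "alg_class K S R s = alg_class K S R t"
  using alg_class_eq_iff[OF assms(1)] alg_cong_terms[OF assms] assms(2) by blast

lemma pres_alg_module:
  assumes "cring K"
  shows "module K (pres_alg K S R)"
proof -
  interpret cring K by fact
  note ops = pres_alg_ops[OF assms]
  note eqI = alg_class_eqI[OF assms]
  have zs: "alg_cong K S R (TAdd (TSmul (\<ominus>\<^bsub>K\<^esub> \<one>\<^bsub>K\<^esub>) t) t) TZero" if t: "t \<in> aterms K S" for t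
  proof -
    have "alg_cong K S R (TAdd (TSmul (\<ominus>\<^bsub>K\<^esub> \<one>\<^bsub>K\<^esub>) t) t) (TAdd (TSmul (\<ominus>\<^bsub>K\<^esub> \<one>\<^bsub>K\<^esub>) t) (TSmul \<one>\<^bsub>K\<^esub> t))"
      using t by (intro alg_cong.add alg_cong.refl alg_cong.sym[OF alg_cong.one_smul] aterms.intros) auto
    moreover have "alg_cong K S R \<dots> (TSmul ((\<ominus>\<^bsub>K\<^esub> \<one>\<^bsub>K\<^esub>) \<oplus>\<^bsub>K\<^esub> \<one>\<^bsub>K\<^esub>) t)"
      using t by (intro alg_cong.sym[OF alg_cong.add_smul]) auto
    moreover have "alg_cong K S R (TSmul ((\<ominus>\<^bsub>K\<^esub> \<one>\<^bsub>K\<^esub>) \<oplus>\<^bsub>K\<^esub> \<one>\<^bsub>K\<^esub>) t) TZero"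
      using alg_cong.zero_smul[OF t, of R] by (simp add: l_neg)
    ultimately show ?thesis by (meson alg_cong.trans)
  qed
  have az: "alg_cong K S R (TAdd TZero t) t" if "t \<in> aterms K S" for t
    using that by (meson alg_cong.trans alg_cong.add_comm alg_cong.add_zero aterms.zero)
  note T = aterms.intros
  show ?thesis
    apply (intro moduleI abelian_groupI assms; (unfold pres_alg_carrier pres_alg_zero)?; (elim imageE; simp only: ops T)?)
    apply (intro imageI T; assumption)
    apply (intro imageI T; assumption)
    apply (rule eqI, rule alg_cong.add_assoc; assumption)
    apply (rule eqI, rule alg_cong.add_comm; assumption)
    apply (rule eqI, rule az; assumption)
    subgoal for x t
      apply (rule bexI[of _ "alg_class K S R (TSmul (\<ominus>\<^bsub>K\<^esub> \<one>\<^bsub>K\<^esub>) t)"])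
      apply (simp only: ops T a_inv_closed one_closed, rule eqI, rule zs, assumption)
      apply (simp only: imageI T a_inv_closed one_closed)
      done
    apply (intro imageI T; assumption)
    apply (simp only: ops T add.m_closed, rule eqI, rule alg_cong.add_smul; assumption)
    apply (rule eqI, rule alg_cong.smul_add; assumption)
    apply (simp only: ops T m_closed, rule eqI, rule alg_cong.smul_smul; assumption)
    apply (simp only: ops T one_closed, rule eqI, rule alg_cong.one_smul; assumption)
    done
qed

lemma free_lie_lie_algebra:
  assumes "field K"
  shows "lie_algebra K (free_lie K X)"
proof -
  interpret field K by fact
  have c: "cring K" by unfold_locales
  interpret module K "free_lie K X"
    unfolding free_lie_def by (rule pres_alg_module[OF c])
  note ops = pres_alg_ops[OF c]
  note eqI = alg_class_eqI[OF c]
  note T = aterms.intros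
  show ?thesis
    apply (unfold_locales; (unfold free_lie_def pres_alg_carrier pres_alg_zero)?; (elim imageE; simp only: ops T)?)
    apply (intro imageI T; assumption)
    apply (rule eqI, rule alg_cong.add_mul; assumption)
    apply (rule eqI, rule alg_cong.mul_add; assumption)
    apply (rule eqI, rule alg_cong.smul_mul; assumption)
    apply (rule eqI, rule alg_cong.mul_smul; assumption)
    apply (rule eqI, rule alg_cong.rel; (intro T; assumption)?; unfold lie_rels_def; blast)
    apply (rule eqI, rule alg_cong.rel; (intro T; assumption)?; unfold lie_rels_def; blast)
    done
qed

lemma free_lie_gen_linear:
  assumes "field K" "module K X" "x \<in> carrier X" "y \<in> carrier X" "c \<in> carrier K"
  shows "free_lie_gen K X (x \<oplus>\<^bsub>X\<^esub> y) = free_lie_gen K X x \<oplus>\<^bsub>free_lie K X\<^esub> free_lie_gen K X y"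
    and "free_lie_gen K X (c \<odot>\<^bsub>X\<^esub> x) = c \<odot>\<^bsub>free_lie K X\<^esub> free_lie_gen K X x"
proof -
  interpret module K X by fact
  have c: "cring K" by unfold_locales
  note ops = pres_alg_ops[OF c]
  note eqI = alg_class_eqI[OF c]
  note T = aterms.intros
  have g: "TGen (x \<oplus>\<^bsub>X\<^esub> y) \<in> aterms K (carrier X)" "TGen (c \<odot>\<^bsub>X\<^esub> x) \<in> aterms K (carrier X)"
     "TGen x \<in> aterms K (carrier X)" "TGen y \<in> aterms K (carrier X)"
    using assms by (auto intro: T)
  show "free_lie_gen K X (x \<oplus>\<^bsub>X\<^esub> y) = free_lie_gen K X x \<oplus>\<^bsub>free_lie K X\<^esub> free_lie_gen K X y"
    unfolding free_lie_gen_def free_lie_def ops(1)[OF g(3,4)]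
    using g assms by (intro eqI alg_cong.rel T) (auto simp: lie_rels_def lin_rels_def)
  show "free_lie_gen K X (c \<odot>\<^bsub>X\<^esub> x) = c \<odot>\<^bsub>free_lie K X\<^esub> free_lie_gen K X x"
    unfolding free_lie_gen_def free_lie_def ops(3)[OF g(3,3) assms(5)]
    using g assms by (intro eqI alg_cong.rel T) (auto simp: lie_rels_def lin_rels_def)
qed

lemma aterms_inv:
  "TMul s t \<in> aterms K S \<longleftrightarrow> s \<in> aterms K S \<and> t \<in> aterms K S"
  "TAdd s t \<in> aterms K S \<longleftrightarrow> s \<in> aterms K S \<and> t \<in> aterms K S"
  by (auto intro: aterms.intros elim: aterms.cases)

lemma term_map_cong:
  assumes c: "cring K"
    and S: "\<And>x. x \<in> S \<Longrightarrow> p x \<in> S'"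
    and R: "\<And>s t. \<lbrakk>(s, t) \<in> R; s \<in> aterms K S; t \<in> aterms K S\<rbrakk> \<Longrightarrow> (map_aterm (\<lambda>a. a) p s, map_aterm (\<lambda>a. a) p t) \<in> R'"
    and st: "alg_cong K S R s t"
  shows "alg_cong K S' R' (map_aterm (\<lambda>a. a) p s) (map_aterm (\<lambda>a. a) p t)"
proof -
  have T: "map_aterm (\<lambda>a. a) p t \<in> aterms K S'" if "t \<in> aterms K S" for t
    using that by induction (auto intro: aterms.intros S)
  from st show ?thesis
  proof induction
    case (rel s t) then show ?case by (intro alg_cong.rel R T)
  next
    case (sym s t) then show ?case by (blast intro: alg_cong.sym)
  next
    case (trans s t) then show ?case by (blast intro: alg_cong.trans)
  qed (auto intro: alg_cong.intros T)
qed

lemma map_aterm_ident: "t \<in> aterms K S \<Longrightarrow> (\<And>x. x \<in> S \<Longrightarrow> p x = x) \<Longrightarrow> map_aterm (\<lambda>a. a) p t = t"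
  by (induction rule: aterms.induct) auto

lemma aterms_mono: "t \<in> aterms K S \<Longrightarrow> S \<subseteq> S' \<Longrightarrow> t \<in> aterms K S'"
  by (induction rule: aterms.induct) (auto intro: aterms.intros)

lemma free_lie_incl_inj:
  fixes E :: "('k, 'x, 'j) module_scheme"
  assumes c: "field K" and E: "module K E" and V: "submodule V K E" and W: "submodule W K E"
    and VW: "V \<inter> W = {\<zero>\<^bsub>E\<^esub>}" and X: "X = E\<lparr>carrier := V <+>\<^bsub>E\<^esub> W\<rparr>"
  shows "inj_on (free_lie_incl K X) (carrier (free_lie K (X\<lparr>carrier := V\<rparr>)))"
    and "t \<in> aterms K V \<Longrightarrow> free_lie_incl K X (alg_class K V (lie_rels K (X\<lparr>carrier := V\<rparr>)) t) = alg_class K (carrier X) (lie_rels K X) t"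
proof -
  interpret module K E by fact
  have cr: "cring K" by unfold_locales
  interpret V: submodule V K E by fact
  interpret W: submodule W K E by fact
  note sV = submoduleE[OF V] and sW = submoduleE[OF W]
  have z: "\<zero>\<^bsub>E\<^esub> \<in> V" "\<zero>\<^bsub>E\<^esub> \<in> W" using VW by auto
  let ?RV = "lie_rels K (X\<lparr>carrier := V\<rparr>)"
  define p where "p x = (THE v. v \<in> V \<and> (\<exists>w\<in>W. x = v \<oplus>\<^bsub>E\<^esub> w))" for x
  have p: "p (v \<oplus>\<^bsub>E\<^esub> w) = v" if v: "v \<in> V" and w: "w \<in> W" for v w
    unfolding p_def
  proof (rule the_equality)
    show "v \<in> V \<and> (\<exists>wa\<in>W. v \<oplus>\<^bsub>E\<^esub> w = v \<oplus>\<^bsub>E\<^esub> wa)" using v w by blast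
  next
    fix v' assume "v' \<in> V \<and> (\<exists>wa\<in>W. v \<oplus>\<^bsub>E\<^esub> w = v' \<oplus>\<^bsub>E\<^esub> wa)"
    then obtain w' where v': "v' \<in> V" and w': "w' \<in> W" and e: "v \<oplus>\<^bsub>E\<^esub> w = v' \<oplus>\<^bsub>E\<^esub> w'" by blast
    have cc: "v \<in> carrier E" "v' \<in> carrier E" "w \<in> carrier E" "w' \<in> carrier E"
      using v v' w w' sV(1) sW(1) by auto
    have "v' \<ominus>\<^bsub>E\<^esub> v = w \<ominus>\<^bsub>E\<^esub> w'"
    proof -
      have "v' = (v \<oplus>\<^bsub>E\<^esub> w) \<ominus>\<^bsub>E\<^esub> w'" unfolding e using cc by (simp add: M.minus_eq M.a_assoc M.r_neg)
      also have "\<dots> = (w \<ominus>\<^bsub>E\<^esub> w') \<oplus>\<^bsub>E\<^esub> v" using cc by (simp add: M.minus_eq M.a_ac)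
      finally show ?thesis using cc by (simp add: M.minus_eq M.a_assoc M.r_neg)
    qed
    moreover have "v' \<ominus>\<^bsub>E\<^esub> v \<in> V" using v v' sV by (simp add: M.minus_eq)
    moreover have "w \<ominus>\<^bsub>E\<^esub> w' \<in> W" using w w' sW by (simp add: M.minus_eq)
    ultimately have "v' \<ominus>\<^bsub>E\<^esub> v = \<zero>\<^bsub>E\<^esub>" using VW by auto
    then show "v' = v" using cc by (metis M.minus_eq M.minus_equality M.minus_minus M.a_inv_closed)
  qed
  have cX: "x \<in> carrier X \<longleftrightarrow> (\<exists>v\<in>V. \<exists>w\<in>W. x = v \<oplus>\<^bsub>E\<^esub> w)" for x
    by (auto simp: X set_add_def')
  have pV: "p v = v" if "v \<in> V" for v
    using p[OF that z(2)] that sV(1) by auto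
  have padd: "p (x \<oplus>\<^bsub>E\<^esub> y) = p x \<oplus>\<^bsub>E\<^esub> p y" if xy: "x \<in> carrier X" "y \<in> carrier X" for x y
  proof -
    from xy obtain v w v' w' where *: "v \<in> V" "w \<in> W" "x = v \<oplus>\<^bsub>E\<^esub> w" "v' \<in> V" "w' \<in> W" "y = v' \<oplus>\<^bsub>E\<^esub> w'"
      unfolding cX by blast
    then have "x \<oplus>\<^bsub>E\<^esub> y = (v \<oplus>\<^bsub>E\<^esub> v') \<oplus>\<^bsub>E\<^esub> (w \<oplus>\<^bsub>E\<^esub> w')"
      using sV(1) sW(1) by (auto simp: M.a_ac subset_iff)
    then show ?thesis using * p sV sW by auto
  qed
  have psm: "p (c \<odot>\<^bsub>E\<^esub> x) = c \<odot>\<^bsub>E\<^esub> p x" if xy: "x \<in> carrier X" "c \<in> carrier K" for x c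
  proof -
    from xy obtain v w where *: "v \<in> V" "w \<in> W" "x = v \<oplus>\<^bsub>E\<^esub> w"
      unfolding cX by blast
    then have "c \<odot>\<^bsub>E\<^esub> x = (c \<odot>\<^bsub>E\<^esub> v) \<oplus>\<^bsub>E\<^esub> (c \<odot>\<^bsub>E\<^esub> w)"
      using sV(1) sW(1) that by (auto simp: smult_r_distr subset_iff)
    then show ?thesis using * p sV sW that by auto
  qed
  have pc: "p x \<in> V" if "x \<in> carrier X" for x using that p unfolding cX by auto
  have VX: "V \<subseteq> carrier X"
    unfolding cX subset_iff using z(2) sV(1) by (metis M.r_zero subsetD)
  have X': "add X = add E" "smult X = smult E" by (auto simp: X)
  have RR: "?RV \<subseteq> lie_rels K X" using VX by (auto simp: lie_rels_def lin_rels_def X')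
  have up: "alg_cong K (carrier X) (lie_rels K X) s t" if "alg_cong K V ?RV s t" for s t
  proof -
    have "alg_cong K (carrier X) (lie_rels K X) (map_aterm (\<lambda>a. a) (\<lambda>a. a) s) (map_aterm (\<lambda>a. a) (\<lambda>a. a) t)"
      by (rule term_map_cong[OF cr _ _ that]) (use RR VX in \<open>auto simp: aterm.map_ident\<close>)
    then show ?thesis by (simp add: aterm.map_ident)
  qed
  have down: "alg_cong K V ?RV s t" if "alg_cong K (carrier X) (lie_rels K X) s t" "s \<in> aterms K V" "t \<in> aterms K V" for s t
  proof -
    have "alg_cong K V ?RV (map_aterm (\<lambda>a. a) p s) (map_aterm (\<lambda>a. a) p t)"
    proof (rule term_map_cong[OF cr _ _ that(1)])
      fix s t assume "(s, t) \<in> lie_rels K X"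
      then show "(map_aterm (\<lambda>a. a) p s, map_aterm (\<lambda>a. a) p t) \<in> ?RV"
        unfolding lie_rels_def lin_rels_def
        apply (elim UnE)
        subgoal using pc by (auto simp: X' padd) 
        subgoal using pc by (auto simp: X' psm)
        subgoal by auto
        subgoal by auto
        done
    qed (auto intro: pc)
    then show ?thesis using map_aterm_ident[OF that(2)] map_aterm_ident[OF that(3)] pV by auto
  qed
  show I: "free_lie_incl K X (alg_class K V ?RV t) = alg_class K (carrier X) (lie_rels K X) t" if t: "t \<in> aterms K V" for t
  proof -
    have "alg_class K (carrier X) (lie_rels K X) s = alg_class K (carrier X) (lie_rels K X) t" if "s \<in> alg_class K V ?RV t" for s
      using up[of t s] that alg_class_eq_iff[OF cr aterms_mono[OF t VX]] by (auto simp: mem_alg_class)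
    moreover have "t \<in> alg_class K V ?RV t" using t by (simp add: mem_alg_class alg_cong.refl)
    ultimately show ?thesis unfolding free_lie_incl_def by blast
  qed
  show "inj_on (free_lie_incl K X) (carrier (free_lie K (X\<lparr>carrier := V\<rparr>)))"
  proof (rule inj_onI)
    fix a b assume a: "a \<in> carrier (free_lie K (X\<lparr>carrier := V\<rparr>))" and b: "b \<in> carrier (free_lie K (X\<lparr>carrier := V\<rparr>))"
      and e: "free_lie_incl K X a = free_lie_incl K X b"
    from a b obtain s t where s: "s \<in> aterms K V" "a = alg_class K V ?RV s" and t: "t \<in> aterms K V" "b = alg_class K V ?RV t"
      by (auto simp: free_lie_def pres_alg_carrier)
    have "alg_cong K (carrier X) (lie_rels K X) s t"
      using e unfolding s(2) t(2) I[OF s(1)] I[OF t(1)] alg_class_eq_iff[OF cr aterms_mono[OF s(1) VX]] .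
    from down[OF this s(1) t(1)] show "a = b" unfolding s(2) t(2) alg_class_eq_iff[OF cr s(1)] .
  qed
qed

lemma uea_act_class:
  assumes L: "lie_algebra K L" and H: "H \<subseteq> carrier L"
    and a: "t \<in> aterms K (insert None (Some ` H))" and b: "b \<in> carrier L"
    and Hc: "\<And>x y. x \<in> H \<Longrightarrow> y \<in> H \<Longrightarrow> x \<otimes>\<^bsub>L\<^esub> y \<in> H"
  shows "uea_act L (alg_class K (insert None (Some ` H)) (uea_rels K (L\<lparr>carrier := H\<rparr>)) t) b = uea_term_act L t b"
proof -
  interpret lie_algebra K L by fact
  let ?S = "insert None (Some ` H)"
  have cr: "cring K" by unfold_locales
  have cl: "uea_term_act L t b \<in> carrier L" if "t \<in> aterms K ?S" "b \<in> carrier L" for t b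
    using that by (induction arbitrary: b) (use H in \<open>auto intro!: lie_closed\<close>)
  have minus1: "\<ominus>\<^bsub>K\<^esub> \<one>\<^bsub>K\<^esub> \<odot>\<^bsub>L\<^esub> x = \<ominus>\<^bsub>L\<^esub> x" if "x \<in> carrier L" for x
    using that by (simp add: smult_l_minus)
  have anti: "x \<otimes>\<^bsub>L\<^esub> y = \<ominus>\<^bsub>L\<^esub> (y \<otimes>\<^bsub>L\<^esub> x)" if xy: "x \<in> carrier L" "y \<in> carrier L" for x y
  proof -
    have "\<zero>\<^bsub>L\<^esub> = (x \<oplus>\<^bsub>L\<^esub> y) \<otimes>\<^bsub>L\<^esub> (x \<oplus>\<^bsub>L\<^esub> y)" using xy lie_alternating by simp
    also have "\<dots> = x \<otimes>\<^bsub>L\<^esub> y \<oplus>\<^bsub>L\<^esub> y \<otimes>\<^bsub>L\<^esub> x"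
      using xy by (simp add: lie_add_left lie_add_right lie_alternating[OF xy(1)] lie_alternating[OF xy(2)] lie_closed M.a_comm)
    finally show ?thesis using xy by (metis M.minus_equality lie_closed)
  qed
  have jac: "(x \<otimes>\<^bsub>L\<^esub> y) \<otimes>\<^bsub>L\<^esub> b = x \<otimes>\<^bsub>L\<^esub> (y \<otimes>\<^bsub>L\<^esub> b) \<oplus>\<^bsub>L\<^esub> \<ominus>\<^bsub>L\<^esub> (y \<otimes>\<^bsub>L\<^esub> (x \<otimes>\<^bsub>L\<^esub> b))"
    if xy: "x \<in> carrier L" "y \<in> carrier L" "b \<in> carrier L" for x y b
  proof -
    have m: "y \<otimes>\<^bsub>L\<^esub> (b \<otimes>\<^bsub>L\<^esub> x) = \<ominus>\<^bsub>L\<^esub> (y \<otimes>\<^bsub>L\<^esub> (x \<otimes>\<^bsub>L\<^esub> b))"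
      using xy anti[of b x] lie_smult_right[of "\<ominus>\<^bsub>K\<^esub> \<one>\<^bsub>K\<^esub>" y "x \<otimes>\<^bsub>L\<^esub> b"] by (simp add: minus1 lie_closed)
    have n: "b \<otimes>\<^bsub>L\<^esub> (x \<otimes>\<^bsub>L\<^esub> y) = \<ominus>\<^bsub>L\<^esub> ((x \<otimes>\<^bsub>L\<^esub> y) \<otimes>\<^bsub>L\<^esub> b)"
      using anti[of b "x \<otimes>\<^bsub>L\<^esub> y"] xy by (simp add: lie_closed)
    let ?a = "x \<otimes>\<^bsub>L\<^esub> (y \<otimes>\<^bsub>L\<^esub> b)" and ?b = "\<ominus>\<^bsub>L\<^esub> (y \<otimes>\<^bsub>L\<^esub> (x \<otimes>\<^bsub>L\<^esub> b))" and ?c = "(x \<otimes>\<^bsub>L\<^esub> y) \<otimes>\<^bsub>L\<^esub> b"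
    have "(?a \<oplus>\<^bsub>L\<^esub> ?b) \<oplus>\<^bsub>L\<^esub> \<ominus>\<^bsub>L\<^esub> ?c = \<zero>\<^bsub>L\<^esub>"
      using lie_jacobi[OF xy] xy unfolding m n by (simp add: lie_closed M.a_assoc)
    then show ?thesis using xy by (metis M.a_closed M.a_inv_closed M.minus_equality M.minus_minus lie_closed)
  qed
  have lin: "uea_term_act L t (c \<odot>\<^bsub>L\<^esub> b) = c \<odot>\<^bsub>L\<^esub> uea_term_act L t b" 
    if "t \<in> aterms K ?S" "b \<in> carrier L" "c \<in> carrier K" for t b c
    using that
  proof (induction arbitrary: b)
    case (gen x) then show ?case using H by (auto simp: lie_smult_right)
  next
    case (smul d t) then show ?case using cl[OF smul(2)]
      by (simp add: smult_assoc1[symmetric] R.m_comm)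
  qed (auto simp: smult_r_distr cl)
  have add: "uea_term_act L t (b \<oplus>\<^bsub>L\<^esub> b') = uea_term_act L t b \<oplus>\<^bsub>L\<^esub> uea_term_act L t b'" 
    if "t \<in> aterms K ?S" "b \<in> carrier L" "b' \<in> carrier L" for t b b'
    using that
  proof (induction arbitrary: b b')
    case (gen x) then show ?case using H by (auto simp: lie_add_right)
  qed (auto simp: smult_r_distr cl M.a_ac)
  have zro: "uea_term_act L t \<zero>\<^bsub>L\<^esub> = \<zero>\<^bsub>L\<^esub>" if "t \<in> aterms K ?S" for t
    using lin[OF that, of "\<zero>\<^bsub>L\<^esub>" "\<zero>\<^bsub>K\<^esub>"] cl[OF that] by simp
  have key: "uea_term_act L s b = uea_term_act L t b"
    if "alg_cong K ?S (uea_rels K (L\<lparr>carrier := H\<rparr>)) s t" "b \<in> carrier L" for s t b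
    using that
  proof (induction arbitrary: b)
    case (rel s t)
    then show ?case
      unfolding uea_rels_def lin_rels_def Un_iff
      apply (elim disjE)
      subgoal using H by (auto simp: lie_add_left subset_iff)
      subgoal using H by (auto simp: lie_smult_left subset_iff)
      subgoal by auto
      subgoal by auto
      subgoal by auto
      subgoal using H by (auto simp: jac minus1 lie_closed subset_iff)
      done
  next
    case (mul s s' t t') then show ?case using alg_cong_terms[OF cr mul.hyps(2)] cl by auto
  qed (auto simp: cl smult_r_distr smult_l_distr smult_assoc1 M.a_ac lin add zro)
  have "uea_term_act L s b = uea_term_act L t b" if "s \<in> alg_class K ?S (uea_rels K (L\<lparr>carrier := H\<rparr>)) t" for s
    using key[of t s b] that b by (simp add: mem_alg_class)
  moreover have "t \<in> alg_class K ?S (uea_rels K (L\<lparr>carrier := H\<rparr>)) t"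
    using a by (simp add: mem_alg_class alg_cong.refl)
  ultimately have "(\<lambda>s. uea_term_act L s b) ` alg_class K ?S (uea_rels K (L\<lparr>carrier := H\<rparr>)) t = {uea_term_act L t b}"
    unfolding set_eq_iff image_iff singleton_iff by blast
  then show ?thesis unfolding uea_act_def by simp
qed


primrec tder :: "('x \<Rightarrow> 'x) \<Rightarrow> ('k, 'x) aterm \<Rightarrow> ('k, 'x) aterm" where
  "tder d (TGen x) = TGen (d x)"
| "tder d TZero = TZero"
| "tder d (TAdd s t) = TAdd (tder d s) (tder d t)"
| "tder d (TSmul c t) = TSmul c (tder d t)"
| "tder d (TMul s t) = TAdd (TMul (tder d s) t) (TMul s (tder d t))"

lemma free_lie_der_ex1:
  assumes K: "field K" and N: "module K N" and d: "\<And>x. x \<in> carrier N \<Longrightarrow> d x \<in> carrier N"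
    and dadd: "\<And>x y. \<lbrakk>x \<in> carrier N; y \<in> carrier N\<rbrakk> \<Longrightarrow> d (x \<oplus>\<^bsub>N\<^esub> y) = d x \<oplus>\<^bsub>N\<^esub> d y"
    and dsm: "\<And>c x. \<lbrakk>c \<in> carrier K; x \<in> carrier N\<rbrakk> \<Longrightarrow> d (c \<odot>\<^bsub>N\<^esub> x) = c \<odot>\<^bsub>N\<^esub> d x"
  shows "\<exists>!D. D \<in> lie_derivations K (free_lie K N) \<and> D \<in> extensional (carrier (free_lie K N)) \<and>
            (\<forall>n\<in>carrier N. D (free_lie_gen K N n) = free_lie_gen K N (d n))"
proof -
  interpret lie_algebra K "free_lie K N" by (rule free_lie_lie_algebra[OF K])
  have cr: "cring K" by unfold_locales
  define L where "L = free_lie K N"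
  define cl where "cl = alg_class K (carrier N) (lie_rels K N)"
  let ?T = "aterms K (carrier N)"
  interpret L: lie_algebra K L unfolding L_def by (rule free_lie_lie_algebra[OF K])
  have car: "carrier L = cl ` ?T" by (simp add: L_def cl_def free_lie_def pres_alg_carrier)
  have ops: "cl (TAdd s t) = cl s \<oplus>\<^bsub>L\<^esub> cl t" "cl (TMul s t) = cl s \<otimes>\<^bsub>L\<^esub> cl t"
    if "s \<in> ?T" "t \<in> ?T" for s t
    unfolding L_def cl_def free_lie_def using pres_alg_ops[OF cr that] by simp_all
  have ops3: "cl (TSmul c t) = c \<odot>\<^bsub>L\<^esub> cl t" if "t \<in> ?T" "c \<in> carrier K" for t c
    unfolding L_def cl_def free_lie_def using pres_alg_ops(3)[OF cr that(1,1,2)] by simp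
  note ops = ops ops3
  have zer: "cl TZero = \<zero>\<^bsub>L\<^esub>" by (simp add: L_def cl_def free_lie_def pres_alg_zero)
  have gen: "free_lie_gen K N n = cl (TGen n)" for n by (simp add: free_lie_gen_def cl_def)
  have clc: "cl t \<in> carrier L" if "t \<in> ?T" for t using that car by auto
  have dT: "tder d t \<in> ?T" if "t \<in> ?T" for t
    using that by induction (auto intro: aterms.intros d)
  have eqv: "cl s = cl t" if "alg_cong K (carrier N) (lie_rels K N) s t" for s t
    unfolding cl_def by (rule alg_class_eqI[OF cr that])
  have eqv': "alg_cong K (carrier N) (lie_rels K N) s t" if "cl s = cl t" "s \<in> ?T" for s t
    using that alg_class_eq_iff[OF cr that(2)] unfolding cl_def by auto
  note T = aterms.intros
  have glin: "cl (TGen (x \<oplus>\<^bsub>N\<^esub> y)) = cl (TGen x) \<oplus>\<^bsub>L\<^esub> cl (TGen y)"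
    if "x \<in> carrier N" "y \<in> carrier N" for x y
    using free_lie_gen_linear(1)[OF K N that] unfolding gen L_def by auto
  have glin2: "cl (TGen (c \<odot>\<^bsub>N\<^esub> x)) = c \<odot>\<^bsub>L\<^esub> cl (TGen x)"
    if "x \<in> carrier N" "c \<in> carrier K" for x c
    using free_lie_gen_linear(2)[OF K N that(1,1,2)] unfolding gen L_def by auto
  note glin = glin glin2
  define D0 where "D0 t = cl (tder d t)" for t
  have D0c: "D0 t \<in> carrier L" if "t \<in> ?T" for t unfolding D0_def using clc dT that by auto
  have D0: "D0 (TAdd s t) = D0 s \<oplus>\<^bsub>L\<^esub> D0 t" "D0 (TMul s t) = (D0 s \<otimes>\<^bsub>L\<^esub> cl t) \<oplus>\<^bsub>L\<^esub> (cl s \<otimes>\<^bsub>L\<^esub> D0 t)"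
    if "s \<in> ?T" "t \<in> ?T" for s t
    using that dT by (simp_all add: D0_def ops zer T)
  have D03: "D0 (TSmul c t) = c \<odot>\<^bsub>L\<^esub> D0 t" if "t \<in> ?T" "c \<in> carrier K" for t c
    using that dT by (simp_all add: D0_def ops T)
  have D04: "D0 TZero = \<zero>\<^bsub>L\<^esub>" by (simp add: D0_def zer)
  note D0 = D0 D03 D04
  have anti: "(x \<otimes>\<^bsub>L\<^esub> y) \<oplus>\<^bsub>L\<^esub> (y \<otimes>\<^bsub>L\<^esub> x) = \<zero>\<^bsub>L\<^esub>" if xy: "x \<in> carrier L" "y \<in> carrier L" for x y
  proof -
    have "\<zero>\<^bsub>L\<^esub> = (x \<oplus>\<^bsub>L\<^esub> y) \<otimes>\<^bsub>L\<^esub> (x \<oplus>\<^bsub>L\<^esub> y)" using xy L.lie_alternating by simp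
    also have "\<dots> = x \<otimes>\<^bsub>L\<^esub> y \<oplus>\<^bsub>L\<^esub> y \<otimes>\<^bsub>L\<^esub> x"
      using xy by (simp add: L.lie_add_left L.lie_add_right L.lie_alternating[OF xy(1)] L.lie_alternating[OF xy(2)] L.lie_closed L.M.a_comm)
    finally show ?thesis by simp
  qed
  have jac: "D0 (TAdd (TMul r (TMul s t)) (TAdd (TMul s (TMul t r)) (TMul t (TMul r s)))) = \<zero>\<^bsub>L\<^esub>"
    if t: "r \<in> ?T" "s \<in> ?T" "t \<in> ?T" for r s t
  proof -
    have *: "D0 (TAdd (TMul r (TMul s t)) (TAdd (TMul s (TMul t r)) (TMul t (TMul r s)))) =
      ((D0 r \<otimes>\<^bsub>L\<^esub> (cl s \<otimes>\<^bsub>L\<^esub> cl t)) \<oplus>\<^bsub>L\<^esub> ((cl s \<otimes>\<^bsub>L\<^esub> (cl t \<otimes>\<^bsub>L\<^esub> D0 r)) \<oplus>\<^bsub>L\<^esub> (cl t \<otimes>\<^bsub>L\<^esub> (D0 r \<otimes>\<^bsub>L\<^esub> cl s)))) \<oplus>\<^bsub>L\<^esub>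
      (((cl r \<otimes>\<^bsub>L\<^esub> (D0 s \<otimes>\<^bsub>L\<^esub> cl t)) \<oplus>\<^bsub>L\<^esub> ((D0 s \<otimes>\<^bsub>L\<^esub> (cl t \<otimes>\<^bsub>L\<^esub> cl r)) \<oplus>\<^bsub>L\<^esub> (cl t \<otimes>\<^bsub>L\<^esub> (cl r \<otimes>\<^bsub>L\<^esub> D0 s)))) \<oplus>\<^bsub>L\<^esub>
      ((cl r \<otimes>\<^bsub>L\<^esub> (cl s \<otimes>\<^bsub>L\<^esub> D0 t)) \<oplus>\<^bsub>L\<^esub> ((cl s \<otimes>\<^bsub>L\<^esub> (D0 t \<otimes>\<^bsub>L\<^esub> cl r)) \<oplus>\<^bsub>L\<^esub> (D0 t \<otimes>\<^bsub>L\<^esub> (cl r \<otimes>\<^bsub>L\<^esub> cl s)))))"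
      using t by (simp add: D0 T ops D0c clc L.lie_closed L.lie_add_right L.M.a_ac)
    show ?thesis unfolding * using t by (simp add: L.lie_jacobi D0c clc)
  qed
  have wd: "D0 s = D0 t" if "alg_cong K (carrier N) (lie_rels K N) s t" for s t
    using that
  proof induction
    case (rel s t)
    from rel(1) show ?case
      unfolding lie_rels_def lin_rels_def Un_iff
      apply (elim disjE)
      subgoal using glin d by (auto simp: D0_def dadd ops T)
      subgoal using glin d by (auto simp: D0_def dsm ops T)
      subgoal using rel(2) by (auto simp: D0 anti D0c clc aterms_inv)
      subgoal using rel(2) jac D04 unfolding prod.inject mem_Collect_eq by (metis aterms_inv)
      done
  next
    case (mul s s' t t')
    then show ?case using alg_cong_terms[OF cr mul.hyps(1)] alg_cong_terms[OF cr mul.hyps(2)] eqv by (simp add: D0)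
  next
    case (add s s' t t')
    then show ?case using alg_cong_terms[OF cr add.hyps(1)] alg_cong_terms[OF cr add.hyps(2)] by (simp add: D0)
  next
    case (smul c t t')
    then show ?case using alg_cong_terms[OF cr smul.hyps(2)] by (simp add: D0)
  qed (simp_all add: D0 D0c clc ops T L.M.a_ac L.smult_l_distr L.smult_r_distr L.smult_assoc1 L.lie_add_left
      L.lie_add_right L.lie_smult_left L.lie_smult_right L.lie_closed)
  define D where "D = restrict (\<lambda>C. D0 (SOME t. t \<in> ?T \<and> cl t = C)) (carrier L)"
  have DD: "D (cl t) = D0 t" if t: "t \<in> ?T" for t
  proof -
    have "\<exists>s. s \<in> ?T \<and> cl s = cl t" using t by blast
    then have "(SOME s. s \<in> ?T \<and> cl s = cl t) \<in> ?T \<and> cl (SOME s. s \<in> ?T \<and> cl s = cl t) = cl t" by (rule someI_ex)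
    then have "D0 (SOME s. s \<in> ?T \<and> cl s = cl t) = D0 t" using wd eqv' by blast
    then show ?thesis using clc[OF t] by (simp add: D_def)
  qed
  show ?thesis unfolding L_def[symmetric]
  proof (rule ex1I[of _ D])
    have "D (cl s \<oplus>\<^bsub>L\<^esub> cl t) = D (cl s) \<oplus>\<^bsub>L\<^esub> D (cl t)" if "s \<in> ?T" "t \<in> ?T" for s t
      unfolding ops(1)[OF that, symmetric] using DD that T D0 by metis
    moreover have "D (cl s \<otimes>\<^bsub>L\<^esub> cl t) = (D (cl s) \<otimes>\<^bsub>L\<^esub> cl t) \<oplus>\<^bsub>L\<^esub> (cl s \<otimes>\<^bsub>L\<^esub> D (cl t))" if "s \<in> ?T" "t \<in> ?T" for s t
      unfolding ops(2)[OF that, symmetric] using DD that T D0 by metis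
    moreover have "D (c \<odot>\<^bsub>L\<^esub> cl t) = c \<odot>\<^bsub>L\<^esub> D (cl t)" if "c \<in> carrier K" "t \<in> ?T" for c t
      unfolding ops3[OF that(2,1), symmetric] using DD that T D0 by metis
    ultimately show "D \<in> lie_derivations K L \<and> D \<in> extensional (carrier L) \<and> (\<forall>n\<in>carrier N. D (free_lie_gen K N n) = free_lie_gen K N (d n))"
      unfolding lie_derivations_def gen using D0c DD d by (auto simp: car T D0_def) (auto simp: D_def car)
  next
    fix F assume F: "F \<in> lie_derivations K L \<and> F \<in> extensional (carrier L) \<and> (\<forall>n\<in>carrier N. F (free_lie_gen K N n) = free_lie_gen K N (d n))"
    have Fz: "F \<zero>\<^bsub>L\<^esub> = \<zero>\<^bsub>L\<^esub>"
    proof -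
      have "F (\<zero>\<^bsub>K\<^esub> \<odot>\<^bsub>L\<^esub> \<zero>\<^bsub>L\<^esub>) = \<zero>\<^bsub>K\<^esub> \<odot>\<^bsub>L\<^esub> F \<zero>\<^bsub>L\<^esub>" "F \<zero>\<^bsub>L\<^esub> \<in> carrier L" using F unfolding lie_derivations_def by (blast intro: L.M.zero_closed R.zero_closed)+
      then show ?thesis by simp
    qed
    have "F (cl t) = D0 t" if "t \<in> ?T" for t
      using that by induction (use F Fz in \<open>auto simp: ops D0 gen zer clc T lie_derivations_def D0_def[of "TGen _"]\<close>)
    then have "F x = D x" if "x \<in> carrier L" for x using that DD car by auto
    then show "F = D" using F by (intro extensionalityI[of _ "carrier L"]) (auto simp: D_def)
  qed
qed

end

theory Submission
  imports Defs
begin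

text \<open>
  The isomorphism with the semidirect product is constructed in both directions from universal properties.

  By freeness there is a homomorphism \<open>\<phi>\<close> from \<open>L(V \<oplus> W)\<close> to the semidirect product of
  \<open>G = L(V)/\<langle>A\<rangle>\<close> and \<open>L(N)\<close> that sends \<open>v \<in> V\<close> to \<open>(v + \<langle>A\<rangle>, 0)\<close> and \<open>w \<in> W\<close> to \<open>(0, w + M1)\<close>. It
  sends every \<open>x \<in> L(V)\<close> to \<open>(x + \<langle>A\<rangle>, 0)\<close> and, since bracketing with \<open>x\<close> becomes the action of
  \<open>x\<close>, every \<open>m \<in> M\<close> to the generator \<open>(0, m + M1)\<close>. So \<open>\<phi>\<close> kills \<open>A\<close> and \<open>B\<close> and induces a
  homomorphism \<open>\<Phi>\<close> on the quotient \<open>Q\<close> of \<open>L(V \<oplus> W)\<close> by \<open>I = \<langle>A, B\<rangle>\<close>.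

  Conversely \<open>\<langle>A\<rangle> \<subseteq> I\<close> and \<open>M1 \<subseteq> I\<close>. So the inclusions of \<open>L(V)\<close> and \<open>M\<close> induce a homomorphism
  \<open>h : G \<rightarrow> Q\<close> and a linear map \<open>N \<rightarrow> Q\<close>, and the latter extends to a homomorphism
  \<open>\<psi> : L(N) \<rightarrow> Q\<close>. It satisfies \<open>\<psi> (g\<cdot>n) = [h g, \<psi> n]\<close>, as is checked on \<open>N\<close> and propagated by the
  derivation rule. Hence \<open>\<Psi> (g, n) = h g + \<psi> n\<close> is a homomorphism from the semidirect product to
  \<open>Q\<close>. That \<open>\<Phi>\<close> and \<open>\<Psi>\<close> are inverse to each other is checked on generators
  (\<open>\<Phi>_\<Psi>\<close>, \<open>\<Psi>_\<Phi>\<close>).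

  The identification of \<open>L(N)\<close> with the ideal generated by \<open>W\<close> is then read off:
  \<open>\<psi>\<close> is injective because \<open>\<Phi>\<close> inverts it, and its image is an ideal because \<open>L(N)\<close> is one in the semidirect product. The image contains \<open>W\<close> and lies in the ideal
  generated by \<open>W\<close>, so it equals that ideal (\<open>\<psi>_image\<close>).

  That \<open>N\<close> is a module comes down to the stability of \<open>M1\<close> under \<open>L(V)\<close> and to \<open>[\<langle>A\<rangle>, M] \<subseteq> M1\<close>. The enveloping
  algebra enters only through \<open>uea_span_props\<close>, which describes \<open>U(L(V))\<cdot>W\<close> and \<open>U(L(V))\<cdot>B\<close> as the
  least subspaces stable under \<open>L(V)\<close> that contain \<open>W\<close> and \<open>B\<close>.
\<close>

section \<open>Subspaces and quotients of vector spaces\<close>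

lemma a_r_coset_carrier_update [simp]:
  "I +>\<^bsub>L\<lparr>carrier := H\<rparr>\<^esub> x = I +>\<^bsub>L\<^esub> x"
  by (simp add: a_r_coset_def')

lemma set_addI: "\<lbrakk>s \<in> S; t \<in> T\<rbrakk> \<Longrightarrow> s \<oplus>\<^bsub>L\<^esub> t \<in> S <+>\<^bsub>L\<^esub> T"
  unfolding set_add_def' by blast

context module
begin

lemma submodule_zero: "submodule H R M \<Longrightarrow> \<zero>\<^bsub>M\<^esub> \<in> H"
  unfolding submodule_def using subgroup.one_closed[of H "add_monoid M"] by auto

text \<open>
  Negation is multiplication by \<open>-1\<close>, so closure under negatives comes for free.
\<close>

lemma submoduleI_vs:
  assumes "H \<subseteq> carrier M" "\<zero>\<^bsub>M\<^esub> \<in> H"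
    and "\<And>x y. \<lbrakk>x \<in> H; y \<in> H\<rbrakk> \<Longrightarrow> x \<oplus>\<^bsub>M\<^esub> y \<in> H"
    and "\<And>c x. \<lbrakk>c \<in> carrier R; x \<in> H\<rbrakk> \<Longrightarrow> c \<odot>\<^bsub>M\<^esub> x \<in> H"
  shows "submodule H R M"
proof (rule submoduleI)
  fix x assume x: "x \<in> H"
  have "(\<ominus> \<one>) \<odot>\<^bsub>M\<^esub> x \<in> H" using assms(4) x by blast
  then show "\<ominus>\<^bsub>M\<^esub> x \<in> H" using x assms(1) smult_l_minus[of "\<one>" x] by auto
qed (use assms in auto)

lemma submodule_minus: "\<lbrakk>submodule H R M; x \<in> H; y \<in> H\<rbrakk> \<Longrightarrow> x \<ominus>\<^bsub>M\<^esub> y \<in> H"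
  by (simp add: M.minus_eq submoduleE(3,5))

text \<open>
  Common to \<^const>\<open>lin_span\<close> and \<^const>\<open>ideal_gen\<close>: an intersection of subspaces is a subspace.
\<close>

lemma submodule_hull:
  assumes "\<And>H. P H \<Longrightarrow> submodule H R M" "P (carrier M)" "S \<subseteq> carrier M"
  shows "submodule (P hull S) R M"
proof (rule submoduleI_vs)
  show "P hull S \<subseteq> carrier M" using assms by (intro hull_minimal)
  have *: "x \<in> H \<and> submodule H R M" if "x \<in> P hull S" "P H" "S \<subseteq> H" for x H
    using that assms(1) by (auto simp: hull_def)
  show "c \<odot>\<^bsub>M\<^esub> x \<in> P hull S" if "c \<in> carrier R" "x \<in> P hull S" for c x
    unfolding hull_def using * that by (auto intro: submoduleE(4))
  show "x \<oplus>\<^bsub>M\<^esub> y \<in> P hull S" if "x \<in> P hull S" "y \<in> P hull S" for x y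
    unfolding hull_def using * that by (auto intro: submoduleE(5))
qed (auto simp: hull_def intro: submodule_zero assms(1))

lemma lin_span_submodule: "S \<subseteq> carrier M \<Longrightarrow> submodule (lin_span R M S) R M"
  unfolding lin_span_def by (rule submodule_hull) (simp_all add: carrier_is_submodule)

lemma lin_span_minimal: "\<lbrakk>S \<subseteq> T; submodule T R M\<rbrakk> \<Longrightarrow> lin_span R M S \<subseteq> T"
  unfolding lin_span_def by (rule hull_minimal)

lemma submodule_of_submodule:
  assumes H: "submodule H R M" and T: "submodule T R (M\<lparr>carrier := H\<rparr>)"
  shows "submodule T R M"
proof -
  interpret H: module R "M\<lparr>carrier := H\<rparr>"
    using submodule.submodule_is_module[OF H module_axioms] .
  show ?thesis
    using H.submoduleE[OF T] submoduleE(1)[OF H] H.submodule_zero[OF T]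
    by (intro submoduleI_vs) auto
qed

lemma submodule_sum:
  assumes S: "submodule S R M" and T: "submodule T R M"
  shows "submodule (S <+>\<^bsub>M\<^esub> T) R M"
proof (rule submoduleI_vs)
  note * = submoduleE(1,4,5)[OF S] submoduleE(1,4,5)[OF T]
  show "S <+>\<^bsub>M\<^esub> T \<subseteq> carrier M" using * by (auto simp: set_add_def')
  have "\<zero>\<^bsub>M\<^esub> = \<zero>\<^bsub>M\<^esub> \<oplus>\<^bsub>M\<^esub> \<zero>\<^bsub>M\<^esub>" by simp
  then show "\<zero>\<^bsub>M\<^esub> \<in> S <+>\<^bsub>M\<^esub> T"
    using set_addI[OF submodule_zero[OF S] submodule_zero[OF T], of M] by simp
next
  note * = submoduleE(1,4,5)[OF S] submoduleE(1,4,5)[OF T]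
  note c = subsetD[OF *(1)] subsetD[OF *(4)]
  fix x y assume "x \<in> S <+>\<^bsub>M\<^esub> T" "y \<in> S <+>\<^bsub>M\<^esub> T"
  then obtain s t s' t' where st: "s \<in> S" "t \<in> T" "s' \<in> S" "t' \<in> T"
    "x = s \<oplus>\<^bsub>M\<^esub> t" "y = s' \<oplus>\<^bsub>M\<^esub> t'" by (auto simp: set_add_def')
  have "x \<oplus>\<^bsub>M\<^esub> y = (s \<oplus>\<^bsub>M\<^esub> s') \<oplus>\<^bsub>M\<^esub> (t \<oplus>\<^bsub>M\<^esub> t')"
    using st c by (simp add: M.a_ac)
  then show "x \<oplus>\<^bsub>M\<^esub> y \<in> S <+>\<^bsub>M\<^esub> T"
    using st *(3,6) by (simp add: set_addI)
next
  note * = submoduleE(1,4,5)[OF S] submoduleE(1,4,5)[OF T]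
  note c = subsetD[OF *(1)] subsetD[OF *(4)]
  fix a x assume a: "a \<in> carrier R" and "x \<in> S <+>\<^bsub>M\<^esub> T"
  then obtain s t where st: "s \<in> S" "t \<in> T" "x = s \<oplus>\<^bsub>M\<^esub> t" by (auto simp: set_add_def')
  have "a \<odot>\<^bsub>M\<^esub> x = a \<odot>\<^bsub>M\<^esub> s \<oplus>\<^bsub>M\<^esub> a \<odot>\<^bsub>M\<^esub> t"
    using st c a by (simp add: smult_r_distr)
  then show "a \<odot>\<^bsub>M\<^esub> x \<in> S <+>\<^bsub>M\<^esub> T"
    using st a *(2,5) by (simp add: set_addI)
qed

lemma submodule_sum_incl:
  assumes S: "submodule S R M" and T: "submodule T R M"
  shows "S \<subseteq> S <+>\<^bsub>M\<^esub> T" "T \<subseteq> S <+>\<^bsub>M\<^esub> T"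
proof -
  show "S \<subseteq> S <+>\<^bsub>M\<^esub> T"
  proof
    fix s assume s: "s \<in> S"
    then have "s = s \<oplus>\<^bsub>M\<^esub> \<zero>\<^bsub>M\<^esub>" using submoduleE(1)[OF S] by auto
    then show "s \<in> S <+>\<^bsub>M\<^esub> T" using set_addI[OF s submodule_zero[OF T], of M] by simp
  qed
  show "T \<subseteq> S <+>\<^bsub>M\<^esub> T"
  proof
    fix t assume t: "t \<in> T"
    then have "t = \<zero>\<^bsub>M\<^esub> \<oplus>\<^bsub>M\<^esub> t" using submoduleE(1)[OF T] by auto
    then show "t \<in> S <+>\<^bsub>M\<^esub> T" using set_addI[OF submodule_zero[OF S] t, of M] by simp
  qed
qed

lemma mem_coset_iff: 
  assumes I: "submodule I R M" and "x \<in> carrier M"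
  shows "y \<in> I +>\<^bsub>M\<^esub> x \<longleftrightarrow> y \<in> carrier M \<and> y \<ominus>\<^bsub>M\<^esub> x \<in> I"
proof -
  have "y = (y \<ominus>\<^bsub>M\<^esub> x) \<oplus>\<^bsub>M\<^esub> x" if "y \<in> carrier M"
    using that assms(2) by (simp add: M.minus_eq M.a_assoc M.l_neg)
  moreover have "(i \<oplus>\<^bsub>M\<^esub> x) \<ominus>\<^bsub>M\<^esub> x = i" if "i \<in> carrier M" for i
    using that assms(2) by (simp add: M.minus_eq M.a_assoc M.r_neg)
  ultimately show ?thesis
    using submoduleE(1)[OF I] assms(2) by (auto simp: a_r_coset_def')
qed

lemma coset_eq_iff:
  assumes I: "submodule I R M" and x: "x \<in> carrier M" and y: "y \<in> carrier M"
  shows "I +>\<^bsub>M\<^esub> x = I +>\<^bsub>M\<^esub> y \<longleftrightarrow> x \<ominus>\<^bsub>M\<^esub> y \<in> I"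
proof -
  have s: "subgroup I (add_monoid M)" using I by (simp add: submodule_def)
  have "x \<in> I +>\<^bsub>M\<^esub> x"
    using x submodule_zero[OF I] by (simp add: mem_coset_iff[OF I] M.minus_eq M.r_neg)
  then show ?thesis
    using M.a_repr_independence[OF _ y s, of x] mem_coset_iff[OF I y] x by auto
qed

lemma coset_self: "\<lbrakk>submodule I R M; x \<in> carrier M\<rbrakk> \<Longrightarrow> x \<in> I +>\<^bsub>M\<^esub> x"
  by (simp add: mem_coset_iff submodule_zero M.minus_eq M.r_neg)

lemma coset_eqI: "\<lbrakk>submodule I R M; x \<in> carrier M; y \<in> I +>\<^bsub>M\<^esub> x\<rbrakk> \<Longrightarrow> I +>\<^bsub>M\<^esub> y = I +>\<^bsub>M\<^esub> x"
  by (simp add: mem_coset_iff coset_eq_iff)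

lemma coset_zero: "submodule I R M \<Longrightarrow> I +>\<^bsub>M\<^esub> \<zero>\<^bsub>M\<^esub> = I"
  by (simp add: submoduleE(1))

lemma coset_eq_self_iff: "\<lbrakk>submodule I R M; x \<in> carrier M\<rbrakk> \<Longrightarrow> I +>\<^bsub>M\<^esub> x = I \<longleftrightarrow> x \<in> I"
  using coset_eq_iff[of I x "\<zero>\<^bsub>M\<^esub>"] M.minus_equality[of "\<zero>\<^bsub>M\<^esub>" "\<zero>\<^bsub>M\<^esub>"]
  by (simp add: coset_zero M.minus_eq)

lemma quot_carrier: "carrier (lie_quot M I) = (\<lambda>x. I +>\<^bsub>M\<^esub> x) ` carrier M"
  by (auto simp: lie_quot_def FactRing_def A_RCOSETS_def' ring.defs module.defs)

lemma quot_zero: "\<zero>\<^bsub>lie_quot M I\<^esub> = I"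
  by (simp add: lie_quot_def FactRing_def ring.defs module.defs)

lemma quot_mult: "C \<otimes>\<^bsub>lie_quot M I\<^esub> D = [mod I:] C \<Otimes>\<^bsub>M\<^esub> D"
  by (simp add: lie_quot_def FactRing_def ring.defs module.defs)

lemma quot_add:
  assumes I: "submodule I R M" and "x \<in> carrier M" "y \<in> carrier M"
  shows "(I +>\<^bsub>M\<^esub> x) \<oplus>\<^bsub>lie_quot M I\<^esub> (I +>\<^bsub>M\<^esub> y) = I +>\<^bsub>M\<^esub> (x \<oplus>\<^bsub>M\<^esub> y)"
proof -
  interpret I: abelian_subgroup I M
    using I by (intro abelian_subgroupI3) (simp_all add: submodule_def additive_subgroup_def M.abelian_group_axioms)
  show ?thesis
    using I.a_rcos_sum[OF assms(2,3)] by (simp add: lie_quot_def FactRing_def ring.defs module.defs)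
qed

text \<open>
  The operations on cosets are unions over representatives; this lemma evaluates such a union once
  the independence of the representative is known.
\<close>

lemma UN_coset:
  assumes I: "submodule I R M" and x: "x \<in> carrier M" and "\<And>y. y \<in> I +>\<^bsub>M\<^esub> x \<Longrightarrow> F y = F x"
  shows "(\<Union>y\<in>I +>\<^bsub>M\<^esub> x. F y) = F x"
  using assms(3) coset_self[OF I x] by blast

lemma quot_smult:
  assumes I: "submodule I R M" and x: "x \<in> carrier M" and c: "c \<in> carrier R"
  shows "c \<odot>\<^bsub>lie_quot M I\<^esub> (I +>\<^bsub>M\<^esub> x) = I +>\<^bsub>M\<^esub> (c \<odot>\<^bsub>M\<^esub> x)"
proof -
  have "(\<Union>y\<in>I +>\<^bsub>M\<^esub> x. I +>\<^bsub>M\<^esub> (c \<odot>\<^bsub>M\<^esub> y)) = I +>\<^bsub>M\<^esub> (c \<odot>\<^bsub>M\<^esub> x)"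
  proof (rule UN_coset[OF I x])
    fix y assume "y \<in> I +>\<^bsub>M\<^esub> x"
    then have y: "y \<in> carrier M" "y \<ominus>\<^bsub>M\<^esub> x \<in> I" using mem_coset_iff[OF I x] by auto
    have "c \<odot>\<^bsub>M\<^esub> y \<ominus>\<^bsub>M\<^esub> c \<odot>\<^bsub>M\<^esub> x = c \<odot>\<^bsub>M\<^esub> (y \<ominus>\<^bsub>M\<^esub> x)"
      using y x c by (simp add: M.minus_eq smult_r_distr smult_r_minus)
    then show "I +>\<^bsub>M\<^esub> (c \<odot>\<^bsub>M\<^esub> y) = I +>\<^bsub>M\<^esub> (c \<odot>\<^bsub>M\<^esub> x)"
      using y x c submoduleE(4)[OF I c] by (simp add: coset_eq_iff[OF I])
  qed
  then show ?thesis by (simp add: lie_quot_def FactRing_def ring.defs module.defs)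
qed

lemma quot_module:
  assumes I: "submodule I R M"
  shows "module R (lie_quot M I)"
proof (intro moduleI abelian_groupI)
  note q = quot_carrier quot_add[OF I] quot_smult[OF I]
  show "cring R" by (rule R.is_cring)
  have z: "\<zero>\<^bsub>lie_quot M I\<^esub> = I +>\<^bsub>M\<^esub> \<zero>\<^bsub>M\<^esub>" using coset_zero[OF I] quot_zero by simp
  then show "\<zero>\<^bsub>lie_quot M I\<^esub> \<in> carrier (lie_quot M I)" by (auto simp: quot_carrier)
  fix C assume "C \<in> carrier (lie_quot M I)"
  then obtain x where x: "x \<in> carrier M" "C = I +>\<^bsub>M\<^esub> x" by (auto simp: quot_carrier)
  show "\<zero>\<^bsub>lie_quot M I\<^esub> \<oplus>\<^bsub>lie_quot M I\<^esub> C = C" using x unfolding z by (simp add: q)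
  have "(I +>\<^bsub>M\<^esub> (\<ominus>\<^bsub>M\<^esub> x)) \<oplus>\<^bsub>lie_quot M I\<^esub> C = \<zero>\<^bsub>lie_quot M I\<^esub>"
    using x unfolding z by (simp add: q M.l_neg)
  then show "\<exists>D\<in>carrier (lie_quot M I). D \<oplus>\<^bsub>lie_quot M I\<^esub> C = \<zero>\<^bsub>lie_quot M I\<^esub>"
    using x by (auto simp: quot_carrier)
qed (auto simp: quot_carrier quot_add[OF I] quot_smult[OF I] M.a_ac smult_l_distr smult_r_distr smult_assoc1)

end

section \<open>Brackets, ideals and quotients of Lie algebras\<close>

context lie_algebra
begin

lemma bracket_zero [simp]:
  assumes "x \<in> carrier L"
  shows "\<zero>\<^bsub>L\<^esub> \<otimes>\<^bsub>L\<^esub> x = \<zero>\<^bsub>L\<^esub>" "x \<otimes>\<^bsub>L\<^esub> \<zero>\<^bsub>L\<^esub> = \<zero>\<^bsub>L\<^esub>"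
  using lie_smult_left[of \<zero> "\<zero>\<^bsub>L\<^esub>" x] lie_smult_right[of \<zero> x "\<zero>\<^bsub>L\<^esub>"] assms by (simp_all add: lie_closed)

lemma anticommutative:
  assumes xy: "x \<in> carrier L" "y \<in> carrier L"
  shows "x \<otimes>\<^bsub>L\<^esub> y = \<ominus>\<^bsub>L\<^esub> (y \<otimes>\<^bsub>L\<^esub> x)"
proof -
  have "\<zero>\<^bsub>L\<^esub> = (x \<oplus>\<^bsub>L\<^esub> y) \<otimes>\<^bsub>L\<^esub> (x \<oplus>\<^bsub>L\<^esub> y)" using xy lie_alternating by simp
  also have "\<dots> = x \<otimes>\<^bsub>L\<^esub> y \<oplus>\<^bsub>L\<^esub> y \<otimes>\<^bsub>L\<^esub> x"
    using xy lie_alternating[OF xy(1)] lie_alternating[OF xy(2)]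
    by (simp add: lie_add_left lie_add_right lie_closed M.a_comm)
  finally show ?thesis using xy by (metis M.minus_equality lie_closed)
qed

lemma bracket_minus:
  assumes "x \<in> carrier L" "y \<in> carrier L"
  shows "(\<ominus>\<^bsub>L\<^esub> x) \<otimes>\<^bsub>L\<^esub> y = \<ominus>\<^bsub>L\<^esub> (x \<otimes>\<^bsub>L\<^esub> y)" "x \<otimes>\<^bsub>L\<^esub> (\<ominus>\<^bsub>L\<^esub> y) = \<ominus>\<^bsub>L\<^esub> (x \<otimes>\<^bsub>L\<^esub> y)"
  using lie_smult_left[of "\<ominus> \<one>" x y] lie_smult_right[of "\<ominus> \<one>" x y] assms
  by (simp_all add: smult_l_minus lie_closed)

text \<open>
  The Jacobi identity in the form in which it is used below: \<open>[x, -]\<close> is a derivation.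
\<close>

lemma leibniz:
  assumes "x \<in> carrier L" "y \<in> carrier L" "z \<in> carrier L"
  shows "x \<otimes>\<^bsub>L\<^esub> (y \<otimes>\<^bsub>L\<^esub> z) = ((x \<otimes>\<^bsub>L\<^esub> y) \<otimes>\<^bsub>L\<^esub> z) \<oplus>\<^bsub>L\<^esub> (y \<otimes>\<^bsub>L\<^esub> (x \<otimes>\<^bsub>L\<^esub> z))"
proof -
  have 1: "z \<otimes>\<^bsub>L\<^esub> (x \<otimes>\<^bsub>L\<^esub> y) = \<ominus>\<^bsub>L\<^esub> ((x \<otimes>\<^bsub>L\<^esub> y) \<otimes>\<^bsub>L\<^esub> z)"
    using anticommutative[of z "x \<otimes>\<^bsub>L\<^esub> y"] assms by (simp add: lie_closed)
  have 2: "y \<otimes>\<^bsub>L\<^esub> (z \<otimes>\<^bsub>L\<^esub> x) = \<ominus>\<^bsub>L\<^esub> (y \<otimes>\<^bsub>L\<^esub> (x \<otimes>\<^bsub>L\<^esub> z))"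
    using anticommutative[of z x] assms by (simp add: lie_closed bracket_minus)
  let ?a = "x \<otimes>\<^bsub>L\<^esub> (y \<otimes>\<^bsub>L\<^esub> z)" and ?b = "y \<otimes>\<^bsub>L\<^esub> (x \<otimes>\<^bsub>L\<^esub> z)" and ?c = "(x \<otimes>\<^bsub>L\<^esub> y) \<otimes>\<^bsub>L\<^esub> z"
  have c: "?a \<in> carrier L" "?b \<in> carrier L" "?c \<in> carrier L" using assms by (simp_all add: lie_closed)
  have "\<ominus>\<^bsub>L\<^esub> (\<ominus>\<^bsub>L\<^esub> ?b \<oplus>\<^bsub>L\<^esub> \<ominus>\<^bsub>L\<^esub> ?c) = ?a"
    by (rule M.minus_equality) (use lie_jacobi[OF assms] c in \<open>simp_all add: 1 2\<close>)
  then show ?thesis using c by (simp add: M.minus_add M.a_comm)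
qed

text \<open>
  A condition under which the elementwise product of a coset of \<open>I1\<close> and a coset of \<open>I2\<close> lies in
  a single coset of \<open>I\<close>. Taking three different subspaces covers both the bracket of a quotient
  algebra and the action of a quotient algebra on a quotient of a module.
\<close>

lemma rcoset_mult_bracket:
  assumes I1: "submodule I1 K L" and I2: "submodule I2 K L" and I: "submodule I K L"
    and x: "x \<in> carrier L" and y: "y \<in> carrier L"
    and 1: "\<And>a. a \<in> I1 \<Longrightarrow> a \<otimes>\<^bsub>L\<^esub> y \<in> I" and 2: "\<And>b. b \<in> I2 \<Longrightarrow> x \<otimes>\<^bsub>L\<^esub> b \<in> I"
    and 3: "\<And>a b. \<lbrakk>a \<in> I1; b \<in> I2\<rbrakk> \<Longrightarrow> a \<otimes>\<^bsub>L\<^esub> b \<in> I"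
  shows "[mod I:] (I1 +>\<^bsub>L\<^esub> x) \<Otimes>\<^bsub>L\<^esub> (I2 +>\<^bsub>L\<^esub> y) = I +>\<^bsub>L\<^esub> (x \<otimes>\<^bsub>L\<^esub> y)"
proof -
  have *: "I +>\<^bsub>L\<^esub> (a \<otimes>\<^bsub>L\<^esub> b) = I +>\<^bsub>L\<^esub> (x \<otimes>\<^bsub>L\<^esub> y)"
    if "a \<in> I1 +>\<^bsub>L\<^esub> x" "b \<in> I2 +>\<^bsub>L\<^esub> y" for a b
  proof -
    obtain i j where ij: "i \<in> I1" "j \<in> I2" "a = i \<oplus>\<^bsub>L\<^esub> x" "b = j \<oplus>\<^bsub>L\<^esub> y"
      using \<open>a \<in> _\<close> \<open>b \<in> _\<close> by (auto simp: a_r_coset_def')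
    have c: "i \<in> carrier L" "j \<in> carrier L"
      using ij submoduleE(1)[OF I1] submoduleE(1)[OF I2] by auto
    have "a \<otimes>\<^bsub>L\<^esub> b = ((i \<otimes>\<^bsub>L\<^esub> j) \<oplus>\<^bsub>L\<^esub> ((i \<otimes>\<^bsub>L\<^esub> y) \<oplus>\<^bsub>L\<^esub> (x \<otimes>\<^bsub>L\<^esub> j))) \<oplus>\<^bsub>L\<^esub> (x \<otimes>\<^bsub>L\<^esub> y)"
      using c x y ij by (simp add: lie_add_left lie_add_right lie_closed M.a_ac)
    moreover have "(i \<otimes>\<^bsub>L\<^esub> j) \<oplus>\<^bsub>L\<^esub> ((i \<otimes>\<^bsub>L\<^esub> y) \<oplus>\<^bsub>L\<^esub> (x \<otimes>\<^bsub>L\<^esub> j)) \<in> I"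
      using 1 2 3 ij submoduleE(5)[OF I] by blast
    ultimately have "a \<otimes>\<^bsub>L\<^esub> b \<in> I +>\<^bsub>L\<^esub> (x \<otimes>\<^bsub>L\<^esub> y)" by (auto simp: a_r_coset_def')
    then show ?thesis using coset_eqI[OF I] lie_closed[OF x y] by blast
  qed
  have "x \<in> I1 +>\<^bsub>L\<^esub> x" "y \<in> I2 +>\<^bsub>L\<^esub> y" using coset_self I1 I2 x y by auto
  then show ?thesis unfolding rcoset_mult_def using * by blast
qed

lemma lie_subalgebra:
  assumes H: "submodule H K L" and c: "\<And>x y. \<lbrakk>x \<in> H; y \<in> H\<rbrakk> \<Longrightarrow> x \<otimes>\<^bsub>L\<^esub> y \<in> H"
  shows "lie_algebra K (L\<lparr>carrier := H\<rparr>)"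
proof -
  interpret H: module K "L\<lparr>carrier := H\<rparr>" using submodule.submodule_is_module[OF H module_axioms] .
  show ?thesis
    using submoduleE(1)[OF H] c
    by unfold_locales
      (simp_all add: subset_iff lie_add_left lie_add_right lie_smult_left lie_smult_right
        lie_alternating lie_jacobi)
qed

lemma lie_ideal_right: "\<lbrakk>lie_ideal K L I; a \<in> I; x \<in> carrier L\<rbrakk> \<Longrightarrow> a \<otimes>\<^bsub>L\<^esub> x \<in> I"
  unfolding lie_ideal_def using anticommutative[of a x] submoduleE(1,3)[of I] by (metis subsetD)

lemma ideal_gen_ideal:
  assumes "S \<subseteq> carrier L"
  shows "lie_ideal K L (ideal_gen K L S)"
  unfolding lie_ideal_def
proof (intro conjI ballI)
  have "lie_ideal K L (carrier L)" by (simp add: lie_ideal_def carrier_is_submodule lie_closed)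
  then show "submodule (ideal_gen K L S) K L"
    unfolding ideal_gen_def by (rule submodule_hull[rotated]) (simp_all add: lie_ideal_def assms)
qed (auto simp: ideal_gen_def hull_def lie_ideal_def)

lemma ideal_gen_incl: "S \<subseteq> ideal_gen K L S"
  unfolding ideal_gen_def by (rule hull_subset)

lemma ideal_gen_minimal: "\<lbrakk>S \<subseteq> T; lie_ideal K L T\<rbrakk> \<Longrightarrow> ideal_gen K L S \<subseteq> T"
  unfolding ideal_gen_def by (rule hull_minimal)

lemma quot_bracket:
  assumes I: "lie_ideal K L I" and xy: "x \<in> carrier L" "y \<in> carrier L"
  shows "(I +>\<^bsub>L\<^esub> x) \<otimes>\<^bsub>lie_quot L I\<^esub> (I +>\<^bsub>L\<^esub> y) = I +>\<^bsub>L\<^esub> (x \<otimes>\<^bsub>L\<^esub> y)"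
proof -
  have s: "submodule I K L" using I by (simp add: lie_ideal_def)
  show ?thesis unfolding quot_mult
  proof (rule rcoset_mult_bracket[OF s s s xy])
    show "x \<otimes>\<^bsub>L\<^esub> b \<in> I" if "b \<in> I" for b using I xy that by (simp add: lie_ideal_def)
    show "a \<otimes>\<^bsub>L\<^esub> y \<in> I" if "a \<in> I" for a using lie_ideal_right[OF I] xy that by simp
    show "a \<otimes>\<^bsub>L\<^esub> b \<in> I" if "a \<in> I" "b \<in> I" for a b
      using lie_ideal_right[OF I] submoduleE(1)[OF s] that by auto
  qed
qed

lemma quot_lie_algebra:
  assumes I: "lie_ideal K L I"
  shows "lie_algebra K (lie_quot L I)"
proof -
  have s: "submodule I K L" using I by (simp add: lie_ideal_def)
  interpret Q: module K "lie_quot L I" by (rule quot_module[OF s])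
  have z: "\<zero>\<^bsub>lie_quot L I\<^esub> = I +>\<^bsub>L\<^esub> \<zero>\<^bsub>L\<^esub>" using coset_zero[OF s] quot_zero by simp
  show ?thesis
    by unfold_locales
      (auto simp: quot_carrier z quot_add[OF s] quot_smult[OF s] quot_bracket[OF I] lie_closed
        lie_add_left lie_add_right lie_smult_left lie_smult_right lie_alternating lie_jacobi)
qed

end

section \<open>Homomorphisms of Lie algebras\<close>

lemma lie_homD:
  assumes "f \<in> lie_hom K L L'"
  shows "x \<in> carrier L \<Longrightarrow> f x \<in> carrier L'"
    and "\<lbrakk>x \<in> carrier L; y \<in> carrier L\<rbrakk> \<Longrightarrow> f (x \<oplus>\<^bsub>L\<^esub> y) = f x \<oplus>\<^bsub>L'\<^esub> f y"
    and "\<lbrakk>c \<in> carrier K; x \<in> carrier L\<rbrakk> \<Longrightarrow> f (c \<odot>\<^bsub>L\<^esub> x) = c \<odot>\<^bsub>L'\<^esub> f x"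
    and "\<lbrakk>x \<in> carrier L; y \<in> carrier L\<rbrakk> \<Longrightarrow> f (x \<otimes>\<^bsub>L\<^esub> y) = f x \<otimes>\<^bsub>L'\<^esub> f y"
  using assms by (auto simp: lie_hom_def)

lemma linear_zero:
  assumes "module K L" "module K L'" "f \<in> carrier L \<rightarrow> carrier L'"
    and "\<And>c x. \<lbrakk>c \<in> carrier K; x \<in> carrier L\<rbrakk> \<Longrightarrow> f (c \<odot>\<^bsub>L\<^esub> x) = c \<odot>\<^bsub>L'\<^esub> f x"
  shows "f \<zero>\<^bsub>L\<^esub> = \<zero>\<^bsub>L'\<^esub>"
proof -
  interpret L: module K L by fact
  interpret L': module K L' by fact
  have "f (\<zero>\<^bsub>K\<^esub> \<odot>\<^bsub>L\<^esub> \<zero>\<^bsub>L\<^esub>) = \<zero>\<^bsub>K\<^esub> \<odot>\<^bsub>L'\<^esub> f \<zero>\<^bsub>L\<^esub>" using assms(4) by blast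
  moreover have "f \<zero>\<^bsub>L\<^esub> \<in> carrier L'" using assms(3) by auto
  ultimately show ?thesis by simp
qed

lemma lie_hom_zero:
  assumes "lie_algebra K L" "lie_algebra K L'" "f \<in> lie_hom K L L'"
  shows "f \<zero>\<^bsub>L\<^esub> = \<zero>\<^bsub>L'\<^esub>"
  using assms by (intro linear_zero[of K L L' f]) (auto simp: lie_hom_def lie_algebra_def)

lemma lie_hom_minus:
  assumes "lie_algebra K L" "lie_algebra K L'" "f \<in> lie_hom K L L'" "x \<in> carrier L" "y \<in> carrier L"
  shows "f (x \<ominus>\<^bsub>L\<^esub> y) = f x \<ominus>\<^bsub>L'\<^esub> f y"
proof -
  interpret L: lie_algebra K L by fact
  interpret L': lie_algebra K L' by fact
  note f = lie_homD[OF assms(3)]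
  have "f (\<ominus>\<^bsub>L\<^esub> y) \<oplus>\<^bsub>L'\<^esub> f y = \<zero>\<^bsub>L'\<^esub>"
    using f(2)[of "\<ominus>\<^bsub>L\<^esub> y" y] assms(5) by (simp add: L.M.l_neg lie_hom_zero[OF assms(1-3)])
  then have "f (\<ominus>\<^bsub>L\<^esub> y) = \<ominus>\<^bsub>L'\<^esub> f y"
    using L'.M.minus_equality[of "f (\<ominus>\<^bsub>L\<^esub> y)" "f y"] f(1) assms(5) by auto
  then show ?thesis using f(2) assms(4,5) by (simp add: L.M.minus_eq L'.M.minus_eq)
qed

lemma lie_hom_kernel_ideal:
  assumes L: "lie_algebra K L" and H: "lie_algebra K H" and f: "f \<in> lie_hom K L H"
  shows "lie_ideal K L {x \<in> carrier L. f x = \<zero>\<^bsub>H\<^esub>}"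
proof -
  interpret L: lie_algebra K L by fact
  interpret H: lie_algebra K H by fact
  show ?thesis
    unfolding lie_ideal_def
    by (intro conjI L.submoduleI_vs)
      (auto simp: lie_homD[OF f] lie_hom_zero[OF L H f] L.lie_closed)
qed

text \<open>
  The homomorphism theorem. The value at a coset is read off from an arbitrary representative.
\<close>

lemma lie_hom_factor:
  assumes L: "lie_algebra K L" and H: "lie_algebra K H" and I: "lie_ideal K L I"
    and f: "f \<in> lie_hom K L H" and ker: "\<And>x. x \<in> I \<Longrightarrow> f x = \<zero>\<^bsub>H\<^esub>"
  shows "\<exists>F\<in>lie_hom K (lie_quot L I) H. \<forall>x\<in>carrier L. F (I +>\<^bsub>L\<^esub> x) = f x"
proof -
  interpret L: lie_algebra K L by fact
  interpret H: lie_algebra K H by fact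
  have s: "submodule I K L" using I by (simp add: lie_ideal_def)
  define F where "F C = f (SOME x. x \<in> C)" for C
  have F: "F (I +>\<^bsub>L\<^esub> x) = f x" if x: "x \<in> carrier L" for x
  proof -
    define y where "y = (SOME y. y \<in> I +>\<^bsub>L\<^esub> x)"
    have "y \<in> I +>\<^bsub>L\<^esub> x" unfolding y_def using L.coset_self[OF s x] by (rule someI)
    then have "y \<in> carrier L" "f (y \<ominus>\<^bsub>L\<^esub> x) = \<zero>\<^bsub>H\<^esub>" using L.mem_coset_iff[OF s x] ker by auto
    then have "f y \<ominus>\<^bsub>H\<^esub> f x = \<zero>\<^bsub>H\<^esub>" and c: "f x \<in> carrier H" "f y \<in> carrier H"
      using lie_hom_minus[OF L H f, of y x] x lie_homD(1)[OF f] by auto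
    moreover from c have "f y = (f y \<ominus>\<^bsub>H\<^esub> f x) \<oplus>\<^bsub>H\<^esub> f x"
      by (simp add: H.M.minus_eq H.M.a_assoc H.M.l_neg)
    ultimately have "f y = f x" using c by (metis H.M.l_zero)
    then show ?thesis by (simp add: F_def y_def)
  qed
  have "F \<in> lie_hom K (lie_quot L I) H"
    unfolding lie_hom_def
    by (auto simp: L.quot_carrier L.quot_add[OF s] L.quot_smult[OF s] L.quot_bracket[OF I] F lie_homD[OF f]
        L.lie_closed)
  then show ?thesis using F by blast
qed

section \<open>Modules and semidirect products\<close>

text \<open>
  Stating the compatibility with brackets without subtraction lets sums be compared up to
  associativity and commutativity alone, and avoids the negatives of a restricted module.
\<close>

lemma lie_module_natI:
  assumes G: "lie_algebra K G" and N: "module K N"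
    and "\<And>x n. \<lbrakk>x \<in> carrier G; n \<in> carrier N\<rbrakk> \<Longrightarrow> act x n \<in> carrier N"
    and "\<And>x y n. \<lbrakk>x \<in> carrier G; y \<in> carrier G; n \<in> carrier N\<rbrakk>
      \<Longrightarrow> act (x \<oplus>\<^bsub>G\<^esub> y) n = act x n \<oplus>\<^bsub>N\<^esub> act y n"
    and "\<And>c x n. \<lbrakk>c \<in> carrier K; x \<in> carrier G; n \<in> carrier N\<rbrakk>
      \<Longrightarrow> act (c \<odot>\<^bsub>G\<^esub> x) n = c \<odot>\<^bsub>N\<^esub> act x n"
    and "\<And>x m n. \<lbrakk>x \<in> carrier G; m \<in> carrier N; n \<in> carrier N\<rbrakk>
      \<Longrightarrow> act x (m \<oplus>\<^bsub>N\<^esub> n) = act x m \<oplus>\<^bsub>N\<^esub> act x n"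
    and "\<And>c x n. \<lbrakk>c \<in> carrier K; x \<in> carrier G; n \<in> carrier N\<rbrakk>
      \<Longrightarrow> act x (c \<odot>\<^bsub>N\<^esub> n) = c \<odot>\<^bsub>N\<^esub> act x n"
    and br: "\<And>x y n. \<lbrakk>x \<in> carrier G; y \<in> carrier G; n \<in> carrier N\<rbrakk>
      \<Longrightarrow> act (x \<otimes>\<^bsub>G\<^esub> y) n \<oplus>\<^bsub>N\<^esub> act y (act x n) = act x (act y n)"
  shows "lie_module K G N act"
proof -
  interpret G: lie_algebra K G by fact
  interpret N: module K N by fact
  have "act (x \<otimes>\<^bsub>G\<^esub> y) n = act x (act y n) \<ominus>\<^bsub>N\<^esub> act y (act x n)"
    if "x \<in> carrier G" "y \<in> carrier G" "n \<in> carrier N" for x y n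
    using br[OF that, symmetric] that assms(3) by (simp add: N.M.minus_eq N.M.a_assoc N.M.r_neg G.lie_closed)
  then show ?thesis using assms(3-7) by unfold_locales
qed

context lie_module
begin

lemma act_zero:
  assumes "n \<in> carrier N" "x \<in> carrier G"
  shows "act \<zero>\<^bsub>G\<^esub> n = \<zero>\<^bsub>N\<^esub>" "act x \<zero>\<^bsub>N\<^esub> = \<zero>\<^bsub>N\<^esub>"
  using act_smult_left[of "\<zero>\<^bsub>K\<^esub>" "\<zero>\<^bsub>G\<^esub>" n] act_smult_right[of "\<zero>\<^bsub>K\<^esub>" x "\<zero>\<^bsub>N\<^esub>"] assms
  by (simp_all add: act_closed)

lemma act_minus:
  assumes "n \<in> carrier N" "x \<in> carrier G"
  shows "act x (\<ominus>\<^bsub>N\<^esub> n) = \<ominus>\<^bsub>N\<^esub> act x n"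
  using act_smult_right[of "\<ominus>\<^bsub>K\<^esub> \<one>\<^bsub>K\<^esub>" x n] assms by (simp add: N.smult_l_minus act_closed)

end

lemma semidirect_simps:
  "carrier (lie_semidirect G H act) = carrier G \<times> carrier H"
  "\<zero>\<^bsub>lie_semidirect G H act\<^esub> = (\<zero>\<^bsub>G\<^esub>, \<zero>\<^bsub>H\<^esub>)"
  "(x, a) \<oplus>\<^bsub>lie_semidirect G H act\<^esub> (y, b) = (x \<oplus>\<^bsub>G\<^esub> y, a \<oplus>\<^bsub>H\<^esub> b)"
  "c \<odot>\<^bsub>lie_semidirect G H act\<^esub> (x, a) = (c \<odot>\<^bsub>G\<^esub> x, c \<odot>\<^bsub>H\<^esub> a)"
  "(x, a) \<otimes>\<^bsub>lie_semidirect G H act\<^esub> (y, b)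
     = (x \<otimes>\<^bsub>G\<^esub> y, (act x b \<ominus>\<^bsub>H\<^esub> act y a) \<oplus>\<^bsub>H\<^esub> (a \<otimes>\<^bsub>H\<^esub> b))"
  by (simp_all add: lie_semidirect_def)

lemma semidirect_module:
  assumes "module K G" "module K H"
  shows "module K (lie_semidirect G H act)"
proof -
  interpret G: module K G by fact
  interpret H: module K H by fact
  show ?thesis
  proof (intro moduleI abelian_groupI)
    show "cring K" by (rule G.R.is_cring)
    fix p assume "p \<in> carrier (lie_semidirect G H act)"
    then show "\<exists>q\<in>carrier (lie_semidirect G H act).
        q \<oplus>\<^bsub>lie_semidirect G H act\<^esub> p = \<zero>\<^bsub>lie_semidirect G H act\<^esub>"
      by (intro bexI[of _ "(\<ominus>\<^bsub>G\<^esub> fst p, \<ominus>\<^bsub>H\<^esub> snd p)"]) (auto simp: semidirect_simps G.M.l_neg H.M.l_neg)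
  qed (auto simp: semidirect_simps G.M.a_ac H.M.a_ac G.smult_l_distr G.smult_r_distr G.smult_assoc1
      H.smult_l_distr H.smult_r_distr H.smult_assoc1)
qed

text \<open>
  The first component satisfies the Jacobi identity because \<open>G\<close> does. In the second component each
  \<open>[x, y]\<cdot>c\<close> is replaced by \<open>x\<cdot>(y\<cdot>c) - y\<cdot>(x\<cdot>c)\<close> and each \<open>x\<cdot>[a, b]\<close> is expanded by the derivation
  rule. All terms that involve the action then cancel in pairs, and the Jacobi sum of \<open>H\<close> is left.
\<close>

lemma semidirect_lie_algebra:
  assumes H: "lie_algebra K H" and act: "lie_module K G H act"
    and der: "\<And>x a b. \<lbrakk>x \<in> carrier G; a \<in> carrier H; b \<in> carrier H\<rbrakk>
      \<Longrightarrow> act x (a \<otimes>\<^bsub>H\<^esub> b) = (act x a \<otimes>\<^bsub>H\<^esub> b) \<oplus>\<^bsub>H\<^esub> (a \<otimes>\<^bsub>H\<^esub> act x b)"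
  shows "lie_algebra K (lie_semidirect G H act)"
proof -
  interpret H: lie_algebra K H by fact
  interpret G: lie_module K G H act by fact
  interpret S: module K "lie_semidirect G H act"
    by (intro semidirect_module G.module_axioms H.module_axioms)
  note s = G.act_closed G.lie_closed H.lie_closed G.act_add_left G.act_add_right
    G.act_smult_left G.act_smult_right G.act_minus G.act_bracket der
    G.lie_add_left G.lie_add_right G.lie_smult_left G.lie_smult_right G.lie_alternating
    H.lie_add_left H.lie_add_right H.lie_smult_left H.lie_smult_right H.lie_alternating
    H.bracket_minus
    H.M.minus_eq H.M.minus_add H.smult_r_distr H.smult_r_minus
  have jac: "(act x (act y c \<ominus>\<^bsub>H\<^esub> act z b \<oplus>\<^bsub>H\<^esub> b \<otimes>\<^bsub>H\<^esub> c) \<ominus>\<^bsub>H\<^esub> act (y \<otimes>\<^bsub>G\<^esub> z) a \<oplus>\<^bsub>H\<^esub>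
        a \<otimes>\<^bsub>H\<^esub> (act y c \<ominus>\<^bsub>H\<^esub> act z b \<oplus>\<^bsub>H\<^esub> b \<otimes>\<^bsub>H\<^esub> c)) \<oplus>\<^bsub>H\<^esub>
      ((act y (act z a \<ominus>\<^bsub>H\<^esub> act x c \<oplus>\<^bsub>H\<^esub> c \<otimes>\<^bsub>H\<^esub> a) \<ominus>\<^bsub>H\<^esub> act (z \<otimes>\<^bsub>G\<^esub> x) b \<oplus>\<^bsub>H\<^esub>
        b \<otimes>\<^bsub>H\<^esub> (act z a \<ominus>\<^bsub>H\<^esub> act x c \<oplus>\<^bsub>H\<^esub> c \<otimes>\<^bsub>H\<^esub> a)) \<oplus>\<^bsub>H\<^esub>
      (act z (act x b \<ominus>\<^bsub>H\<^esub> act y a \<oplus>\<^bsub>H\<^esub> a \<otimes>\<^bsub>H\<^esub> b) \<ominus>\<^bsub>H\<^esub> act (x \<otimes>\<^bsub>G\<^esub> y) c \<oplus>\<^bsub>H\<^esub>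
        c \<otimes>\<^bsub>H\<^esub> (act x b \<ominus>\<^bsub>H\<^esub> act y a \<oplus>\<^bsub>H\<^esub> a \<otimes>\<^bsub>H\<^esub> b))) = \<zero>\<^bsub>H\<^esub>" (is "?l = _")
    if xyz: "x \<in> carrier G" "y \<in> carrier G" "z \<in> carrier G"
      and abc: "a \<in> carrier H" "b \<in> carrier H" "c \<in> carrier H" for x y z a b c
  proof -
    (* P and D name the twelve kinds of terms that involve the action. Both [a, w.v] and [w.v, a]
       are written through D, so that terms which cancel become syntactic negatives. *)
    define P where "P u v w = act u (act v w)" for u v w
    have Pc: "P u v w \<in> carrier H" if "u \<in> carrier G" "v \<in> carrier G" "w \<in> carrier H" for u v w
      using that by (simp add: P_def G.act_closed)
    define D where "D w v u = u \<otimes>\<^bsub>H\<^esub> act w v" for u v w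
    have Dc: "D w v u \<in> carrier H" if "w \<in> carrier G" "u \<in> carrier H" "v \<in> carrier H" for u v w
      using that by (simp add: D_def G.act_closed H.lie_closed)
    have D: "act w v \<otimes>\<^bsub>H\<^esub> u = \<ominus>\<^bsub>H\<^esub> D w v u" if "w \<in> carrier G" "u \<in> carrier H" "v \<in> carrier H" for u v w
      using that H.anticommutative[of "act w v" u] by (simp add: D_def G.act_closed)
    have cancel: "(p \<oplus>\<^bsub>H\<^esub> (\<ominus>\<^bsub>H\<^esub> p)) = \<zero>\<^bsub>H\<^esub>" if "p \<in> carrier H" for p
      using that by (rule H.M.r_neg)
    have "?l = 
       (P x y c \<oplus>\<^bsub>H\<^esub> \<ominus>\<^bsub>H\<^esub> P x y c) \<oplus>\<^bsub>H\<^esub> ((P y x c \<oplus>\<^bsub>H\<^esub> \<ominus>\<^bsub>H\<^esub> P y x c) \<oplus>\<^bsub>H\<^esub>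
       ((P y z a \<oplus>\<^bsub>H\<^esub> \<ominus>\<^bsub>H\<^esub> P y z a) \<oplus>\<^bsub>H\<^esub> ((P z y a \<oplus>\<^bsub>H\<^esub> \<ominus>\<^bsub>H\<^esub> P z y a) \<oplus>\<^bsub>H\<^esub>
       ((P z x b \<oplus>\<^bsub>H\<^esub> \<ominus>\<^bsub>H\<^esub> P z x b) \<oplus>\<^bsub>H\<^esub> ((P x z b \<oplus>\<^bsub>H\<^esub> \<ominus>\<^bsub>H\<^esub> P x z b) \<oplus>\<^bsub>H\<^esub>
       ((D x b c \<oplus>\<^bsub>H\<^esub> \<ominus>\<^bsub>H\<^esub> D x b c) \<oplus>\<^bsub>H\<^esub> ((D x c b \<oplus>\<^bsub>H\<^esub> \<ominus>\<^bsub>H\<^esub> D x c b) \<oplus>\<^bsub>H\<^esub>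
       ((D y a c \<oplus>\<^bsub>H\<^esub> \<ominus>\<^bsub>H\<^esub> D y a c) \<oplus>\<^bsub>H\<^esub> ((D y c a \<oplus>\<^bsub>H\<^esub> \<ominus>\<^bsub>H\<^esub> D y c a) \<oplus>\<^bsub>H\<^esub>
       ((D z a b \<oplus>\<^bsub>H\<^esub> \<ominus>\<^bsub>H\<^esub> D z a b) \<oplus>\<^bsub>H\<^esub> ((D z b a \<oplus>\<^bsub>H\<^esub> \<ominus>\<^bsub>H\<^esub> D z b a) \<oplus>\<^bsub>H\<^esub>
       (a \<otimes>\<^bsub>H\<^esub> (b \<otimes>\<^bsub>H\<^esub> c) \<oplus>\<^bsub>H\<^esub> (b \<otimes>\<^bsub>H\<^esub> (c \<otimes>\<^bsub>H\<^esub> a) \<oplus>\<^bsub>H\<^esub> c \<otimes>\<^bsub>H\<^esub> (a \<otimes>\<^bsub>H\<^esub> b))))))))))))))"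
      using xyz abc
      by (simp add: s D P_def[symmetric] D_def[symmetric] Pc Dc del: H.M.r_neg) (simp add: H.M.a_ac Pc Dc H.lie_closed)
    then show ?thesis using xyz abc by (simp add: cancel Pc Dc H.lie_jacobi)
  qed
  show ?thesis
  proof (unfold_locales, goal_cases)
    case (1 x y) then show ?case by (auto simp: semidirect_simps s)
  next
    case (2 x y z) then show ?case by (auto simp: semidirect_simps s H.M.a_ac)
  next
    case (3 x y z) then show ?case by (auto simp: semidirect_simps s H.M.a_ac)
  next
    case (4 c x y) then show ?case by (auto simp: semidirect_simps s)
  next
    case (5 c x y) then show ?case by (auto simp: semidirect_simps s)
  next
    case (6 x) then show ?case by (auto simp: semidirect_simps s H.M.r_neg)
  next
    case (7 x y z) then show ?case using jac G.lie_jacobi by (auto simp: semidirect_simps)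
  qed
qed

section \<open>Free Lie algebras\<close>

lemma free_lie_ops:
  assumes K: "field K"
  shows "\<lbrakk>s \<in> aterms K (carrier X); t \<in> aterms K (carrier X)\<rbrakk> \<Longrightarrow>
      alg_class K (carrier X) (lie_rels K X) s \<oplus>\<^bsub>free_lie K X\<^esub> alg_class K (carrier X) (lie_rels K X) t
      = alg_class K (carrier X) (lie_rels K X) (TAdd s t)"
    and "\<lbrakk>s \<in> aterms K (carrier X); t \<in> aterms K (carrier X)\<rbrakk> \<Longrightarrow>
      alg_class K (carrier X) (lie_rels K X) s \<otimes>\<^bsub>free_lie K X\<^esub> alg_class K (carrier X) (lie_rels K X) t
      = alg_class K (carrier X) (lie_rels K X) (TMul s t)"
    and "\<lbrakk>c \<in> carrier K; t \<in> aterms K (carrier X)\<rbrakk> \<Longrightarrow>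
      c \<odot>\<^bsub>free_lie K X\<^esub> alg_class K (carrier X) (lie_rels K X) t
      = alg_class K (carrier X) (lie_rels K X) (TSmul c t)"
  unfolding free_lie_def
  using pres_alg_ops[OF fieldE(1)[OF K], where R = "lie_rels K X"] by blast+

lemma free_lie_gen_add_smult:
  assumes "field K" "module K X"
  shows "\<lbrakk>x \<in> carrier X; y \<in> carrier X\<rbrakk> \<Longrightarrow>
      free_lie_gen K X (x \<oplus>\<^bsub>X\<^esub> y) = free_lie_gen K X x \<oplus>\<^bsub>free_lie K X\<^esub> free_lie_gen K X y"
    and "\<lbrakk>c \<in> carrier K; x \<in> carrier X\<rbrakk> \<Longrightarrow>
      free_lie_gen K X (c \<odot>\<^bsub>X\<^esub> x) = c \<odot>\<^bsub>free_lie K X\<^esub> free_lie_gen K X x"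
proof -
  interpret module K X by fact
  show "\<lbrakk>x \<in> carrier X; y \<in> carrier X\<rbrakk> \<Longrightarrow>
      free_lie_gen K X (x \<oplus>\<^bsub>X\<^esub> y) = free_lie_gen K X x \<oplus>\<^bsub>free_lie K X\<^esub> free_lie_gen K X y"
    using free_lie_gen_linear(1)[OF assms] R.zero_closed by blast
  show "\<lbrakk>c \<in> carrier K; x \<in> carrier X\<rbrakk> \<Longrightarrow>
      free_lie_gen K X (c \<odot>\<^bsub>X\<^esub> x) = c \<odot>\<^bsub>free_lie K X\<^esub> free_lie_gen K X x"
    using free_lie_gen_linear(2)[OF assms] by blast
qed

text \<open>
  For a set \<open>V\<close> of generators, the classes of the terms over \<open>V\<close> form the subalgebra generated by \<open>V\<close>.
  With \<open>V = carrier X\<close> this is the whole free Lie algebra; with \<open>V\<close> a direct summand it is the image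
  of \<open>L(V)\<close>. One induction principle therefore serves both.
\<close>

lemma term_classes_subalgebra:
  fixes K :: "('k, 'i) ring_scheme" and X :: "('k, 'x, 'j) module_scheme"
  assumes K: "field K" and V: "V \<subseteq> carrier X"
  defines "C \<equiv> alg_class K (carrier X) (lie_rels K X) ` aterms K V"
  shows "submodule C K (free_lie K X)"
    and "\<lbrakk>x \<in> C; y \<in> C\<rbrakk> \<Longrightarrow> x \<otimes>\<^bsub>free_lie K X\<^esub> y \<in> C"
    and "v \<in> V \<Longrightarrow> free_lie_gen K X v \<in> C"
proof -
  interpret lie_algebra K "free_lie K X" by (rule free_lie_lie_algebra[OF K])
  note T = aterms.intros
  note up = aterms_mono[OF _ V]
  note ops = free_lie_ops(1,2)[OF K up up] free_lie_ops(3)[OF K _ up]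
  show "submodule C K (free_lie K X)"
  proof (rule submoduleI_vs)
    show "C \<subseteq> carrier (free_lie K X)"
      unfolding C_def free_lie_def pres_alg_carrier using up by auto
    show "\<zero>\<^bsub>free_lie K X\<^esub> \<in> C"
      unfolding C_def free_lie_def pres_alg_zero by (intro imageI T)
  qed (auto simp: C_def ops intro!: imageI T)
  show "\<lbrakk>x \<in> C; y \<in> C\<rbrakk> \<Longrightarrow> x \<otimes>\<^bsub>free_lie K X\<^esub> y \<in> C"
    by (auto simp: C_def ops intro!: imageI T)
  show "v \<in> V \<Longrightarrow> free_lie_gen K X v \<in> C"
    unfolding C_def free_lie_gen_def by (intro imageI T)
qed

lemma term_classes_induct [consumes 3, case_names gen zero add smult bracket]:
  fixes K :: "('k, 'i) ring_scheme" and X :: "('k, 'x, 'j) module_scheme"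
  assumes K: "field K" and V: "V \<subseteq> carrier X"
  defines "C \<equiv> alg_class K (carrier X) (lie_rels K X) ` aterms K V"
  assumes z: "z \<in> C"
    and gen: "\<And>v. v \<in> V \<Longrightarrow> P (free_lie_gen K X v)"
    and zero: "P \<zero>\<^bsub>free_lie K X\<^esub>"
    and add: "\<And>x y. \<lbrakk>x \<in> C; y \<in> C; P x; P y\<rbrakk> \<Longrightarrow> P (x \<oplus>\<^bsub>free_lie K X\<^esub> y)"
    and smult: "\<And>c x. \<lbrakk>c \<in> carrier K; x \<in> C; P x\<rbrakk> \<Longrightarrow> P (c \<odot>\<^bsub>free_lie K X\<^esub> x)"
    and bracket: "\<And>x y. \<lbrakk>x \<in> C; y \<in> C; P x; P y\<rbrakk> \<Longrightarrow> P (x \<otimes>\<^bsub>free_lie K X\<^esub> y)"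
  shows "P z"
proof -
  note up = aterms_mono[OF _ V]
  obtain t where t: "t \<in> aterms K V" "z = alg_class K (carrier X) (lie_rels K X) t"
    using z by (auto simp: C_def)
  note ops = free_lie_ops(1,2)[OF K up up] free_lie_ops(3)[OF K _ up]
  from t(1) have "P (alg_class K (carrier X) (lie_rels K X) t)"
  proof induction
    case (gen x)
    then show ?case using assms(5) by (simp add: free_lie_gen_def)
  next
    case zero
    then show ?case using assms(6) by (simp add: free_lie_def pres_alg_zero)
  next
    case (add s t)
    then show ?case using assms(7)[OF _ _ add.IH] ops(1)[OF add.hyps] by (simp add: C_def)
  next
    case (smul c t)
    then show ?case using assms(8)[OF smul.hyps(1) _ smul.IH] ops(3)[OF smul.hyps] by (simp add: C_def)
  next
    case (mul s t)
    then show ?case using assms(9)[OF _ _ mul.IH] ops(2)[OF mul.hyps] by (simp add: C_def)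
  qed
  then show ?thesis using t by simp
qed

lemma free_lie_carrier: "carrier (free_lie K X) = alg_class K (carrier X) (lie_rels K X) ` aterms K (carrier X)"
  by (simp add: free_lie_def pres_alg_carrier)

lemmas free_lie_induct [consumes 2, case_names gen zero add smult bracket] =
  term_classes_induct[OF _ order_refl, folded free_lie_carrier]

lemma free_lie_gen_closed: "x \<in> carrier X \<Longrightarrow> free_lie_gen K X x \<in> carrier (free_lie K X)"
  by (auto simp: free_lie_carrier free_lie_gen_def intro: aterms.gen)

primrec aterm_eval :: "('k, 'a, 'j) module_scheme \<Rightarrow> ('x \<Rightarrow> 'a) \<Rightarrow> ('k, 'x) aterm \<Rightarrow> 'a" where
  "aterm_eval H f (TGen x) = f x"
| "aterm_eval H f TZero = \<zero>\<^bsub>H\<^esub>"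
| "aterm_eval H f (TAdd s t) = aterm_eval H f s \<oplus>\<^bsub>H\<^esub> aterm_eval H f t"
| "aterm_eval H f (TSmul c t) = c \<odot>\<^bsub>H\<^esub> aterm_eval H f t"
| "aterm_eval H f (TMul s t) = aterm_eval H f s \<otimes>\<^bsub>H\<^esub> aterm_eval H f t"

text \<open>
  The universal property of \<open>L(X)\<close>: evaluation of terms in \<open>H\<close> respects every generating relation of
  the congruence, because \<open>H\<close> is a Lie algebra and \<open>f\<close> is linear.
\<close>

lemma free_lie_lift:
  fixes K :: "('k, 'i) ring_scheme" and X :: "('k, 'x, 'j) module_scheme"
    and H :: "('k, 'a, 'l) module_scheme"
  assumes H: "lie_algebra K H"
    and f: "\<And>x. x \<in> carrier X \<Longrightarrow> f x \<in> carrier H"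
    and fadd: "\<And>x y. \<lbrakk>x \<in> carrier X; y \<in> carrier X\<rbrakk> \<Longrightarrow> f (x \<oplus>\<^bsub>X\<^esub> y) = f x \<oplus>\<^bsub>H\<^esub> f y"
    and fsm: "\<And>c x. \<lbrakk>c \<in> carrier K; x \<in> carrier X\<rbrakk> \<Longrightarrow> f (c \<odot>\<^bsub>X\<^esub> x) = c \<odot>\<^bsub>H\<^esub> f x"
  shows "\<exists>F\<in>lie_hom K (free_lie K X) H. \<forall>x\<in>carrier X. F (free_lie_gen K X x) = f x"
proof -
  interpret H: lie_algebra K H by fact
  have cr: "cring K" by unfold_locales
  let ?T = "aterms K (carrier X)" and ?cl = "alg_class K (carrier X) (lie_rels K X)"
  let ?e = "aterm_eval H f"
  have ec: "?e t \<in> carrier H" if "t \<in> ?T" for t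
    using that by induction (auto simp: f H.lie_closed)
  have sound: "?e s = ?e t" if "alg_cong K (carrier X) (lie_rels K X) s t" for s t
    using that
  proof induction
    case (rel s t)
    then show ?case
      by (auto simp: lie_rels_def lin_rels_def fadd fsm H.lie_alternating H.lie_jacobi ec aterms_inv)
  qed (simp_all add: ec H.M.a_ac H.smult_l_distr H.smult_r_distr H.smult_assoc1 H.lie_add_left
      H.lie_add_right H.lie_smult_left H.lie_smult_right H.lie_closed)
  define F where "F C = ?e (SOME t. t \<in> C)" for C
  have F: "F (?cl t) = ?e t" if t: "t \<in> ?T" for t
  proof -
    have "t \<in> ?cl t" using t by (simp add: mem_alg_class alg_cong.refl)
    then have "(SOME s. s \<in> ?cl t) \<in> ?cl t" by (rule someI)
    then show ?thesis using sound by (auto simp: F_def mem_alg_class)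
  qed
  note ops = free_lie_ops[OF H.field_axioms]
  have "F \<in> lie_hom K (free_lie K X) H"
    unfolding lie_hom_def by (auto simp: free_lie_carrier ops F aterms.intros ec)
  moreover have "F (free_lie_gen K X x) = f x" if "x \<in> carrier X" for x
    unfolding free_lie_gen_def using F[OF aterms.gen[OF that]] by simp
  ultimately show ?thesis by blast
qed

lemma lie_derivationsD:
  assumes "D \<in> lie_derivations K L"
  shows "x \<in> carrier L \<Longrightarrow> D x \<in> carrier L"
    and "\<lbrakk>x \<in> carrier L; y \<in> carrier L\<rbrakk> \<Longrightarrow> D (x \<oplus>\<^bsub>L\<^esub> y) = D x \<oplus>\<^bsub>L\<^esub> D y"
    and "\<lbrakk>c \<in> carrier K; x \<in> carrier L\<rbrakk> \<Longrightarrow> D (c \<odot>\<^bsub>L\<^esub> x) = c \<odot>\<^bsub>L\<^esub> D x"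
    and "\<lbrakk>x \<in> carrier L; y \<in> carrier L\<rbrakk> \<Longrightarrow> D (x \<otimes>\<^bsub>L\<^esub> y) = (D x \<otimes>\<^bsub>L\<^esub> y) \<oplus>\<^bsub>L\<^esub> (x \<otimes>\<^bsub>L\<^esub> D y)"
  using assms by (auto simp: lie_derivations_def)

lemma lie_derivation_zero:
  assumes "lie_algebra K L" "D \<in> lie_derivations K L"
  shows "D \<zero>\<^bsub>L\<^esub> = \<zero>\<^bsub>L\<^esub>"
  using assms by (intro linear_zero[of K L L D]) (auto simp: lie_derivations_def lie_algebra_def)

context lie_module
begin

lemma free_lie_der_act:
  assumes x: "x \<in> carrier G"
  shows "free_lie_der K N (act x) \<in> lie_derivations K (free_lie K N)"
    and "n \<in> carrier N \<Longrightarrow> free_lie_der K N (act x) (free_lie_gen K N n) = free_lie_gen K N (act x n)"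
proof -
  have "\<exists>!D. D \<in> lie_derivations K (free_lie K N) \<and> D \<in> extensional (carrier (free_lie K N)) \<and>
            (\<forall>n\<in>carrier N. D (free_lie_gen K N n) = free_lie_gen K N (act x n))"
    using x by (intro free_lie_der_ex1)
      (simp_all add: act_closed act_add_right act_smult_right N.module_axioms field_axioms)
  from theI'[OF this, folded free_lie_der_def]
  show "free_lie_der K N (act x) \<in> lie_derivations K (free_lie K N)"
    and "n \<in> carrier N \<Longrightarrow> free_lie_der K N (act x) (free_lie_gen K N n) = free_lie_gen K N (act x n)"
    by auto
qed

text \<open>
  Each module identity relates two maps on \<open>L(N)\<close> that are determined by their values on \<open>N\<close>, where
  the identity is known; it propagates to brackets by the derivation rule.
\<close>

lemma free_lie_module: "lie_module K G (free_lie K N) (\<lambda>x. free_lie_der K N (act x))"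
proof -
  have K: "field K" by unfold_locales
  interpret F: lie_algebra K "free_lie K N" by (rule free_lie_lie_algebra[OF K])
  note der = lie_derivationsD[OF free_lie_der_act(1)]
  note zer = lie_derivation_zero[OF F.lie_algebra_axioms free_lie_der_act(1)]
  note glin = free_lie_gen_add_smult[OF K N.module_axioms]
  note gc = free_lie_gen_closed
  note s = free_lie_der_act(2) act_closed gc glin der zer lie_closed F.lie_closed
    F.lie_add_left F.lie_add_right F.lie_smult_left F.lie_smult_right F.smult_r_distr F.M.a_ac
  show ?thesis
  proof (rule lie_module_natI)
    show "free_lie_der K N (act (x \<oplus>\<^bsub>G\<^esub> y)) n
        = free_lie_der K N (act x) n \<oplus>\<^bsub>free_lie K N\<^esub> free_lie_der K N (act y) n"
      if "x \<in> carrier G" "y \<in> carrier G" "n \<in> carrier (free_lie K N)" for x y n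
      using K that(3) by (induction rule: free_lie_induct) (use that(1,2) in \<open>simp_all add: s act_add_left\<close>)
    show "free_lie_der K N (act (c \<odot>\<^bsub>G\<^esub> x)) n = c \<odot>\<^bsub>free_lie K N\<^esub> free_lie_der K N (act x) n"
      if "c \<in> carrier K" "x \<in> carrier G" "n \<in> carrier (free_lie K N)" for c x n
      using K that(3) by (induction rule: free_lie_induct)
        (use that(1,2) in \<open>simp_all add: s act_smult_left F.smult_assoc1[symmetric] R.m_comm\<close>)
    show "free_lie_der K N (act (x \<otimes>\<^bsub>G\<^esub> y)) n
          \<oplus>\<^bsub>free_lie K N\<^esub> free_lie_der K N (act y) (free_lie_der K N (act x) n)
        = free_lie_der K N (act x) (free_lie_der K N (act y) n)"
      if xy: "x \<in> carrier G" "y \<in> carrier G" and n: "n \<in> carrier (free_lie K N)" for x y n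
      using K n
    proof (induction rule: free_lie_induct)
      case (gen n)
      have "act x (act y n) = act (x \<otimes>\<^bsub>G\<^esub> y) n \<oplus>\<^bsub>N\<^esub> act y (act x n)"
        using xy gen by (simp add: act_bracket act_closed N.M.minus_eq N.M.a_assoc N.M.l_neg)
      then show ?case using xy gen by (simp add: s)
    next
      case (add a b)
      then show ?case using xy by (simp add: s(1-13) add(3,4)[symmetric]) (simp add: s)
    next
      case (smult c a)
      then show ?case using xy by (simp add: s(1-13) smult(3)[symmetric]) (simp add: s)
    next
      case (bracket a b)
      then show ?case using xy by (simp add: s(1-13) bracket(3,4)[symmetric]) (simp add: s)
    qed (use xy in \<open>simp_all add: s(1-13)\<close>)
  qed (use der in \<open>auto intro: lie_algebra_axioms F.module_axioms\<close>)
qed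

end

section \<open>Spans under the enveloping algebra\<close>

text \<open>
  This removes the enveloping algebra from the argument: \<open>U(H)\<cdot>S\<close> is the least subspace that contains
  \<open>S\<close> and is stable under bracketing with \<open>H\<close>, since every element of \<open>U(H)\<close> acts by a combination of
  iterated brackets with elements of \<open>H\<close>.
\<close>

lemma uea_span_props:
  assumes L: "lie_algebra K L" and H: "H \<subseteq> carrier L" and S: "S \<subseteq> carrier L"
    and Hc: "\<forall>x\<in>H. \<forall>y\<in>H. x \<otimes>\<^bsub>L\<^esub> y \<in> H"
  shows "submodule (uea_span K L H S) K L"
    and "S \<subseteq> uea_span K L H S"
    and "\<lbrakk>x \<in> H; m \<in> uea_span K L H S\<rbrakk> \<Longrightarrow> x \<otimes>\<^bsub>L\<^esub> m \<in> uea_span K L H S"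
    and "\<lbrakk>submodule T K L; S \<subseteq> T; \<And>x t. \<lbrakk>x \<in> H; t \<in> T\<rbrakk> \<Longrightarrow> x \<otimes>\<^bsub>L\<^esub> t \<in> T\<rbrakk>
      \<Longrightarrow> uea_span K L H S \<subseteq> T"
proof -
  interpret lie_algebra K L by fact
  let ?A = "aterms K (insert None (Some ` H))"
  define P where "P = {uea_term_act L t b | t b. t \<in> ?A \<and> b \<in> S}"
  let ?cl = "alg_class K (insert None (Some ` H)) (uea_rels K (L\<lparr>carrier := H\<rparr>))"
  have car: "carrier (uea K (L\<lparr>carrier := H\<rparr>)) = ?cl ` ?A" by (simp add: uea_def pres_alg_carrier)
  have act: "uea_act L (?cl t) b = uea_term_act L t b" if "t \<in> ?A" "b \<in> S" for t b
    using uea_act_class[OF L H that(1)] Hc S that(2) by blast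
  have "{uea_act L a b | a b. a \<in> carrier (uea K (L\<lparr>carrier := H\<rparr>)) \<and> b \<in> S} = P"
    unfolding P_def car
  proof (intro equalityI subsetI; elim CollectE exE conjE)
    fix x a b assume "x = uea_act L a b" "a \<in> ?cl ` ?A" "b \<in> S"
    then show "x \<in> {uea_term_act L t b | t b. t \<in> ?A \<and> b \<in> S}" using act by auto
  next
    fix x t b assume "x = uea_term_act L t b" "t \<in> ?A" "b \<in> S"
    then show "x \<in> {uea_act L a b | a b. a \<in> ?cl ` ?A \<and> b \<in> S}" 
      using act[of t b] by (intro CollectI exI[of _ "?cl t"] exI[of _ b]) simp
  qed
  then have U: "uea_span K L H S = lin_span K L P" by (simp add: uea_span_def)
  have act_in: "uea_term_act L t b \<in> T"
    if "t \<in> ?A" "b \<in> T" "submodule T K L" "\<And>x t. \<lbrakk>x \<in> H; t \<in> T\<rbrakk> \<Longrightarrow> x \<otimes>\<^bsub>L\<^esub> t \<in> T" for t b T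
    using that(1,2) by (induction arbitrary: b)
      (use that(4) submodule_zero[OF that(3)] submoduleE(4,5)[OF that(3)] in auto)
  have Pc: "P \<subseteq> carrier L"
  proof
    fix p assume "p \<in> P"
    then obtain t b where "t \<in> ?A" "b \<in> S" "p = uea_term_act L t b" by (auto simp: P_def)
    then show "p \<in> carrier L"
      using act_in[of t b "carrier L", OF _ _ carrier_is_submodule] S H lie_closed by blast
  qed
  show sub: "submodule (uea_span K L H S) K L" unfolding U using Pc by (rule lin_span_submodule)
  have PU: "P \<subseteq> uea_span K L H S" unfolding U lin_span_def by (rule hull_subset)
  have "b \<in> P" if "b \<in> S" for b
    unfolding P_def using that aterms.gen[of None "insert None (Some ` H)" K]
    by (intro CollectI exI[of _ "TGen None"] exI[of _ b]) auto
  then show "S \<subseteq> uea_span K L H S" using PU by auto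
  show "uea_span K L H S \<subseteq> T"
    if "submodule T K L" "S \<subseteq> T" "\<And>x t. \<lbrakk>x \<in> H; t \<in> T\<rbrakk> \<Longrightarrow> x \<otimes>\<^bsub>L\<^esub> t \<in> T"
    unfolding U
    using act_in[OF _ _ that(1)] that(2,3) by (intro lin_span_minimal that) (auto simp: P_def)
  show "x \<otimes>\<^bsub>L\<^esub> m \<in> uea_span K L H S" if x: "x \<in> H" and m: "m \<in> uea_span K L H S" for x m
  proof -
    define T where "T = {m \<in> carrier L. x \<otimes>\<^bsub>L\<^esub> m \<in> uea_span K L H S}"
    have xc: "x \<in> carrier L" using x H by auto
    have "submodule T K L"
      using xc submodule_zero[OF sub] submoduleE(4,5)[OF sub]
      by (intro submoduleI_vs) (auto simp: T_def lie_add_right lie_smult_right)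
    moreover have "P \<subseteq> T"
    proof
      fix p assume p: "p \<in> P"
      then obtain t b where tb: "t \<in> ?A" "b \<in> S" "p = uea_term_act L t b" by (auto simp: P_def)
      have "x \<otimes>\<^bsub>L\<^esub> p = uea_term_act L (TMul (TGen (Some x)) t) b" by (simp add: tb)
      moreover have "TMul (TGen (Some x)) t \<in> ?A" using x tb by (intro aterms.intros) auto
      ultimately have "x \<otimes>\<^bsub>L\<^esub> p \<in> P" using tb unfolding P_def by blast
      then show "p \<in> T" using p Pc PU by (auto simp: T_def)
    qed
    ultimately have "uea_span K L H S \<subseteq> T" unfolding U by (intro lin_span_minimal)
    then show ?thesis using m by (auto simp: T_def)
  qed
qed

section \<open>Projections of a direct sum\<close>

lemma direct_sum_projections:
  assumes E: "module K E" and V: "submodule V K E" and W: "submodule W K E" and VW: "V \<inter> W = {\<zero>\<^bsub>E\<^esub>}"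
  shows "\<exists>p q. \<forall>v\<in>V. \<forall>w\<in>W. p (v \<oplus>\<^bsub>E\<^esub> w) = v \<and> q (v \<oplus>\<^bsub>E\<^esub> w) = w"
proof -
  interpret module K E by fact
  note sV = submoduleE[OF V] and sW = submoduleE[OF W]
  have uniq: "v = v' \<and> w = w'"
    if "v \<in> V" "v' \<in> V" "w \<in> W" "w' \<in> W" and e: "v \<oplus>\<^bsub>E\<^esub> w = v' \<oplus>\<^bsub>E\<^esub> w'" for v v' w w'
  proof -
    have c: "v \<in> carrier E" "v' \<in> carrier E" "w \<in> carrier E" "w' \<in> carrier E"
      using that sV(1) sW(1) by auto
    have "v' = (v \<oplus>\<^bsub>E\<^esub> w) \<ominus>\<^bsub>E\<^esub> w'" unfolding e using c by (simp add: M.minus_eq M.a_assoc M.r_neg)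
    also have "\<dots> = v \<oplus>\<^bsub>E\<^esub> (w \<ominus>\<^bsub>E\<^esub> w')" using c by (simp add: M.minus_eq M.a_ac)
    finally have v': "v' = v \<oplus>\<^bsub>E\<^esub> (w \<ominus>\<^bsub>E\<^esub> w')" .
    have "v' \<ominus>\<^bsub>E\<^esub> v = (w \<ominus>\<^bsub>E\<^esub> w') \<oplus>\<^bsub>E\<^esub> (v \<oplus>\<^bsub>E\<^esub> \<ominus>\<^bsub>E\<^esub> v)"
      unfolding v' using c by (simp add: M.minus_eq M.a_ac del: M.r_neg)
    then have "v' \<ominus>\<^bsub>E\<^esub> v = w \<ominus>\<^bsub>E\<^esub> w'" using c by (simp add: M.r_neg)
    moreover have "v' \<ominus>\<^bsub>E\<^esub> v \<in> V" "w \<ominus>\<^bsub>E\<^esub> w' \<in> W"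
      using submodule_minus V W that by auto
    ultimately have z: "w \<ominus>\<^bsub>E\<^esub> w' = \<zero>\<^bsub>E\<^esub>" using VW by auto
    have "w = (w \<ominus>\<^bsub>E\<^esub> w') \<oplus>\<^bsub>E\<^esub> w'" using c by (simp add: M.minus_eq M.a_assoc M.l_neg)
    then show ?thesis using v' c unfolding z by simp
  qed
  define p where "p x = (SOME v. v \<in> V \<and> (\<exists>w\<in>W. x = v \<oplus>\<^bsub>E\<^esub> w))" for x
  define q where "q x = (SOME w. w \<in> W \<and> (\<exists>v\<in>V. x = v \<oplus>\<^bsub>E\<^esub> w))" for x
  have "p (v \<oplus>\<^bsub>E\<^esub> w) = v \<and> q (v \<oplus>\<^bsub>E\<^esub> w) = w" if "v \<in> V" "w \<in> W" for v w
    unfolding p_def q_def using that uniq by (intro conjI some_equality) blast+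
  then show ?thesis by blast
qed

section \<open>Relations on a free Lie algebra over a direct sum\<close>

text \<open>
  The derived objects are parameters tied to their definitions by equations. They stay atomic in terms,
  and the rules proved below for cosets, generators and stable subspaces replace their definitions.
\<close>

locale free_lie_relations =
  fixes K :: "('k, 'i) ring_scheme" and E :: "('k, 'x, 'j) module_scheme"
    and V W :: "'x set" and X L LV M A B IA G M1 N actN actLN I Q J h actJ
  assumes K: "field K" and E: "module K E" and V: "submodule V K E" and W: "submodule W K E"
    and VW: "V \<inter> W = {\<zero>\<^bsub>E\<^esub>}"
    and X_eq: "X = E\<lparr>carrier := V <+>\<^bsub>E\<^esub> W\<rparr>"
    and L_eq: "L = free_lie K X"
    and LV_eq: "LV = L\<lparr>carrier := free_lie_sub K X V\<rparr>"
    and M_eq: "M = uea_span K L (carrier LV) (free_lie_gen K X ` W)"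
    and A_subspace: "submodule A K LV"
    and B_subspace: "submodule B K (L\<lparr>carrier := M\<rparr>)"
    and IA_eq: "IA = ideal_gen K LV A"
    and G_eq: "G = lie_quot LV IA"
    and M1_eq: "M1 = lin_span K L {m \<otimes>\<^bsub>L\<^esub> a | m a. m \<in> M \<and> a \<in> IA} <+>\<^bsub>L\<^esub> uea_span K L (carrier LV) B"
    and N_eq: "N = lie_quot (L\<lparr>carrier := M\<rparr>) M1"
    and actN_eq: "actN = (\<lambda>g n. [mod M1:] g \<Otimes>\<^bsub>L\<^esub> n)"
    and actLN_eq: "actLN = (\<lambda>g. free_lie_der K N (actN g))"
    and I_eq: "I = ideal_gen K L (A \<union> B)"
    and Q_eq: "Q = lie_quot L I"
    and J_eq: "J = ideal_gen K Q ((\<lambda>w. I +>\<^bsub>L\<^esub> free_lie_gen K X w) ` W)"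
    and h_eq: "h = (\<lambda>g. \<Union>x\<in>g. I +>\<^bsub>L\<^esub> x)"
    and actJ_eq: "actJ = (\<lambda>g y. h g \<otimes>\<^bsub>Q\<^esub> y)"
begin

abbreviation genL where "genL \<equiv> free_lie_gen K X"
abbreviation genN where "genN \<equiv> free_lie_gen K N"
abbreviation FN where "FN \<equiv> free_lie K N"
abbreviation S where "S \<equiv> lie_semidirect G FN actLN"

sublocale E: module K E by (rule E)

lemma X_module: "module K X"
  unfolding X_eq by (rule submodule.submodule_is_module[OF E.submodule_sum[OF V W] E])

lemma VX: "V \<subseteq> carrier X" and WX: "W \<subseteq> carrier X"
  using E.submodule_sum_incl[OF V W] by (simp_all add: X_eq)

lemma X_ops: "x \<oplus>\<^bsub>X\<^esub> y = x \<oplus>\<^bsub>E\<^esub> y" "c \<odot>\<^bsub>X\<^esub> x = c \<odot>\<^bsub>E\<^esub> x" "\<zero>\<^bsub>X\<^esub> = \<zero>\<^bsub>E\<^esub>"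
  by (simp_all add: X_eq)

lemma X_cases:
  assumes "x \<in> carrier X"
  obtains v w where "v \<in> V" "w \<in> W" "x = v \<oplus>\<^bsub>X\<^esub> w"
  using assms by (auto simp: X_eq set_add_def')

sublocale L: lie_algebra K L unfolding L_eq by (rule free_lie_lie_algebra[OF K])

lemma genL_add_smult:
  "\<lbrakk>x \<in> carrier X; y \<in> carrier X\<rbrakk> \<Longrightarrow> genL (x \<oplus>\<^bsub>X\<^esub> y) = genL x \<oplus>\<^bsub>L\<^esub> genL y"
  "\<lbrakk>c \<in> carrier K; x \<in> carrier X\<rbrakk> \<Longrightarrow> genL (c \<odot>\<^bsub>X\<^esub> x) = c \<odot>\<^bsub>L\<^esub> genL x"
  unfolding L_eq using free_lie_gen_add_smult[OF K X_module] by blast+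

lemma genL_closed: "x \<in> carrier X \<Longrightarrow> genL x \<in> carrier L"
  unfolding L_eq by (rule free_lie_gen_closed)

lemma genL_zero: "genL \<zero>\<^bsub>X\<^esub> = \<zero>\<^bsub>L\<^esub>"
  by (rule linear_zero[OF X_module L.module_axioms])
    (auto simp: genL_closed genL_add_smult)

section \<open>The subalgebra \<open>L(V)\<close> and the module \<open>M\<close>\<close>

lemma LV_carrier: "carrier LV = alg_class K (carrier X) (lie_rels K X) ` aterms K V"
proof -
  have "free_lie_incl K X ` carrier (free_lie K (X\<lparr>carrier := V\<rparr>))
    = free_lie_incl K X ` alg_class K V (lie_rels K (X\<lparr>carrier := V\<rparr>)) ` aterms K V"
    by (simp add: free_lie_carrier)
  also have "\<dots> = alg_class K (carrier X) (lie_rels K X) ` aterms K V"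
    using free_lie_incl_inj(2)[OF K E V W VW X_eq] by (force simp: image_image)
  finally show ?thesis by (simp add: LV_eq free_lie_sub_def)
qed

lemma LV_upd: "LV = L\<lparr>carrier := carrier LV\<rparr>" by (simp add: LV_eq)

lemma LV_submodule: "submodule (carrier LV) K L"
  and LV_bracket: "\<lbrakk>x \<in> carrier LV; y \<in> carrier LV\<rbrakk> \<Longrightarrow> x \<otimes>\<^bsub>L\<^esub> y \<in> carrier LV"
  and LV_gen: "v \<in> V \<Longrightarrow> genL v \<in> carrier LV"
  unfolding LV_carrier L_eq using term_classes_subalgebra[OF K VX] by auto

lemma LV_bracket_ball: "\<forall>x\<in>carrier LV. \<forall>y\<in>carrier LV. x \<otimes>\<^bsub>L\<^esub> y \<in> carrier LV"
  using LV_bracket by blast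

lemmas LV_subset = L.submoduleE(1)[OF LV_submodule]
lemmas LV_sub = LV_subset[THEN subsetD]
lemmas LV_closed = L.submoduleE(4,5)[OF LV_submodule] LV_bracket L.submodule_zero[OF LV_submodule]

lemma LV_ops: "add LV = add L" "mult LV = mult L" "smult LV = smult L" "\<zero>\<^bsub>LV\<^esub> = \<zero>\<^bsub>L\<^esub>"
  "I' +>\<^bsub>LV\<^esub> x = I' +>\<^bsub>L\<^esub> x"
  by (simp_all add: LV_eq)

sublocale LV: lie_algebra K LV
  by (subst LV_upd) (intro L.lie_subalgebra LV_submodule LV_bracket)

lemma gen_W: "free_lie_gen K X ` W \<subseteq> carrier L"
  using genL_closed WX by auto

lemma M_submodule: "submodule M K L"
  and M_gen: "w \<in> W \<Longrightarrow> genL w \<in> M"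
  and M_act: "\<lbrakk>x \<in> carrier LV; m \<in> M\<rbrakk> \<Longrightarrow> x \<otimes>\<^bsub>L\<^esub> m \<in> M"
  and M_minimal: "\<lbrakk>submodule T K L; \<And>w. w \<in> W \<Longrightarrow> genL w \<in> T;
      \<And>x t. \<lbrakk>x \<in> carrier LV; t \<in> T\<rbrakk> \<Longrightarrow> x \<otimes>\<^bsub>L\<^esub> t \<in> T\<rbrakk> \<Longrightarrow> M \<subseteq> T"
proof -
  note * = uea_span_props[OF L.lie_algebra_axioms LV_subset gen_W LV_bracket_ball, folded M_eq]
  show "submodule M K L" by (rule *(1))
  show "w \<in> W \<Longrightarrow> genL w \<in> M" using *(2) by auto
  show "\<lbrakk>x \<in> carrier LV; m \<in> M\<rbrakk> \<Longrightarrow> x \<otimes>\<^bsub>L\<^esub> m \<in> M" by (rule *(3))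
  show "\<lbrakk>submodule T K L; \<And>w. w \<in> W \<Longrightarrow> genL w \<in> T;
      \<And>x t. \<lbrakk>x \<in> carrier LV; t \<in> T\<rbrakk> \<Longrightarrow> x \<otimes>\<^bsub>L\<^esub> t \<in> T\<rbrakk> \<Longrightarrow> M \<subseteq> T" using *(4)[of T] by blast
qed

lemmas M_sub = L.submoduleE(1)[OF M_submodule, THEN subsetD]
lemmas M_closed = L.submoduleE(4,5)[OF M_submodule] M_act L.submodule_zero[OF M_submodule]

section \<open>The Lie algebra \<open>L(V)/\<langle>A\<rangle>\<close> and its module \<open>N\<close>\<close>

lemma A_incl: "A \<subseteq> IA" unfolding IA_eq by (rule LV.ideal_gen_incl)

lemma IA_ideal: "lie_ideal K LV IA"
  unfolding IA_eq by (intro LV.ideal_gen_ideal LV.submoduleE(1)[OF A_subspace])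

lemma IA_LV: "IA \<subseteq> carrier LV"
  using IA_ideal LV.submoduleE(1) by (auto simp: lie_ideal_def)

lemma IA_submodule: "submodule IA K L"
  using IA_ideal LV_upd L.submodule_of_submodule[OF LV_submodule] unfolding lie_ideal_def by metis

lemma IA_act: "\<lbrakk>x \<in> carrier LV; a \<in> IA\<rbrakk> \<Longrightarrow> x \<otimes>\<^bsub>L\<^esub> a \<in> IA"
  using IA_ideal by (simp add: lie_ideal_def LV_ops)

sublocale G: lie_algebra K G
  unfolding G_eq by (rule LV.quot_lie_algebra[OF IA_ideal])

lemma IA_submodule_LV: "submodule IA K LV" using IA_ideal by (simp add: lie_ideal_def)

lemma G_carrier: "carrier G = (\<lambda>x. IA +>\<^bsub>L\<^esub> x) ` carrier LV"
  using LV.quot_carrier[of IA] by (simp add: G_eq LV_ops)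

lemma G_ops:
  "\<lbrakk>x \<in> carrier LV; y \<in> carrier LV\<rbrakk> \<Longrightarrow> (IA +>\<^bsub>L\<^esub> x) \<oplus>\<^bsub>G\<^esub> (IA +>\<^bsub>L\<^esub> y) = IA +>\<^bsub>L\<^esub> (x \<oplus>\<^bsub>L\<^esub> y)"
  "\<lbrakk>x \<in> carrier LV; y \<in> carrier LV\<rbrakk> \<Longrightarrow> (IA +>\<^bsub>L\<^esub> x) \<otimes>\<^bsub>G\<^esub> (IA +>\<^bsub>L\<^esub> y) = IA +>\<^bsub>L\<^esub> (x \<otimes>\<^bsub>L\<^esub> y)"
  "\<lbrakk>c \<in> carrier K; x \<in> carrier LV\<rbrakk> \<Longrightarrow> c \<odot>\<^bsub>G\<^esub> (IA +>\<^bsub>L\<^esub> x) = IA +>\<^bsub>L\<^esub> (c \<odot>\<^bsub>L\<^esub> x)"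
  "\<zero>\<^bsub>G\<^esub> = IA" "IA +>\<^bsub>L\<^esub> \<zero>\<^bsub>L\<^esub> = IA"
  using LV.quot_add[OF IA_submodule_LV, of x y] LV.quot_bracket[OF IA_ideal, of x y]
    LV.quot_smult[OF IA_submodule_LV, of x c] LV.quot_zero[of IA] L.coset_zero[OF IA_submodule]
  by (simp_all add: G_eq LV_ops)

sublocale M: module K "L\<lparr>carrier := M\<rparr>"
  by (rule submodule.submodule_is_module[OF M_submodule L.module_axioms])

lemma B_submodule: "submodule B K L" and B_M: "B \<subseteq> M"
  using L.submodule_of_submodule[OF M_submodule B_subspace] M.submoduleE(1)[OF B_subspace] by auto

abbreviation MA where "MA \<equiv> lin_span K L {m \<otimes>\<^bsub>L\<^esub> a | m a. m \<in> M \<and> a \<in> IA}"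
abbreviation UB where "UB \<equiv> uea_span K L (carrier LV) B"

lemmas IA_sub = IA_LV[THEN subsetD, THEN LV_sub]

lemma MA_gen_closed: "{m \<otimes>\<^bsub>L\<^esub> a | m a. m \<in> M \<and> a \<in> IA} \<subseteq> M"
  using L.anticommutative[OF M_sub IA_sub] L.submoduleE(3)[OF M_submodule] M_act IA_LV by auto

lemma MA_submodule: "submodule MA K L"
  using MA_gen_closed M_sub by (intro L.lin_span_submodule) blast

lemma MA_incl: "\<lbrakk>m \<in> M; a \<in> IA\<rbrakk> \<Longrightarrow> m \<otimes>\<^bsub>L\<^esub> a \<in> MA"
  unfolding lin_span_def by (rule hull_inc) blast

text \<open>
  The subspace \<open>[M, \<langle>A\<rangle>]\<close> is stable under \<open>L(V)\<close>, since \<open>[x, [m, a]] = [[x, m], a] + [m, [x, a]]\<close> and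
  both \<open>M\<close> and \<open>\<langle>A\<rangle>\<close> are stable.
\<close>

lemma MA_act: 
  assumes "x \<in> carrier LV" "t \<in> MA" shows "x \<otimes>\<^bsub>L\<^esub> t \<in> MA"
proof -
  define T where "T = {t \<in> carrier L. x \<otimes>\<^bsub>L\<^esub> t \<in> MA}"
  note c = L.submodule_zero[OF MA_submodule] L.submoduleE(4,5)[OF MA_submodule]
  have x: "x \<in> carrier L" using assms LV_sub by blast
  have "submodule T K L"
    using x c by (intro L.submoduleI_vs) (auto simp: T_def L.lie_add_right L.lie_smult_right)
  moreover have "{m \<otimes>\<^bsub>L\<^esub> a | m a. m \<in> M \<and> a \<in> IA} \<subseteq> T"
  proof clarify
    fix m a assume ma: "m \<in> M" "a \<in> IA"
    then have "x \<otimes>\<^bsub>L\<^esub> (m \<otimes>\<^bsub>L\<^esub> a) = ((x \<otimes>\<^bsub>L\<^esub> m) \<otimes>\<^bsub>L\<^esub> a) \<oplus>\<^bsub>L\<^esub> (m \<otimes>\<^bsub>L\<^esub> (x \<otimes>\<^bsub>L\<^esub> a))"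
      using x M_sub IA_sub by (intro L.leibniz)
    moreover have "\<dots> \<in> MA"
      using ma assms(1) by (intro c MA_incl M_act IA_act)
    ultimately show "m \<otimes>\<^bsub>L\<^esub> a \<in> T" using ma M_sub IA_sub L.lie_closed by (auto simp: T_def)
  qed
  ultimately have "MA \<subseteq> T" by (intro L.lin_span_minimal)
  then show ?thesis using assms by (auto simp: T_def)
qed

lemmas UB_props = uea_span_props[OF L.lie_algebra_axioms LV_subset L.submoduleE(1)[OF B_submodule] LV_bracket_ball]

lemma M1_submodule: "submodule M1 K L"
  unfolding M1_eq by (intro L.submodule_sum MA_submodule UB_props)

text \<open>
  \<open>M1\<close> is the least \<open>L(V)\<close>-stable subspace that contains \<open>[M, \<langle>A\<rangle>]\<close> and \<open>B\<close>. This yields both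
  \<open>M1 \<subseteq> M\<close> and \<open>M1 \<subseteq> \<langle>A, B\<rangle>\<close>.
\<close>

lemma M1_contained:
  assumes T: "submodule T K L" and MA: "\<And>m a. \<lbrakk>m \<in> M; a \<in> IA\<rbrakk> \<Longrightarrow> m \<otimes>\<^bsub>L\<^esub> a \<in> T" and B: "B \<subseteq> T"
    and act: "\<And>x t. \<lbrakk>x \<in> carrier LV; t \<in> T\<rbrakk> \<Longrightarrow> x \<otimes>\<^bsub>L\<^esub> t \<in> T"
  shows "M1 \<subseteq> T"
proof -
  have "MA \<subseteq> T" using MA by (intro L.lin_span_minimal T) auto
  moreover have "UB \<subseteq> T" using UB_props(4)[OF T B] act by blast
  ultimately show ?thesis using L.submoduleE(5)[OF T] by (auto simp: M1_eq set_add_def')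
qed

lemma M1_M: "M1 \<subseteq> M"
  using MA_gen_closed by (intro M1_contained M_submodule B_M) (auto intro: M_act)

lemma M1_B: "B \<subseteq> M1"
  unfolding M1_eq using UB_props(2) L.submodule_sum_incl(2)[OF MA_submodule UB_props(1)] by blast

text \<open>
  This is where the summand \<open>[M, \<langle>A\<rangle>]\<close> of \<open>M1\<close> enters: it makes \<open>\<langle>A\<rangle>\<close> act on \<open>N\<close> by zero.
\<close>

lemma M1_IA: "\<lbrakk>a \<in> IA; m \<in> M\<rbrakk> \<Longrightarrow> a \<otimes>\<^bsub>L\<^esub> m \<in> M1"
  using L.anticommutative[OF IA_sub M_sub, of a m] MA_incl L.submoduleE(3)[OF MA_submodule]
    L.submodule_sum_incl(1)[OF MA_submodule UB_props(1)] by (auto simp: M1_eq)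

lemma M1_act: "\<lbrakk>x \<in> carrier LV; t \<in> M1\<rbrakk> \<Longrightarrow> x \<otimes>\<^bsub>L\<^esub> t \<in> M1"
proof -
  assume x: "x \<in> carrier LV" and "t \<in> M1"
  then obtain a b where ab: "a \<in> MA" "b \<in> UB" "t = a \<oplus>\<^bsub>L\<^esub> b" by (auto simp: M1_eq set_add_def')
  then have "a \<in> carrier L" "b \<in> carrier L"
    using L.submoduleE(1)[OF MA_submodule] L.submoduleE(1)[OF UB_props(1)] by auto
  then have "x \<otimes>\<^bsub>L\<^esub> t = (x \<otimes>\<^bsub>L\<^esub> a) \<oplus>\<^bsub>L\<^esub> (x \<otimes>\<^bsub>L\<^esub> b)"
    using x LV_sub by (simp add: ab(3) L.lie_add_right)
  then show ?thesis using MA_act[OF x] UB_props(3)[OF x] ab by (simp add: M1_eq set_addI)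
qed

lemma M1_submodule_M: "submodule M1 K (L\<lparr>carrier := M\<rparr>)"
  using M1_M L.submoduleE(4,5)[OF M1_submodule] L.submodule_zero[OF M1_submodule]
  by (intro M.submoduleI_vs) auto

sublocale N: module K N
  unfolding N_eq by (rule M.quot_module[OF M1_submodule_M])

lemma N_carrier: "carrier N = (\<lambda>m. M1 +>\<^bsub>L\<^esub> m) ` M"
  using M.quot_carrier[of M1] by (simp add: N_eq)

lemma N_ops:
  "\<lbrakk>m \<in> M; n \<in> M\<rbrakk> \<Longrightarrow> (M1 +>\<^bsub>L\<^esub> m) \<oplus>\<^bsub>N\<^esub> (M1 +>\<^bsub>L\<^esub> n) = M1 +>\<^bsub>L\<^esub> (m \<oplus>\<^bsub>L\<^esub> n)"
  "\<lbrakk>c \<in> carrier K; m \<in> M\<rbrakk> \<Longrightarrow> c \<odot>\<^bsub>N\<^esub> (M1 +>\<^bsub>L\<^esub> m) = M1 +>\<^bsub>L\<^esub> (c \<odot>\<^bsub>L\<^esub> m)"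
  "\<zero>\<^bsub>N\<^esub> = M1" "M1 +>\<^bsub>L\<^esub> \<zero>\<^bsub>L\<^esub> = M1"
  using M.quot_add[OF M1_submodule_M, of m n] M.quot_smult[OF M1_submodule_M, of m c]
    M.quot_zero[of M1] L.coset_zero[OF M1_submodule]
  by (simp_all add: N_eq)

lemma actN_coset:
  assumes "x \<in> carrier LV" "m \<in> M"
  shows "actN (IA +>\<^bsub>L\<^esub> x) (M1 +>\<^bsub>L\<^esub> m) = M1 +>\<^bsub>L\<^esub> (x \<otimes>\<^bsub>L\<^esub> m)"
  unfolding actN_eq
  by (intro L.rcoset_mult_bracket IA_submodule M1_submodule)
    (use assms LV_sub M_sub M1_IA M1_act M1_M in auto)

sublocale N: lie_module K G N actN
proof (rule lie_module_natI)
  show "actN (x \<otimes>\<^bsub>G\<^esub> y) n \<oplus>\<^bsub>N\<^esub> actN y (actN x n) = actN x (actN y n)"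
    if "x \<in> carrier G" "y \<in> carrier G" "n \<in> carrier N" for x y n
    using that by (auto simp: G_carrier N_carrier G_ops actN_coset N_ops LV_closed M_closed
        L.leibniz[symmetric] LV_sub M_sub)
qed (auto simp: G_carrier N_carrier G_ops actN_coset N_ops LV_closed M_closed LV_sub M_sub
    L.lie_add_left L.lie_add_right L.lie_smult_left L.lie_smult_right
    intro: G.lie_algebra_axioms N.module_axioms)

sublocale FN: lie_algebra K FN by (rule free_lie_lie_algebra[OF K])

sublocale FN: lie_module K G FN actLN
  unfolding actLN_eq by (rule N.free_lie_module)

lemma actLN_bracket:
  "\<lbrakk>x \<in> carrier G; a \<in> carrier FN; b \<in> carrier FN\<rbrakk>
    \<Longrightarrow> actLN x (a \<otimes>\<^bsub>FN\<^esub> b) = (actLN x a \<otimes>\<^bsub>FN\<^esub> b) \<oplus>\<^bsub>FN\<^esub> (a \<otimes>\<^bsub>FN\<^esub> actLN x b)"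
  and actLN_gen: "\<lbrakk>x \<in> carrier G; n \<in> carrier N\<rbrakk> \<Longrightarrow> actLN x (genN n) = genN (actN x n)"
  unfolding actLN_eq
  by (fact lie_derivationsD(4)[OF N.free_lie_der_act(1)] N.free_lie_der_act(2))+

sublocale S: lie_algebra K S
  by (intro semidirect_lie_algebra FN.lie_algebra_axioms FN.lie_module_axioms actLN_bracket)

section \<open>The quotient by all relations\<close>

lemma AB_subset: "A \<union> B \<subseteq> carrier L"
  using A_incl IA_sub L.submoduleE(1)[OF B_submodule] by blast

lemma I_ideal: "lie_ideal K L I"
  unfolding I_eq by (intro L.ideal_gen_ideal AB_subset)

lemma I_submodule: "submodule I K L" using I_ideal by (simp add: lie_ideal_def)

lemma I_act: "\<lbrakk>x \<in> carrier L; a \<in> I\<rbrakk> \<Longrightarrow> x \<otimes>\<^bsub>L\<^esub> a \<in> I"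
  using I_ideal by (simp add: lie_ideal_def)

lemma AB_I: "A \<subseteq> I" "B \<subseteq> I"
  using L.ideal_gen_incl[of "A \<union> B"] by (auto simp: I_eq)

lemma IA_I: "IA \<subseteq> I"
proof -
  have "lie_ideal K LV (I \<inter> carrier LV)"
    unfolding lie_ideal_def using I_act LV_sub
    by (intro conjI LV.submoduleI_vs)
      (auto simp: LV_ops LV_closed L.submoduleE(4,5)[OF I_submodule] L.submodule_zero[OF I_submodule])
  moreover have "A \<subseteq> I \<inter> carrier LV" using AB_I A_incl IA_LV by blast
  ultimately have "IA \<subseteq> I \<inter> carrier LV" unfolding IA_eq by (intro LV.ideal_gen_minimal)
  then show ?thesis by blast
qed

lemma M1_I: "M1 \<subseteq> I"
  using IA_I AB_I by (intro M1_contained I_submodule) (auto intro: I_act M_sub LV_sub)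

sublocale Q: lie_algebra K Q
  unfolding Q_eq by (rule L.quot_lie_algebra[OF I_ideal])

lemma Q_carrier: "carrier Q = (\<lambda>x. I +>\<^bsub>L\<^esub> x) ` carrier L"
  by (simp add: Q_eq L.quot_carrier)

lemma Q_ops:
  "\<lbrakk>x \<in> carrier L; y \<in> carrier L\<rbrakk> \<Longrightarrow> (I +>\<^bsub>L\<^esub> x) \<oplus>\<^bsub>Q\<^esub> (I +>\<^bsub>L\<^esub> y) = I +>\<^bsub>L\<^esub> (x \<oplus>\<^bsub>L\<^esub> y)"
  "\<lbrakk>x \<in> carrier L; y \<in> carrier L\<rbrakk> \<Longrightarrow> (I +>\<^bsub>L\<^esub> x) \<otimes>\<^bsub>Q\<^esub> (I +>\<^bsub>L\<^esub> y) = I +>\<^bsub>L\<^esub> (x \<otimes>\<^bsub>L\<^esub> y)"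
  "\<lbrakk>c \<in> carrier K; x \<in> carrier L\<rbrakk> \<Longrightarrow> c \<odot>\<^bsub>Q\<^esub> (I +>\<^bsub>L\<^esub> x) = I +>\<^bsub>L\<^esub> (c \<odot>\<^bsub>L\<^esub> x)"
  "\<zero>\<^bsub>Q\<^esub> = I" "I +>\<^bsub>L\<^esub> \<zero>\<^bsub>L\<^esub> = I"
  by (simp_all add: Q_eq L.quot_add[OF I_submodule] L.quot_bracket[OF I_ideal] L.quot_smult[OF I_submodule]
      L.quot_zero L.coset_zero[OF I_submodule])

lemma Q_zero: "I +>\<^bsub>L\<^esub> \<zero>\<^bsub>L\<^esub> = \<zero>\<^bsub>Q\<^esub>" by (simp add: Q_ops)

text \<open>
  The union defining \<open>h\<close> sends a coset of any subspace of \<open>I\<close> to the coset of \<open>I\<close> containing it. Hence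
  \<open>h\<close> describes both the map on \<open>L(V)/\<langle>A\<rangle>\<close> and the linear map on \<open>N\<close> induced by inclusions.
\<close>

lemma h_coset:
  assumes T: "submodule T K L" "T \<subseteq> I" and x: "x \<in> carrier L"
  shows "h (T +>\<^bsub>L\<^esub> x) = I +>\<^bsub>L\<^esub> x"
  unfolding h_eq
proof (rule L.UN_coset[OF T(1) x])
  fix y assume "y \<in> T +>\<^bsub>L\<^esub> x"
  then show "I +>\<^bsub>L\<^esub> y = I +>\<^bsub>L\<^esub> x"
    using T L.mem_coset_iff[OF T(1) x] x by (auto simp: L.coset_eq_iff[OF I_submodule])
qed

lemma h_G: "x \<in> carrier LV \<Longrightarrow> h (IA +>\<^bsub>L\<^esub> x) = I +>\<^bsub>L\<^esub> x"
  and h_N: "m \<in> M \<Longrightarrow> h (M1 +>\<^bsub>L\<^esub> m) = I +>\<^bsub>L\<^esub> m"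
  by (simp_all add: h_coset IA_submodule IA_I M1_submodule M1_I LV_sub M_sub)

lemma h_hom: "h \<in> lie_hom K G Q"
  unfolding lie_hom_def
  by (auto simp: G_carrier Q_carrier G_ops h_G LV_closed Q_ops LV_sub)

lemmas h_homD = lie_homD[OF h_hom]

section \<open>From the semidirect product to the quotient\<close>

lemma genN_closed: "n \<in> carrier N \<Longrightarrow> genN n \<in> carrier FN" by (rule free_lie_gen_closed)

lemma genN_add_smult:
  "\<lbrakk>m \<in> carrier N; n \<in> carrier N\<rbrakk> \<Longrightarrow> genN (m \<oplus>\<^bsub>N\<^esub> n) = genN m \<oplus>\<^bsub>FN\<^esub> genN n"
  "\<lbrakk>c \<in> carrier K; m \<in> carrier N\<rbrakk> \<Longrightarrow> genN (c \<odot>\<^bsub>N\<^esub> m) = c \<odot>\<^bsub>FN\<^esub> genN m"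
  using free_lie_gen_add_smult[OF K N.module_axioms] by blast+

lemma genN_zero: "genN M1 = \<zero>\<^bsub>FN\<^esub>"
  using linear_zero[OF N.module_axioms FN.module_axioms, of genN]
  by (auto simp: genN_closed genN_add_smult N_ops)

text \<open>
  The homomorphism \<open>L(N) \<rightarrow> L/\<langle>A, B\<rangle>\<close> that extends \<open>m + M1 \<mapsto> m + \<langle>A, B\<rangle>\<close>.
\<close>

definition \<psi> where
  "\<psi> = (SOME F. F \<in> lie_hom K FN Q \<and> (\<forall>n\<in>carrier N. F (genN n) = h n))"

lemma \<psi>_spec: "\<psi> \<in> lie_hom K FN Q" "n \<in> carrier N \<Longrightarrow> \<psi> (genN n) = h n"
proof -
  have "\<exists>F\<in>lie_hom K FN Q. \<forall>n\<in>carrier N. F (genN n) = h n"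
    by (rule free_lie_lift[OF Q.lie_algebra_axioms])
      (auto simp: N_carrier Q_carrier N_ops h_N M_closed Q_ops M_sub)
  then have "\<psi> \<in> lie_hom K FN Q \<and> (\<forall>n\<in>carrier N. \<psi> (genN n) = h n)"
    unfolding \<psi>_def Bex_def by (rule someI_ex)
  then show "\<psi> \<in> lie_hom K FN Q" "n \<in> carrier N \<Longrightarrow> \<psi> (genN n) = h n" by auto
qed

lemmas \<psi>_homD = lie_homD[OF \<psi>_spec(1)]
lemmas \<psi>_zero = lie_hom_zero[OF FN.lie_algebra_axioms Q.lie_algebra_axioms \<psi>_spec(1)]

text \<open>
  On generators both sides are the coset of \<open>[x, m]\<close>. On brackets, the derivation rule on the left
  matches the Jacobi identity in the quotient on the right.
\<close>

lemma \<psi>_equivariant: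
  assumes g: "g \<in> carrier G" and n: "n \<in> carrier FN"
  shows "\<psi> (actLN g n) = h g \<otimes>\<^bsub>Q\<^esub> \<psi> n"
  using K n
proof (induction rule: free_lie_induct)
  case (gen n)
  obtain x m where "x \<in> carrier LV" "g = IA +>\<^bsub>L\<^esub> x" "m \<in> M" "n = M1 +>\<^bsub>L\<^esub> m"
    using g gen by (auto simp: G_carrier N_carrier)
  then show ?case
    using g gen by (simp add: actLN_gen \<psi>_spec N.act_closed) (simp add: actN_coset h_N h_G M_closed Q_ops LV_sub M_sub)
next
  case zero
  then show ?case using g h_homD(1)[OF g] by (simp add: FN.act_zero[OF FN.zero_closed] \<psi>_zero)
next
  case (bracket a b)
  then show ?case
    using g by (simp add: actLN_bracket \<psi>_homD FN.act_closed FN.lie_closed Q.leibniz[of "h g" "\<psi> a" "\<psi> b"] h_homD)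
qed (use g in \<open>simp_all add: FN.act_add_right FN.act_smult_right FN.act_closed \<psi>_homD h_homD Q.lie_add_right Q.lie_smult_right\<close>)

definition \<Psi> where "\<Psi> = (\<lambda>(g, n). h g \<oplus>\<^bsub>Q\<^esub> \<psi> n)"

text \<open>
  Equivariance of \<open>\<psi>\<close> is what turns the cross terms \<open>x\<cdot>b - y\<cdot>a\<close> of the semidirect product into the
  brackets \<open>[h x, \<psi> b] + [\<psi> a, h y]\<close>.
\<close>

lemma \<Psi>_hom: "\<Psi> \<in> lie_hom K S Q"
proof -
  have br: "\<Psi> ((x, a) \<otimes>\<^bsub>S\<^esub> (y, b)) = \<Psi> (x, a) \<otimes>\<^bsub>Q\<^esub> \<Psi> (y, b)"
    if xy: "x \<in> carrier G" "y \<in> carrier G" and ab: "a \<in> carrier FN" "b \<in> carrier FN" for x y a b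
  proof -
    have "\<psi> (actLN x b \<ominus>\<^bsub>FN\<^esub> actLN y a) = h x \<otimes>\<^bsub>Q\<^esub> \<psi> b \<ominus>\<^bsub>Q\<^esub> h y \<otimes>\<^bsub>Q\<^esub> \<psi> a"
      using xy ab
      by (simp add: lie_hom_minus[OF FN.lie_algebra_axioms Q.lie_algebra_axioms \<psi>_spec(1)] FN.act_closed \<psi>_equivariant)
    also have "\<dots> = h x \<otimes>\<^bsub>Q\<^esub> \<psi> b \<oplus>\<^bsub>Q\<^esub> \<psi> a \<otimes>\<^bsub>Q\<^esub> h y"
      using xy ab by (simp add: Q.M.minus_eq Q.anticommutative[of "\<psi> a" "h y"] h_homD \<psi>_homD)
    finally show ?thesis
      using xy ab
      by (simp add: \<Psi>_def semidirect_simps \<psi>_homD h_homD FN.act_closed FN.lie_closed Q.lie_closed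
          Q.lie_add_left Q.lie_add_right Q.M.a_ac)
  qed
  show ?thesis
    unfolding lie_hom_def
    using br by (auto simp: semidirect_simps(1)) 
      (auto simp: \<Psi>_def semidirect_simps h_homD \<psi>_homD Q.M.a_ac Q.smult_r_distr)
qed

section \<open>From the quotient to the semidirect product\<close>

text \<open>
  The homomorphism from \<open>L(V \<oplus> W)\<close> to the semidirect product that sends \<open>v\<close> to its class in the first
  factor and \<open>w\<close> to its class among the generators of \<open>L(N)\<close>. A linear map
  on \<open>V \<oplus> W\<close> with these values comes from the two projections, and freeness extends it.
\<close>

definition \<phi> where
  "\<phi> = (SOME F. F \<in> lie_hom K L S \<and>
    (\<forall>v\<in>V. \<forall>w\<in>W. F (genL (v \<oplus>\<^bsub>X\<^esub> w)) = (IA +>\<^bsub>L\<^esub> genL v, genN (M1 +>\<^bsub>L\<^esub> genL w))))"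

lemma \<phi>_spec: "\<phi> \<in> lie_hom K L S"
  "\<lbrakk>v \<in> V; w \<in> W\<rbrakk> \<Longrightarrow> \<phi> (genL (v \<oplus>\<^bsub>X\<^esub> w)) = (IA +>\<^bsub>L\<^esub> genL v, genN (M1 +>\<^bsub>L\<^esub> genL w))"
proof -
  obtain p q where pq: "\<And>v w. \<lbrakk>v \<in> V; w \<in> W\<rbrakk> \<Longrightarrow> p (v \<oplus>\<^bsub>X\<^esub> w) = v \<and> q (v \<oplus>\<^bsub>X\<^esub> w) = w"
    using direct_sum_projections[OF E V W VW] unfolding X_ops by blast
  define f where "f x = (IA +>\<^bsub>L\<^esub> genL (p x), genN (M1 +>\<^bsub>L\<^esub> genL (q x)))" for x
  have f: "f (v \<oplus>\<^bsub>X\<^esub> w) = (IA +>\<^bsub>L\<^esub> genL v, genN (M1 +>\<^bsub>L\<^esub> genL w))" if "v \<in> V" "w \<in> W" for v w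
    using pq that by (simp add: f_def)
  interpret X: module K X by (rule X_module)
  note VWc = E.submoduleE(4,5)[OF V, folded X_ops] E.submoduleE(4,5)[OF W, folded X_ops]
  note cc = VX[THEN subsetD] WX[THEN subsetD]
  have Nc: "M1 +>\<^bsub>L\<^esub> genL w \<in> carrier N" if "w \<in> W" for w
    using that M_gen by (auto simp: N_carrier)
  have "\<exists>F\<in>lie_hom K (free_lie K X) S. \<forall>x\<in>carrier X. F (genL x) = f x"
  proof (rule free_lie_lift[OF S.lie_algebra_axioms])
    fix x assume "x \<in> carrier X"
    then obtain v w where x: "v \<in> V" "w \<in> W" "x = v \<oplus>\<^bsub>X\<^esub> w" by (rule X_cases)
    then show "f x \<in> carrier S"
      using LV_gen genN_closed[OF Nc] by (auto simp: f semidirect_simps G_carrier)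
    show "f (c \<odot>\<^bsub>X\<^esub> x) = c \<odot>\<^bsub>S\<^esub> f x" if c: "c \<in> carrier K" for c
    proof -
      have "c \<odot>\<^bsub>X\<^esub> x = (c \<odot>\<^bsub>X\<^esub> v) \<oplus>\<^bsub>X\<^esub> (c \<odot>\<^bsub>X\<^esub> w)"
        using x c cc by (simp add: X.smult_r_distr)
      then show ?thesis
        using x c by (simp add: f VWc genL_add_smult cc semidirect_simps G_ops LV_gen
            N_ops(1,2)[symmetric] M_gen genN_add_smult Nc)
    qed
    fix y assume "y \<in> carrier X"
    then obtain v' w' where y: "v' \<in> V" "w' \<in> W" "y = v' \<oplus>\<^bsub>X\<^esub> w'" by (rule X_cases)
    have "x \<oplus>\<^bsub>X\<^esub> y = (v \<oplus>\<^bsub>X\<^esub> v') \<oplus>\<^bsub>X\<^esub> (w \<oplus>\<^bsub>X\<^esub> w')"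
      using x y cc by (simp add: X.M.a_ac)
    then show "f (x \<oplus>\<^bsub>X\<^esub> y) = f x \<oplus>\<^bsub>S\<^esub> f y"
      using x y by (simp add: f VWc genL_add_smult cc semidirect_simps G_ops LV_gen
            N_ops(1,2)[symmetric] M_gen genN_add_smult Nc)
  qed
  then have "\<exists>F. F \<in> lie_hom K L S \<and>
    (\<forall>v\<in>V. \<forall>w\<in>W. F (genL (v \<oplus>\<^bsub>X\<^esub> w)) = (IA +>\<^bsub>L\<^esub> genL v, genN (M1 +>\<^bsub>L\<^esub> genL w)))"
    unfolding L_eq[symmetric] using f X.M.a_closed cc by (metis (no_types, lifting))
  then have "\<phi> \<in> lie_hom K L S \<and>
    (\<forall>v\<in>V. \<forall>w\<in>W. \<phi> (genL (v \<oplus>\<^bsub>X\<^esub> w)) = (IA +>\<^bsub>L\<^esub> genL v, genN (M1 +>\<^bsub>L\<^esub> genL w)))"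
    unfolding \<phi>_def by (rule someI_ex)
  then show "\<phi> \<in> lie_hom K L S"
    "\<lbrakk>v \<in> V; w \<in> W\<rbrakk> \<Longrightarrow> \<phi> (genL (v \<oplus>\<^bsub>X\<^esub> w)) = (IA +>\<^bsub>L\<^esub> genL v, genN (M1 +>\<^bsub>L\<^esub> genL w))" by auto
qed

lemmas \<phi>_homD = lie_homD[OF \<phi>_spec(1)]
lemmas \<phi>_zero = lie_hom_zero[OF L.lie_algebra_axioms S.lie_algebra_axioms \<phi>_spec(1)]

lemma \<phi>_V: "v \<in> V \<Longrightarrow> \<phi> (genL v) = (IA +>\<^bsub>L\<^esub> genL v, \<zero>\<^bsub>FN\<^esub>)"
  and \<phi>_W: "w \<in> W \<Longrightarrow> \<phi> (genL w) = (\<zero>\<^bsub>G\<^esub>, genN (M1 +>\<^bsub>L\<^esub> genL w))"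
proof -
  interpret X: module K X by (rule X_module)
  have z: "\<zero>\<^bsub>X\<^esub> \<in> V" "\<zero>\<^bsub>X\<^esub> \<in> W" using VW by (auto simp: X_ops)
  show "v \<in> V \<Longrightarrow> \<phi> (genL v) = (IA +>\<^bsub>L\<^esub> genL v, \<zero>\<^bsub>FN\<^esub>)"
    using \<phi>_spec(2)[OF _ z(2), of v] VX by (simp add: subset_iff genL_zero N_ops genN_zero)
  show "w \<in> W \<Longrightarrow> \<phi> (genL w) = (\<zero>\<^bsub>G\<^esub>, genN (M1 +>\<^bsub>L\<^esub> genL w))"
    using \<phi>_spec(2)[OF z(1), of w] WX by (simp add: subset_iff genL_zero G_ops)
qed

text \<open>
  The condition defines a subalgebra of \<open>L(V)\<close>, and it holds on \<open>V\<close>.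
\<close>

lemma \<phi>_LV:
  assumes "x \<in> carrier LV"
  shows "\<phi> x = (IA +>\<^bsub>L\<^esub> x, \<zero>\<^bsub>FN\<^esub>)"
proof -
  have *: "IA +>\<^bsub>L\<^esub> x \<in> carrier G" if "x \<in> carrier LV" for x using that by (auto simp: G_carrier)
  show ?thesis
    using K VX assms[unfolded LV_carrier]
  proof (induction rule: term_classes_induct)
    case (add x y) then show ?case 
      unfolding LV_carrier[symmetric] L_eq[symmetric] by (simp add: \<phi>_homD LV_sub semidirect_simps G_ops)
  next
    case (smult c x) then show ?case 
      unfolding LV_carrier[symmetric] L_eq[symmetric] by (simp add: \<phi>_homD LV_sub semidirect_simps G_ops)
  next
    case (bracket x y) then show ?case 
      unfolding LV_carrier[symmetric] L_eq[symmetric] 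
      by (simp add: \<phi>_homD LV_sub semidirect_simps G_ops * FN.act_zero[OF FN.zero_closed] FN.M.minus_eq FN.M.r_neg)
  next
    case zero then show ?case
      unfolding L_eq[symmetric] by (simp add: \<phi>_zero semidirect_simps G_ops)
  qed (simp add: \<phi>_V)
qed

text \<open>
  The elements of \<open>M\<close> with this property form a subspace containing \<open>W\<close>. It is stable under
  \<open>L(V)\<close>, because bracketing \<open>(x, 0)\<close> with \<open>(0, n)\<close> in the semidirect product gives \<open>(0, x\<cdot>n)\<close>.
\<close>

lemma \<phi>_M:
  assumes "m \<in> M"
  shows "\<phi> m = (\<zero>\<^bsub>G\<^esub>, genN (M1 +>\<^bsub>L\<^esub> m))"
proof -
  have Nc: "M1 +>\<^bsub>L\<^esub> m \<in> carrier N" if "m \<in> M" for m using that by (auto simp: N_carrier)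
  define T where "T = {m \<in> M. \<phi> m = (\<zero>\<^bsub>G\<^esub>, genN (M1 +>\<^bsub>L\<^esub> m))}"
  have "M \<subseteq> T"
  proof (rule M_minimal)
    show "submodule T K L"
    proof (rule L.submoduleI_vs)
      show "\<zero>\<^bsub>L\<^esub> \<in> T" by (simp add: T_def M_closed \<phi>_zero N_ops genN_zero semidirect_simps)
    qed (auto simp: T_def M_sub M_closed \<phi>_homD semidirect_simps N_ops(1,2)[symmetric] genN_add_smult Nc)
    show "genL w \<in> T" if "w \<in> W" for w using that by (simp add: T_def M_gen \<phi>_W)
    fix x t assume x: "x \<in> carrier LV" and "t \<in> T"
    then have t: "t \<in> M" "\<phi> t = (\<zero>\<^bsub>G\<^esub>, genN (M1 +>\<^bsub>L\<^esub> t))" by (auto simp: T_def)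
    have xg: "IA +>\<^bsub>L\<^esub> x \<in> carrier G" using x by (auto simp: G_carrier)
    have "\<phi> (x \<otimes>\<^bsub>L\<^esub> t) = (\<zero>\<^bsub>G\<^esub>, actLN (IA +>\<^bsub>L\<^esub> x) (genN (M1 +>\<^bsub>L\<^esub> t)))"
      using x t xg genN_closed[OF Nc[OF t(1)]]
      by (simp add: \<phi>_homD LV_sub M_sub \<phi>_LV semidirect_simps FN.act_zero[OF FN.zero_closed G.zero_closed]
          FN.act_closed FN.M.minus_eq FN.M.minus_equality[of "\<zero>\<^bsub>FN\<^esub>" "\<zero>\<^bsub>FN\<^esub>"])
    then show "x \<otimes>\<^bsub>L\<^esub> t \<in> T"
      using x t xg by (simp add: T_def M_closed actLN_gen Nc actN_coset)
  qed
  then show ?thesis using assms by (auto simp: T_def)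
qed

text \<open>
  By the two previous lemmas, \<open>\<phi>\<close> maps \<open>a \<in> A\<close> to its class modulo \<open>\<langle>A\<rangle>\<close> and \<open>b \<in> B\<close> to its class
  modulo \<open>M1\<close>. Both vanish, and the kernel of \<open>\<phi>\<close> is an ideal.
\<close>

lemma \<phi>_I: "x \<in> I \<Longrightarrow> \<phi> x = \<zero>\<^bsub>S\<^esub>"
proof -
  have "A \<union> B \<subseteq> {x \<in> carrier L. \<phi> x = \<zero>\<^bsub>S\<^esub>}"
  proof (intro Un_least subsetI CollectI conjI)
    fix a assume a: "a \<in> A"
    then have "a \<in> IA" using A_incl by blast
    then show "\<phi> a = \<zero>\<^bsub>S\<^esub>"
      using IA_LV by (simp add: \<phi>_LV subset_iff semidirect_simps G_ops L.coset_eq_self_iff[OF IA_submodule IA_sub])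
  next
    fix b assume "b \<in> B"
    then have "b \<in> M1" "b \<in> M" using M1_B B_M by auto
    then show "\<phi> b = \<zero>\<^bsub>S\<^esub>"
      using L.coset_eq_self_iff[OF M1_submodule M_sub, of b] by (simp add: \<phi>_M semidirect_simps genN_zero)
  qed (use AB_subset in auto)
  then have "I \<subseteq> {x \<in> carrier L. \<phi> x = \<zero>\<^bsub>S\<^esub>}"
    unfolding I_eq
    by (intro L.ideal_gen_minimal lie_hom_kernel_ideal L.lie_algebra_axioms S.lie_algebra_axioms \<phi>_spec(1))
  then show "x \<in> I \<Longrightarrow> \<phi> x = \<zero>\<^bsub>S\<^esub>" by blast
qed

definition \<Phi> where
  "\<Phi> = (SOME F. F \<in> lie_hom K Q S \<and> (\<forall>x\<in>carrier L. F (I +>\<^bsub>L\<^esub> x) = \<phi> x))"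

lemma \<Phi>_spec: "\<Phi> \<in> lie_hom K Q S" "x \<in> carrier L \<Longrightarrow> \<Phi> (I +>\<^bsub>L\<^esub> x) = \<phi> x"
proof -
  have "\<exists>F\<in>lie_hom K Q S. \<forall>x\<in>carrier L. F (I +>\<^bsub>L\<^esub> x) = \<phi> x"
    unfolding Q_eq
    by (rule lie_hom_factor[OF L.lie_algebra_axioms S.lie_algebra_axioms I_ideal \<phi>_spec(1) \<phi>_I])
  then have "\<Phi> \<in> lie_hom K Q S \<and> (\<forall>x\<in>carrier L. \<Phi> (I +>\<^bsub>L\<^esub> x) = \<phi> x)"
    unfolding \<Phi>_def Bex_def by (rule someI_ex)
  then show "\<Phi> \<in> lie_hom K Q S" "x \<in> carrier L \<Longrightarrow> \<Phi> (I +>\<^bsub>L\<^esub> x) = \<phi> x" by auto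
qed

lemmas \<Phi>_homD = lie_homD[OF \<Phi>_spec(1)]
lemmas \<Psi>_homD = lie_homD[OF \<Psi>_hom]

section \<open>The two homomorphisms are inverse to each other\<close>

lemma \<Psi>_\<phi>:
  assumes "x \<in> carrier L"
  shows "\<Psi> (\<phi> x) = I +>\<^bsub>L\<^esub> x"
  using K assms[unfolded L_eq]
proof (induction rule: free_lie_induct)
  case (gen x)
  then obtain v w where x: "v \<in> V" "w \<in> W" "x = v \<oplus>\<^bsub>X\<^esub> w" by (rule X_cases)
  have "M1 +>\<^bsub>L\<^esub> genL w \<in> carrier N" using x M_gen by (auto simp: N_carrier)
  moreover have "genL v \<in> carrier L" "genL w \<in> carrier L" "v \<in> carrier X" "w \<in> carrier X"
    using x VX WX genL_closed by auto
  moreover have "\<phi> (genL x) = (IA +>\<^bsub>L\<^esub> genL v, genN (M1 +>\<^bsub>L\<^esub> genL w))" using x \<phi>_spec(2) by simp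
  ultimately show ?case
    using x by (simp add: \<Psi>_def h_G LV_gen \<psi>_spec h_N M_gen Q_ops genL_add_smult)
next
  case zero
  have "\<Psi> (\<zero>\<^bsub>S\<^esub>) = \<zero>\<^bsub>Q\<^esub>" by (rule lie_hom_zero[OF S.lie_algebra_axioms Q.lie_algebra_axioms \<Psi>_hom])
  then show ?case unfolding L_eq[symmetric] by (simp add: \<phi>_zero Q_ops)
qed (unfold L_eq[symmetric], simp_all add: \<phi>_homD \<Psi>_homD Q_ops)

lemma \<Phi>_h: "g \<in> carrier G \<Longrightarrow> \<Phi> (h g) = (g, \<zero>\<^bsub>FN\<^esub>)"
  by (auto simp: G_carrier h_G \<Phi>_spec LV_sub \<phi>_LV)

lemma \<Phi>_\<psi>:
  assumes "n \<in> carrier FN"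
  shows "\<Phi> (\<psi> n) = (\<zero>\<^bsub>G\<^esub>, n)"
  using K assms
proof (induction rule: free_lie_induct)
  case (gen n)
  then show ?case by (auto simp: \<psi>_spec N_carrier h_N \<Phi>_spec M_sub \<phi>_M)
next
  case zero
  show ?case
    using lie_hom_zero[OF Q.lie_algebra_axioms S.lie_algebra_axioms \<Phi>_spec(1)] by (simp add: \<psi>_zero semidirect_simps)
next
  case (bracket a b)
  then show ?case
    by (simp add: \<psi>_homD \<Phi>_homD semidirect_simps FN.act_zero[OF _ G.zero_closed] FN.M.minus_eq
        FN.M.minus_equality[of "\<zero>\<^bsub>FN\<^esub>" "\<zero>\<^bsub>FN\<^esub>"] FN.lie_closed)
qed (simp_all add: \<psi>_homD \<Phi>_homD semidirect_simps)

lemma \<Phi>_\<Psi>: "p \<in> carrier S \<Longrightarrow> \<Phi> (\<Psi> p) = p"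
  by (auto simp: semidirect_simps \<Psi>_def \<Phi>_homD h_homD \<psi>_homD \<Phi>_h \<Phi>_\<psi>)

lemma \<Psi>_\<Phi>: "y \<in> carrier Q \<Longrightarrow> \<Psi> (\<Phi> y) = y"
  by (auto simp: Q_carrier \<Phi>_spec \<Psi>_\<phi>)

lemma \<Phi>_iso: "\<Phi> \<in> lie_iso K Q S"
  unfolding lie_iso_def
  by (intro CollectI conjI \<Phi>_spec(1) bij_betw_byWitness[of _ \<Psi>]) (auto simp: \<Phi>_\<Psi> \<Psi>_\<Phi> \<Phi>_homD(1) \<Psi>_homD(1))

section \<open>The ideal generated by \<open>W\<close>\<close>

lemma J_gen_subset: "(\<lambda>w. I +>\<^bsub>L\<^esub> genL w) ` W \<subseteq> carrier Q"
  using genL_closed WX by (auto simp: Q_carrier)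

lemma J_ideal: "lie_ideal K Q J"
  unfolding J_eq by (rule Q.ideal_gen_ideal[OF J_gen_subset])

lemma J_submodule: "submodule J K Q" using J_ideal by (simp add: lie_ideal_def)

lemma J_act: "\<lbrakk>y \<in> carrier Q; a \<in> J\<rbrakk> \<Longrightarrow> y \<otimes>\<^bsub>Q\<^esub> a \<in> J"
  using J_ideal by (simp add: lie_ideal_def)

lemmas J_sub = Q.submoduleE(1)[OF J_submodule, THEN subsetD]
lemmas J_closed = Q.submoduleE(4,5)[OF J_submodule] Q.submodule_zero[OF J_submodule]

lemma M_J: "m \<in> M \<Longrightarrow> I +>\<^bsub>L\<^esub> m \<in> J"
proof -
  have "M \<subseteq> {m \<in> carrier L. I +>\<^bsub>L\<^esub> m \<in> J}"
  proof (rule M_minimal)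
    show "submodule {m \<in> carrier L. I +>\<^bsub>L\<^esub> m \<in> J} K L"
      using J_closed by (intro L.submoduleI_vs) (auto simp: Q_ops(1-3)[symmetric] Q_zero)
    show "genL w \<in> {m \<in> carrier L. I +>\<^bsub>L\<^esub> m \<in> J}" if "w \<in> W" for w
      using that Q.ideal_gen_incl[of "(\<lambda>w. I +>\<^bsub>L\<^esub> genL w) ` W"] gen_W by (auto simp: J_eq)
    show "x \<otimes>\<^bsub>L\<^esub> t \<in> {m \<in> carrier L. I +>\<^bsub>L\<^esub> m \<in> J}"
      if "x \<in> carrier LV" "t \<in> {m \<in> carrier L. I +>\<^bsub>L\<^esub> m \<in> J}" for x t
      using that LV_sub by (auto simp: Q_ops(2)[symmetric] Q_carrier L.lie_closed intro!: J_act)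
  qed
  then show "m \<in> M \<Longrightarrow> I +>\<^bsub>L\<^esub> m \<in> J" by blast
qed

text \<open>
  For \<open>\<subseteq>\<close>, the generators \<open>m + M1\<close> of \<open>L(N)\<close> go to cosets of elements of \<open>M\<close>, which lie in \<open>J\<close>. For
  \<open>\<supseteq>\<close>, the image contains \<open>W\<close> and is an ideal: every \<open>y\<close> in the quotient has the form \<open>h g + \<psi> a\<close>,
  and bracketing \<open>\<psi> n\<close> with it gives \<open>\<psi> (g\<cdot>n + [a, n])\<close>.
\<close>

lemma \<psi>_image: "\<psi> ` carrier FN = J"
proof
  have "\<psi> n \<in> J" if "n \<in> carrier FN" for n
    using K that
  proof (induction rule: free_lie_induct)
    case (gen n)
    then show ?case by (auto simp: \<psi>_spec N_carrier h_N M_J)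
  qed (auto simp: \<psi>_zero \<psi>_homD J_closed intro: J_act J_sub)
  then show "\<psi> ` carrier FN \<subseteq> J" by blast
  have "lie_ideal K Q (\<psi> ` carrier FN)"
    unfolding lie_ideal_def
  proof (intro conjI ballI Q.submoduleI_vs)
    show "\<zero>\<^bsub>Q\<^esub> \<in> \<psi> ` carrier FN" using \<psi>_zero by (metis FN.zero_closed imageI)
    fix y b assume y: "y \<in> carrier Q" and "b \<in> \<psi> ` carrier FN"
    then obtain n where n: "n \<in> carrier FN" "b = \<psi> n" by auto
    obtain g a where ga: "\<Phi> y = (g, a)" by fastforce
    then have c: "g \<in> carrier G" "a \<in> carrier FN" using \<Phi>_homD(1)[OF y] by (auto simp: semidirect_simps)
    have "y = h g \<oplus>\<^bsub>Q\<^esub> \<psi> a" using \<Psi>_\<Phi>[OF y] ga by (simp add: \<Psi>_def)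
    then have "y \<otimes>\<^bsub>Q\<^esub> b = \<psi> (actLN g n \<oplus>\<^bsub>FN\<^esub> a \<otimes>\<^bsub>FN\<^esub> n)"
      using n c by (simp add: Q.lie_add_left \<psi>_homD h_homD \<psi>_equivariant FN.act_closed FN.lie_closed)
    then show "y \<otimes>\<^bsub>Q\<^esub> b \<in> \<psi> ` carrier FN"
      using n c FN.act_closed FN.lie_closed by auto
  qed (auto simp: \<psi>_homD(1) \<psi>_homD(2,3)[symmetric])
  moreover have "(\<lambda>w. I +>\<^bsub>L\<^esub> genL w) ` W \<subseteq> \<psi> ` carrier FN"
  proof clarify
    fix w assume w: "w \<in> W"
    then have "M1 +>\<^bsub>L\<^esub> genL w \<in> carrier N" using M_gen by (auto simp: N_carrier)
    moreover from this have "\<psi> (genN (M1 +>\<^bsub>L\<^esub> genL w)) = I +>\<^bsub>L\<^esub> genL w"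
      using w by (simp add: \<psi>_spec h_N M_gen)
    ultimately show "I +>\<^bsub>L\<^esub> genL w \<in> \<psi> ` carrier FN" using genN_closed by (metis imageI)
  qed
  ultimately show "J \<subseteq> \<psi> ` carrier FN" unfolding J_eq by (intro Q.ideal_gen_minimal)
qed

lemma J_module: "lie_module K G (Q\<lparr>carrier := J\<rparr>) actJ"
proof (rule lie_module_natI)
  show "module K (Q\<lparr>carrier := J\<rparr>)"
    by (rule submodule.submodule_is_module[OF J_submodule Q.module_axioms])
  show "actJ (x \<otimes>\<^bsub>G\<^esub> y) n \<oplus>\<^bsub>Q\<lparr>carrier := J\<rparr>\<^esub> actJ y (actJ x n) = actJ x (actJ y n)"
    if "x \<in> carrier G" "y \<in> carrier G" "n \<in> carrier (Q\<lparr>carrier := J\<rparr>)" for x y n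
    using that by (simp add: actJ_eq h_homD J_sub Q.leibniz[symmetric])
qed (auto simp: actJ_eq h_homD J_sub J_act Q.lie_add_left Q.lie_add_right Q.lie_smult_left
    Q.lie_smult_right intro: G.lie_algebra_axioms)

lemma \<psi>_iso: "\<psi> \<in> lie_module_iso K G FN actLN (Q\<lparr>carrier := J\<rparr>) actJ"
proof -
  have "inj_on \<psi> (carrier FN)" 
    by (rule inj_on_inverseI[of _ "\<lambda>y. snd (\<Phi> y)"]) (simp add: \<Phi>_\<psi>)
  then show ?thesis
    by (simp add: lie_module_iso_def bij_betw_def \<psi>_image \<psi>_homD \<psi>_equivariant actJ_eq)
qed

end

section \<open>Structure of the quotient\<close>

theorem theorem2:
  fixes K :: "('k, 'i) ring_scheme" and E :: "('k, 'x, 'j) module_scheme"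
    and V W :: "'x set"
  assumes "field K" and "module K E" and "submodule V K E" and "submodule W K E"
    and "V \<inter> W = {\<zero>\<^bsub>E\<^esub>}"
    and X_eq: "X = E\<lparr>carrier := V <+>\<^bsub>E\<^esub> W\<rparr>"
    and L_eq: "L = free_lie K X"
    and LV_eq: "LV = L\<lparr>carrier := free_lie_sub K X V\<rparr>"
    and M_eq: "M = uea_span K L (carrier LV) (free_lie_gen K X ` W)"
    and A_subspace: "submodule A K LV"
    and B_subspace: "submodule B K (L\<lparr>carrier := M\<rparr>)"
    and IA_eq: "IA = ideal_gen K LV A"
    and G_eq: "G = lie_quot LV IA"
    and M1_eq: "M1 = lin_span K L {m \<otimes>\<^bsub>L\<^esub> a | m a. m \<in> M \<and> a \<in> IA} <+>\<^bsub>L\<^esub> uea_span K L (carrier LV) B"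
    and N_eq: "N = lie_quot (L\<lparr>carrier := M\<rparr>) M1"
    and actN_eq: "actN = (\<lambda>g n. [mod M1:] g \<Otimes>\<^bsub>L\<^esub> n)"
    and actLN_eq: "actLN = (\<lambda>g. free_lie_der K N (actN g))"
    and I_eq: "I = ideal_gen K L (A \<union> B)"
    and Q_eq: "Q = lie_quot L I"
    and J_eq: "J = ideal_gen K Q ((\<lambda>w. I +>\<^bsub>L\<^esub> free_lie_gen K X w) ` W)"
    and h_eq: "h = (\<lambda>g. \<Union>x\<in>g. I +>\<^bsub>L\<^esub> x)"
    and actJ_eq: "actJ = (\<lambda>g y. h g \<otimes>\<^bsub>Q\<^esub> y)"
  shows "
    (lie_module K G N actN \<and>
      (\<forall>x\<in>carrier LV. \<forall>m\<in>M. actN (IA +>\<^bsub>L\<^esub> x) (M1 +>\<^bsub>L\<^esub> m) = M1 +>\<^bsub>L\<^esub> (x \<otimes>\<^bsub>L\<^esub> m))) \<and>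
    (lie_module K G (free_lie K N) actLN \<and>
      lie_module K G (Q\<lparr>carrier := J\<rparr>) actJ \<and>
      (\<exists>f. f \<in> lie_module_iso K G (free_lie K N) actLN (Q\<lparr>carrier := J\<rparr>) actJ)) \<and>
    (\<exists>f. f \<in> lie_iso K Q (lie_semidirect G (free_lie K N) actLN))"
proof -
  interpret free_lie_relations K E V W X L LV M A B IA G M1 N actN actLN I Q J h actJ
    by (rule free_lie_relations.intro) (fact assms)+
  show ?thesis
    using N.lie_module_axioms actN_coset FN.lie_module_axioms J_module \<psi>_iso \<Phi>_iso by blast
qed

end
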